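(* Let $d$, $D$ and $\ell$ be constants, and let $V$ be a set of $n$ fat objects in $\mathbb{R}^d$. Suppose that for each $v\in V$ we are given points $p_1(v),\ldots,p_\ell(v)\in\mathbb{R}^D$ and semi-algebraic sets $S_1(v),\ldots,S_\ell(v)\subset\mathbb{R}^D$ of constant description complexity satisfying the following property: two objects $u,v\in V$ intersect if and only if $\Phi([p_1(u)\in S_1(v)],\ldots,[p_\ell(u)\in S_\ell(v)])$ holds, where $\Phi$ is an $\ell$-variate Boolean formula. Then the intersection graph $G$ of $V$ has a 2-hop spanner with $O^*\!\left(n^{\frac{3D-2}{2D-1}}\right)=O^*\!\left(n^{\frac{3}{2}-\frac{1}{2(2D-1)}}\right)$ edges.
   Context: The intersection graph of a family of sets has one vertex per set and an (unweighted) edge between two distinct sets iff they have nonempty intersection. For a simple graph $G=(V,E)$, a $t$-hop spanner is a spanning subgraph $G'=(V,E')$, $E'\subseteq E$, with $d_{G'}(x,y)\le t\cdot d_G(x,y)$ for all $x,y\in V$, where $d_G$ is the shortest-path (hop) distance. A family of objects in $\mathbb{R}^d$ is fat if for every axis-aligned hypercube $\gamma$ with side length $s$, there exist $O(1)$ points (i.e., at most some constant number $c$ of points, $c$ independent of $n$ and $\gamma$) hitting all objects of the family that intersect $\gamma$ and have diameter at least $s$; a set of points hits an object if the object contains at least one of the points. $[\,\cdot\,]$ denotes the truth value of a statement. A semi-algebraic set in $\mathbb{R}^D$ has constant description complexity if it is defined by a Boolean combination of a constant number of polynomial inequalities of constant degree (constants uniform over all sets in question). $O^*(\cdot)$ hides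 factors $n^{\varepsilon}$: $f(n)=O^*(n^a)$ means that for every $\varepsilon>0$, $f(n)=O(n^{a+\varepsilon})$, where the implied constant may depend on $\varepsilon$, $d$, $D$, $\ell$, the fatness constant and the description complexity bound. *)

theory Defs
  imports "HOL-Analysis.Analysis" "HOL-Library.Landau_Symbols" "HOL-Library.Extended_Nat"
begin

text \<open>Simple graphs are given by a vertex set and a set of two-element vertex sets.\<close>

definition intersection_edges :: "'a set set \<Rightarrow> 'a set set set" where
  "intersection_edges V = {{u, v} | u v. u \<in> V \<and> v \<in> V \<and> u \<noteq> v \<and> u \<inter> v \<noteq> {}}"

text \<open>The relational power collects the pairs joined by a walk with exactly \<open>k\<close> edges;
  the distance is \<open>\<infinity>\<close> if there is no walk, the infimum of the empty set in \<^typ>\<open>enat\<close>.\<close>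

definition hop_dist :: "'v set set \<Rightarrow> 'v \<Rightarrow> 'v \<Rightarrow> enat" where
  "hop_dist E x y = (INF k \<in> {k. (x, y) \<in> {(a, b). {a, b} \<in> E} ^^ k}. enat k)"

definition hop_spanner :: "nat \<Rightarrow> 'v set \<Rightarrow> 'v set set \<Rightarrow> 'v set set \<Rightarrow> bool" where
  "hop_spanner t V E E' \<longleftrightarrow>
     E' \<subseteq> E \<and> (\<forall>x\<in>V. \<forall>y\<in>V. hop_dist E' x y \<le> enat t * hop_dist E x y)"

text \<open>The library's \<^const>\<open>diameter\<close> is only meaningful on bounded sets (it is not \<open>\<infinity>\<close> on
  unbounded ones); an unbounded object has diameter at least \<open>s\<close> for every \<open>s\<close>.\<close>

definition fat_family :: "nat \<Rightarrow> (real ^ 'd) set set \<Rightarrow> bool" where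
  "fat_family c V \<longleftrightarrow>
     (\<forall>a s. s > 0 \<longrightarrow>
        (\<exists>P. finite P \<and> card P \<le> c \<and>
             (\<forall>v\<in>V. v \<inter> cbox a (a + (\<chi> i. s)) \<noteq> {} \<and> (\<not> bounded v \<or> diameter v \<ge> s)
                \<longrightarrow> P \<inter> v \<noteq> {})))"

definition polynomial_deg_le :: "nat \<Rightarrow> (real ^ 'D \<Rightarrow> real) \<Rightarrow> bool" where
  "polynomial_deg_le k f \<longleftrightarrow>
     (\<exists>a. \<forall>x. f x = (\<Sum>\<alpha> | (\<Sum>i\<in>UNIV. \<alpha> i) \<le> k. a \<alpha> * (\<Prod>i\<in>UNIV. (x $ i) ^ \<alpha> i)))"

text \<open>At most \<open>b\<close> polynomial inequalities of degree at most \<open>b\<close>, combined by an arbitrary truth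
  function \<open>B\<close>. The atoms \<open>f x \<ge> 0\<close> suffice: the other inequalities arise by replacing \<open>f\<close>
  with \<open>- f\<close> and by negation inside \<open>B\<close>.\<close>

definition semialgebraic_complexity_le :: "nat \<Rightarrow> (real ^ 'D) set \<Rightarrow> bool" where
  "semialgebraic_complexity_le b S \<longleftrightarrow>
     (\<exists>fs B. length fs \<le> b \<and> (\<forall>f\<in>set fs. polynomial_deg_le b f) \<and>
             S = {x. B (map (\<lambda>f. f x \<ge> 0) fs)})"

text \<open>The class \<open>O\<^sup>*(n\<^sup>a)\<close>.\<close>

definition O_star_powr :: "real \<Rightarrow> (nat \<Rightarrow> real) set" where
  "O_star_powr a = {f. \<forall>\<epsilon>>0. f \<in> O(\<lambda>n. real n powr (a + \<epsilon>))}"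

end

theory Submission
  imports Defs "HOL-Homology.Homology" "HOL-Computational_Algebra.Polynomial"
begin

text \<open>A quadtree-type decomposition of the witness points of the intersecting pairs reduces the
  problem to groups \<open>(U, Q)\<close>, where all objects of \<open>Q\<close> share a point; by fatness the groups have
  near-linear total size. As \<open>Q\<close> is a clique, a star inside a part of \<open>Q\<close> serves, with one edge, any
  \<open>u \<in> U\<close> that meets every object of that part. Such parts come from a Guth--Katz polynomial
  partition of the points \<open>p\<^sub>i(v)\<close>: the boundary of \<open>S\<^sub>i(u)\<close> crosses only few of its cells, and one
  recurses in the crossed ones. Ham-sandwich cuts need the Borsuk--Ulam theorem, and the number of
  cells is bounded by counting critical points.

  After a slight perturbation the points are generic: they avoid every zero set that occurs, so
  that no lower-dimensional recursion is needed. The spanner for a given \<open>V\<close> is chosen with the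
  least number of edges, so that it obeys the bounds for all \<open>\<epsilon>\<close> at once.\<close>

subsection \<open>The Borsuk--Ulam theorem for Lipschitz maps\<close>

text \<open>The exponent comes from balancing one recursion. Write m = card Q, n = card U, N for the
  number of objects and D for the dimension. Joining all pairs in Q costs about m^2 + n, which is
  cheap once m^2 <= n. A partition into about r^D parts of size m / r^D, of which each range crosses
  about r^(D-1), multiplies a cost (m^2)^\<beta> n^(1-\<beta>) by r to the power -2 D \<beta> + D
  \<beta> + (D-1)(1-\<beta>), by concavity. This power vanishes exactly for \<beta> = (D-1)/(2D-1),
  and m = n = N then gives N^(1+\<beta>) with 1 + \<beta> = (3D-2)/(2D-1). Slack factors N^\<delta>
  absorb logarithms and make the recursion contract. The restriction to Lipschitz maps has one
  reason: the degree argument needs the image of an equator to miss a point of the larger sphere. A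
  continuous map may fill that sphere, a Lipschitz map cannot, by counting. The ham-sandwich theorem
  applies Borsuk-Ulam to clamped sums only, which are Lipschitz.\<close>

lemma topspace_nsphere:
  "topspace (nsphere n) = {x. (\<Sum>i\<le>n. x i ^ 2) = 1 \<and> (\<forall>i>n. x i = 0)}"
  by (simp add: nsphere)

text \<open>The points of \<open>nsphere n\<close> are sequences that vanish beyond index
  \<open>n\<close>; this is the inner product of the surrounding space of dimension n + 1.\<close>

definition iprod :: "nat \<Rightarrow> (nat \<Rightarrow> real) \<Rightarrow> (nat \<Rightarrow> real) \<Rightarrow> real" where
  "iprod n x y = (\<Sum>i\<le>n. x i * y i)"

text \<open>Written as a product with \<open>inverse\<close> rather than as a quotient, so that the
  closure rules for products yield both continuity and the Lipschitz property.\<close>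

definition unitize :: "nat \<Rightarrow> (nat \<Rightarrow> real) \<Rightarrow> nat \<Rightarrow> real" where
  "unitize n y = (\<lambda>i. if i \<le> n then y i * inverse (sqrt (iprod n y y)) else 0)"

lemma iprod_self: "iprod n x x = (\<Sum>i\<le>n. x i ^ 2)"
  by (simp add: iprod_def power2_eq_square)

lemma in_nsphere_iff: "x \<in> topspace (nsphere n) \<longleftrightarrow> iprod n x x = 1 \<and> (\<forall>i>n. x i = 0)"
  by (simp add: topspace_nsphere iprod_self)

lemma iprod_self_nonneg: "iprod n x x \<ge> 0"
  by (simp add: iprod_self sum_nonneg)

lemma iprod_self_pos: "iprod n x x > 0 \<longleftrightarrow> (\<exists>i\<le>n. x i \<noteq> 0)"
proof -
  have "iprod n x x = 0 \<longleftrightarrow> (\<forall>i\<le>n. x i = 0)"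
    unfolding iprod_self by (subst sum_nonneg_eq_0_iff) auto
  then show ?thesis using iprod_self_nonneg[of n x] by force
qed

lemma iprod_commute: "iprod n x y = iprod n y x"
  by (simp add: iprod_def mult.commute)

lemma iprod_minus_left: "iprod n (\<lambda>i. - x i) y = - iprod n x y"
  by (simp add: iprod_def sum_negf)

lemma iprod_minus_right: "iprod n x (\<lambda>i. - y i) = - iprod n x y"
  by (simp add: iprod_def sum_negf)

lemma iprod_lincomb_left: "iprod n (\<lambda>i. a * x i + b * y i) z = a * iprod n x z + b * iprod n y z"
  by (simp add: iprod_def sum.distrib sum_distrib_left algebra_simps)

lemma iprod_lincomb_right: "iprod n z (\<lambda>i. a * x i + b * y i) = a * iprod n z x + b * iprod n z y"
  using iprod_lincomb_left[of n a x b y z] by (simp add: iprod_commute)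

lemma iprod_self_lincomb:
  "iprod n (\<lambda>i. a * x i + b * y i) (\<lambda>i. a * x i + b * y i)
    = a\<^sup>2 * iprod n x x + 2 * a * b * iprod n x y + b\<^sup>2 * iprod n y y"
  using iprod_commute[of n x y]
  by (simp add: iprod_lincomb_left iprod_lincomb_right algebra_simps power2_eq_square)

lemma iprod_unitize:
  "iprod n x (unitize n y) = iprod n x y * inverse (sqrt (iprod n y y))"
  by (simp add: iprod_def unitize_def sum_distrib_right mult.assoc)

lemma unitize_in_nsphere:
  assumes "iprod n y y > 0"
  shows "unitize n y \<in> topspace (nsphere n)"
proof -
  have "iprod n (unitize n y) (unitize n y) = iprod n y y * (inverse (sqrt (iprod n y y)))\<^sup>2"
    by (simp add: iprod_def unitize_def sum_distrib_right power2_eq_square mult_ac)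
  also have "\<dots> = 1" using assms by (simp add: power_inverse)
  finally show ?thesis by (simp add: in_nsphere_iff unitize_def)
qed

lemma unitize_minus: "unitize n (\<lambda>i. - y i) = (\<lambda>i. - unitize n y i)"
  by (simp add: fun_eq_iff unitize_def iprod_minus_left iprod_minus_right)

lemma unitize_id: "x \<in> topspace (nsphere n) \<Longrightarrow> unitize n x = x"
  by (auto simp: fun_eq_iff unitize_def in_nsphere_iff)

lemma continuous_map_iprod:
  assumes "\<And>i. i \<le> n \<Longrightarrow> continuous_map X euclideanreal (\<lambda>x. f x i)"
    and "\<And>i. i \<le> n \<Longrightarrow> continuous_map X euclideanreal (\<lambda>x. g x i)"
  shows "continuous_map X euclideanreal (\<lambda>x. iprod n (f x) (g x))"
  unfolding iprod_def using assms by (intro continuous_intros) auto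

lemma continuous_map_inverse_sqrt:
  assumes "continuous_map X euclideanreal h" "\<And>x. x \<in> topspace X \<Longrightarrow> h x > 0"
  shows "continuous_map X euclideanreal (\<lambda>x. inverse (sqrt (h x)))"
proof -
  have "continuous_map X euclideanreal (\<lambda>x. sqrt (h x))"
    using assms(1) by (intro continuous_intros)
  moreover have "sqrt (h x) \<noteq> 0" if "x \<in> topspace X" for x
    using assms(2)[OF that] by simp
  ultimately show ?thesis by (intro continuous_map_real_inverse) auto
qed

lemma continuous_map_unitize:
  assumes "\<And>i. i \<le> n \<Longrightarrow> continuous_map X euclideanreal (\<lambda>x. f x i)"
    and "\<And>x. x \<in> topspace X \<Longrightarrow> iprod n (f x) (f x) > 0"
  shows "continuous_map X (nsphere n) (\<lambda>x. unitize n (f x))"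
  unfolding nsphere continuous_map_in_subtopology
proof
  have c: "continuous_map X euclideanreal (\<lambda>x. inverse (sqrt (iprod n (f x) (f x))))"
    using assms by (intro continuous_map_inverse_sqrt continuous_map_iprod) auto
  show "continuous_map X (powertop_real UNIV) (\<lambda>x. unitize n (f x))"
    unfolding continuous_map_componentwise_UNIV unitize_def
  proof
    fix i show "continuous_map X euclideanreal (\<lambda>x. if i \<le> n then f x i * inverse (sqrt (iprod n (f x) (f x))) else 0)"
      using assms(1)[of i] c by (cases "i \<le> n") (auto intro!: continuous_intros)
  qed
  show "(\<lambda>x. unitize n (f x)) \<in> topspace X \<rightarrow> {x. (\<Sum>i\<le>n. (x i)\<^sup>2) = 1 \<and> (\<forall>i>n. x i = 0)}"
    using unitize_in_nsphere assms(2) by (auto simp: topspace_nsphere)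
qed

lemma continuous_map_nsphere_component:
  "continuous_map X (nsphere n) f \<Longrightarrow> continuous_map X euclideanreal (\<lambda>x. f x i)"
  using continuous_map_compose[OF _ continuous_map_nsphere_projection, of X n f i] by (simp add: o_def)

text \<open>The segment from \<open>f x\<close> to \<open>g x\<close> misses the origin because the
  angle is acute, so its normalisation is a homotopy.\<close>

lemma Brouwer_degree2_eq_if_iprod_pos:
  assumes f: "continuous_map (nsphere n) (nsphere n) f"
    and g: "continuous_map (nsphere n) (nsphere n) g"
    and pos: "\<And>x. x \<in> topspace (nsphere n) \<Longrightarrow> iprod n (f x) (g x) > 0"
  shows "Brouwer_degree2 n f = Brouwer_degree2 n g"
proof -
  define v where "v = (\<lambda>(t::real, x) i. (1 - t) * f x i + t * g x i)"
  let ?X = "prod_topology (top_of_set {0..1::real}) (nsphere n)"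
  let ?h = "\<lambda>z. unitize n (v z)"
  have fx: "f x \<in> topspace (nsphere n)" "g x \<in> topspace (nsphere n)" if "x \<in> topspace (nsphere n)" for x
    using f g that continuous_map_image_subset_topspace by blast+
  have cf: "continuous_map ?X euclideanreal (\<lambda>z. f (snd z) i)"
    and cg: "continuous_map ?X euclideanreal (\<lambda>z. g (snd z) i)" for i
    using continuous_map_compose[OF continuous_map_snd continuous_map_nsphere_component[OF f, of i]]
      continuous_map_compose[OF continuous_map_snd continuous_map_nsphere_component[OF g, of i]]
    by (simp_all add: o_def)
  have ct: "continuous_map ?X euclideanreal fst"
    using continuous_map_fst continuous_map_in_subtopology by blast
  have "continuous_map ?X (nsphere n) ?h"
  proof (rule continuous_map_unitize)
    fix i
    show "continuous_map ?X euclideanreal (\<lambda>z. v z i)"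
      unfolding v_def case_prod_beta using cf[of i] cg[of i] ct by (intro continuous_intros)
  next
    fix z assume z: "z \<in> topspace ?X"
    obtain t x where zt: "z = (t, x)" by fastforce
    then have t: "0 \<le> t" "t \<le> 1" and x: "x \<in> topspace (nsphere n)" using z by auto
    have "iprod n (v z) (v z) = (1-t)\<^sup>2 + 2 * (1-t) * t * iprod n (f x) (g x) + t\<^sup>2"
      using fx[OF x] by (simp add: zt v_def iprod_self_lincomb in_nsphere_iff)
    moreover have "2 * (1-t) * t * iprod n (f x) (g x) \<ge> 0"
      using t pos[OF x] by simp
    moreover have "(1-t)\<^sup>2 + t\<^sup>2 > 0" by (cases "t = 0") (auto intro: add_nonneg_pos)
    ultimately show "iprod n (v z) (v z) > 0" by linarith
  qed
  moreover have "?h (0, x) = f x" "?h (1, x) = g x" if "x \<in> topspace (nsphere n)" for x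
    using unitize_id fx[OF that] by (simp_all add: v_def)
  ultimately have "homotopic_with (\<lambda>x. True) (nsphere n) (nsphere n) f g"
    by (subst homotopic_with) (auto intro!: exI[of _ ?h])
  then show ?thesis by (rule Brouwer_degree2_homotopic)
qed

text \<open>The sphere lives in an infinite product, where closed and bounded is not enough; the
  compact superset is a product of intervals, by Tychonoff's theorem.\<close>

lemma compact_topspace_nsphere: "compact (topspace (nsphere n))"
proof -
  let ?B = "PiE UNIV (\<lambda>i::nat. {-1..1::real})"
  have "compactin (powertop_real UNIV) ?B"
    by (subst compactin_PiE) auto
  then have B: "compact ?B" by (simp add: euclidean_product_topology)
  have "closed {x::nat\<Rightarrow>real. (\<Sum>i\<le>n. (x i)\<^sup>2) = 1}"
    by (intro closed_Collect_eq continuous_intros continuous_on_product_coordinates)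
  moreover have "closed {x::nat\<Rightarrow>real. x i = 0}" for i
    by (intro closed_Collect_eq continuous_intros continuous_on_product_coordinates)
  ultimately have cl: "closed (topspace (nsphere n))"
    unfolding topspace_nsphere by (intro closed_Collect_conj closed_Collect_all closed_Collect_imp) auto
  have "topspace (nsphere n) \<subseteq> ?B"
  proof (clarsimp simp: PiE_UNIV_domain)
    fix x i assume x: "x \<in> topspace (nsphere n)"
    have "(x i)\<^sup>2 \<le> 1"
    proof (cases "i \<le> n")
      case True
      then have "(x i)\<^sup>2 \<le> (\<Sum>i\<le>n. (x i)\<^sup>2)" by (intro member_le_sum) auto
      then show ?thesis using x by (simp add: topspace_nsphere)
    qed (use x in \<open>simp add: topspace_nsphere\<close>)
    then show "- 1 \<le> x i \<and> x i \<le> 1" by (simp add: abs_square_le_1 abs_le_iff)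
  qed
  then show ?thesis using compact_Int_closed[OF B cl] by (simp add: inf.absorb2)
qed

lemma nsphere_eq_top_of_set: "nsphere n = top_of_set (topspace (nsphere n))"
  by (simp add: nsphere euclidean_product_topology)

lemma nsphere_positive_lower_bound:
  assumes "continuous_map (nsphere n) euclideanreal h" "\<And>x. x \<in> topspace (nsphere n) \<Longrightarrow> h x > 0"
  shows "\<exists>\<rho>>0. \<forall>x\<in>topspace (nsphere n). h x \<ge> \<rho>"
proof -
  have "continuous_on (topspace (nsphere n)) h"
    using assms(1) nsphere_eq_top_of_set by (metis continuous_map_iff_continuous)
  moreover have "topspace (nsphere n) \<noteq> {}" using in_topspace_nsphere by blast
  ultimately obtain x where "x \<in> topspace (nsphere n)" "\<forall>y\<in>topspace (nsphere n). h x \<le> h y"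
    using continuous_attains_inf[OF compact_topspace_nsphere] by blast
  then show ?thesis using assms(2) by blast
qed

section \<open>Bounded Lipschitz functions on spheres\<close>

text \<open>The bound is carried along because products need it. In the sum distance single
  coordinates have Lipschitz constant 1, and restriction to the equator keeps all constants.\<close>

definition bdd_lipschitz :: "nat \<Rightarrow> ((nat \<Rightarrow> real) \<Rightarrow> real) \<Rightarrow> bool" where
  "bdd_lipschitz k h \<longleftrightarrow> (\<exists>B L. B \<ge> 0 \<and> L \<ge> 0 \<and>
     (\<forall>x\<in>topspace (nsphere k). \<bar>h x\<bar> \<le> B \<and>
       (\<forall>y\<in>topspace (nsphere k). \<bar>h x - h y\<bar> \<le> L * (\<Sum>i\<le>k. \<bar>x i - y i\<bar>))))"

lemma bdd_lipschitzI:
  assumes "B \<ge> 0" "L \<ge> 0" "\<And>x. x \<in> topspace (nsphere k) \<Longrightarrow> \<bar>h x\<bar> \<le> B"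
    "\<And>x y. x \<in> topspace (nsphere k) \<Longrightarrow> y \<in> topspace (nsphere k) \<Longrightarrow>
       \<bar>h x - h y\<bar> \<le> L * (\<Sum>i\<le>k. \<bar>x i - y i\<bar>)"
  shows "bdd_lipschitz k h"
  unfolding bdd_lipschitz_def using assms by blast

lemma bdd_lipschitzE:
  assumes "bdd_lipschitz k h"
  obtains B L where "B \<ge> 0" "L \<ge> 0" "\<And>x. x \<in> topspace (nsphere k) \<Longrightarrow> \<bar>h x\<bar> \<le> B"
    "\<And>x y. x \<in> topspace (nsphere k) \<Longrightarrow> y \<in> topspace (nsphere k) \<Longrightarrow>
       \<bar>h x - h y\<bar> \<le> L * (\<Sum>i\<le>k. \<bar>x i - y i\<bar>)"
  using assms unfolding bdd_lipschitz_def by blast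

lemma bdd_lipschitz_const: "bdd_lipschitz k (\<lambda>x. c)"
  by (rule bdd_lipschitzI[of "\<bar>c\<bar>" 0]) auto

lemma bdd_lipschitz_add:
  assumes "bdd_lipschitz k g" "bdd_lipschitz k h"
  shows "bdd_lipschitz k (\<lambda>x. g x + h x)"
proof -
  obtain B L where 1: "B \<ge> 0" "L \<ge> 0" "\<And>x. x \<in> topspace (nsphere k) \<Longrightarrow> \<bar>g x\<bar> \<le> B"
    "\<And>x y. x \<in> topspace (nsphere k) \<Longrightarrow> y \<in> topspace (nsphere k) \<Longrightarrow>
       \<bar>g x - g y\<bar> \<le> L * (\<Sum>i\<le>k. \<bar>x i - y i\<bar>)"
    using bdd_lipschitzE[OF assms(1)] by metis
  obtain B' L' where 2: "B' \<ge> 0" "L' \<ge> 0" "\<And>x. x \<in> topspace (nsphere k) \<Longrightarrow> \<bar>h x\<bar> \<le> B'"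
    "\<And>x y. x \<in> topspace (nsphere k) \<Longrightarrow> y \<in> topspace (nsphere k) \<Longrightarrow>
       \<bar>h x - h y\<bar> \<le> L' * (\<Sum>i\<le>k. \<bar>x i - y i\<bar>)"
    using bdd_lipschitzE[OF assms(2)] by metis
  show ?thesis
  proof (rule bdd_lipschitzI[of "B + B'" "L + L'"])
    fix x y assume "x \<in> topspace (nsphere k)" "y \<in> topspace (nsphere k)"
    then show "\<bar>g x + h x - (g y + h y)\<bar> \<le> (L + L') * (\<Sum>i\<le>k. \<bar>x i - y i\<bar>)"
      using 1(4)[of x y] 2(4)[of x y] unfolding distrib_right by linarith
  next
    fix x assume "x \<in> topspace (nsphere k)"
    then show "\<bar>g x + h x\<bar> \<le> B + B'" using 1(3)[of x] 2(3)[of x] by linarith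
  qed (use 1 2 in auto)
qed

lemma bdd_lipschitz_mult:
  assumes "bdd_lipschitz k g" "bdd_lipschitz k h"
  shows "bdd_lipschitz k (\<lambda>x. g x * h x)"
proof -
  obtain B L where 1: "B \<ge> 0" "L \<ge> 0" "\<And>x. x \<in> topspace (nsphere k) \<Longrightarrow> \<bar>g x\<bar> \<le> B"
    "\<And>x y. x \<in> topspace (nsphere k) \<Longrightarrow> y \<in> topspace (nsphere k) \<Longrightarrow>
       \<bar>g x - g y\<bar> \<le> L * (\<Sum>i\<le>k. \<bar>x i - y i\<bar>)"
    using bdd_lipschitzE[OF assms(1)] by metis
  obtain B' L' where 2: "B' \<ge> 0" "L' \<ge> 0" "\<And>x. x \<in> topspace (nsphere k) \<Longrightarrow> \<bar>h x\<bar> \<le> B'"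
    "\<And>x y. x \<in> topspace (nsphere k) \<Longrightarrow> y \<in> topspace (nsphere k) \<Longrightarrow>
       \<bar>h x - h y\<bar> \<le> L' * (\<Sum>i\<le>k. \<bar>x i - y i\<bar>)"
    using bdd_lipschitzE[OF assms(2)] by metis
  show ?thesis
  proof (rule bdd_lipschitzI[of "B * B'" "B * L' + B' * L"])
    fix x y assume xy: "x \<in> topspace (nsphere k)" "y \<in> topspace (nsphere k)"
    let ?d = "\<Sum>i\<le>k. \<bar>x i - y i\<bar>"
    have "\<bar>g x * h x - g y * h y\<bar> = \<bar>g x * (h x - h y) + h y * (g x - g y)\<bar>"
      by (simp add: algebra_simps)
    also have "\<dots> \<le> \<bar>g x\<bar> * \<bar>h x - h y\<bar> + \<bar>h y\<bar> * \<bar>g x - g y\<bar>"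
      by (metis abs_mult abs_triangle_ineq)
    also have "\<dots> \<le> B * (L' * ?d) + B' * (L * ?d)"
      using 1 2 xy by (intro add_mono mult_mono) auto
    finally show "\<bar>g x * h x - g y * h y\<bar> \<le> (B * L' + B' * L) * ?d"
      by (simp add: algebra_simps)
  next
    fix x assume "x \<in> topspace (nsphere k)"
    then show "\<bar>g x * h x\<bar> \<le> B * B'"
      unfolding abs_mult using 1 2 by (intro mult_mono) auto
  qed (use 1 2 in auto)
qed

lemma bdd_lipschitz_minus: "bdd_lipschitz k h \<Longrightarrow> bdd_lipschitz k (\<lambda>x. - h x)"
  using bdd_lipschitz_mult[OF bdd_lipschitz_const[of k "-1"]] by simp

lemma bdd_lipschitz_diff:
  "bdd_lipschitz k g \<Longrightarrow> bdd_lipschitz k h \<Longrightarrow> bdd_lipschitz k (\<lambda>x. g x - h x)"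
  using bdd_lipschitz_add[OF _ bdd_lipschitz_minus] by simp

lemma bdd_lipschitz_sum:
  "(\<And>i. i \<in> A \<Longrightarrow> bdd_lipschitz k (h i)) \<Longrightarrow> bdd_lipschitz k (\<lambda>x. \<Sum>i\<in>A. h i x)"
  by (induction A rule: infinite_finite_induct) (auto intro: bdd_lipschitz_const bdd_lipschitz_add)

text \<open>With a and b for the two square roots, the difference of the inverses equals the
  difference of the values of \<open>h\<close> divided by a b (a + b), and each factor of this
  denominator is bounded below.\<close>

lemma bdd_lipschitz_inverse_sqrt:
  assumes "bdd_lipschitz k h" "\<rho> > 0" "\<And>x. x \<in> topspace (nsphere k) \<Longrightarrow> h x \<ge> \<rho>"
  shows "bdd_lipschitz k (\<lambda>x. inverse (sqrt (h x)))"
proof -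
  obtain B L where 1: "B \<ge> 0" "L \<ge> 0" "\<And>x. x \<in> topspace (nsphere k) \<Longrightarrow> \<bar>h x\<bar> \<le> B"
    "\<And>x y. x \<in> topspace (nsphere k) \<Longrightarrow> y \<in> topspace (nsphere k) \<Longrightarrow>
       \<bar>h x - h y\<bar> \<le> L * (\<Sum>i\<le>k. \<bar>x i - y i\<bar>)"
    using bdd_lipschitzE[OF assms(1)] by metis
  let ?r = "sqrt \<rho>"
  have r: "?r > 0" using assms by simp
  have ge: "sqrt (h x) \<ge> ?r" if "x \<in> topspace (nsphere k)" for x
    using assms(3)[OF that] by simp
  show ?thesis
  proof (rule bdd_lipschitzI[of "inverse ?r" "inverse (?r * ?r * (2 * ?r)) * L"])
    fix x y assume xy: "x \<in> topspace (nsphere k)" "y \<in> topspace (nsphere k)"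
    let ?d = "\<Sum>i\<le>k. \<bar>x i - y i\<bar>" and ?a = "sqrt (h x)" and ?b = "sqrt (h y)"
    have ab: "?a \<ge> ?r" "?b \<ge> ?r" using ge xy by auto
    have hx: "h x = ?a\<^sup>2" "h y = ?b\<^sup>2" using assms(2,3) xy by (metis less_le_trans less_imp_le real_sqrt_pow2)+
    have hab: "\<bar>h x - h y\<bar> = \<bar>?a - ?b\<bar> * (?a + ?b)"
    proof -
      have "h x - h y = (?a - ?b) * (?a + ?b)"
        using hx by (simp add: power2_eq_square algebra_simps)
      then show ?thesis using ab r by (simp add: abs_mult)
    qed
    have "\<bar>inverse ?a - inverse ?b\<bar> = \<bar>?a - ?b\<bar> / (?a * ?b)"
    proof -
      have "\<bar>inverse a - inverse b\<bar> = \<bar>a - b\<bar> / (a * b)" if "a > 0" "b > 0" for a b :: real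
        using that by (simp add: field_simps abs_if)
      then show ?thesis using ab r by simp
    qed
    also have "\<dots> = \<bar>h x - h y\<bar> * inverse (?a * ?b * (?a + ?b))"
    proof -
      have "t / (a * b) = t * (a + b) * inverse (a * b * (a + b))" if "a > 0" "b > 0" for t a b :: real
      proof -
        have "t * (a + b) * inverse (a * b * (a + b)) = t * inverse (a * b) * ((a + b) * inverse (a + b))"
          by (simp only: inverse_mult_distrib mult_ac)
        then show ?thesis using that by (simp add: divide_inverse)
      qed
      then show ?thesis using ab r unfolding hab by simp
    qed
    also have "\<dots> \<le> (L * ?d) * inverse (?r * ?r * (2 * ?r))"
    proof -
      have h2: "2 * ?r \<le> ?a + ?b" unfolding mult_2 by (intro add_mono ab)
      have "?a \<ge> 0" "?b \<ge> 0" "?r \<ge> 0" using ab r by linarith+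
      then have "?r * ?r * (2 * ?r) \<le> ?a * ?b * (?a + ?b)"
        by (intro mult_mono h2 ab mult_nonneg_nonneg add_nonneg_nonneg) auto
      moreover have "0 < ?r * ?r * (2 * ?r)" using r by simp
      ultimately have "inverse (?a * ?b * (?a + ?b)) \<le> inverse (?r * ?r * (2 * ?r))"
        by (rule le_imp_inverse_le)
      then show ?thesis using ab r 1(2) 1(4)[OF xy] by (intro mult_mono) (auto intro!: mult_nonneg_nonneg sum_nonneg)
    qed
    finally show "\<bar>inverse ?a - inverse ?b\<bar> \<le> inverse (?r * ?r * (2 * ?r)) * L * ?d"
      by (simp add: mult_ac)
  next
    fix x assume "x \<in> topspace (nsphere k)"
    then show "\<bar>inverse (sqrt (h x))\<bar> \<le> inverse ?r"
      using ge[of x] r by (simp add: le_imp_inverse_le)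
  qed (use 1 assms in auto)
qed

lemma bdd_lipschitz_equator:
  assumes "bdd_lipschitz (Suc k) h" shows "bdd_lipschitz k h"
proof -
  have sub: "x \<in> topspace (nsphere (Suc k)) \<and> x (Suc k) = 0" if "x \<in> topspace (nsphere k)" for x
    using that by (auto simp: topspace_nsphere)
  obtain B L where BL: "B \<ge> 0" "L \<ge> 0" "\<And>x. x \<in> topspace (nsphere (Suc k)) \<Longrightarrow> \<bar>h x\<bar> \<le> B"
    "\<And>x y. x \<in> topspace (nsphere (Suc k)) \<Longrightarrow> y \<in> topspace (nsphere (Suc k)) \<Longrightarrow>
       \<bar>h x - h y\<bar> \<le> L * (\<Sum>i\<le>Suc k. \<bar>x i - y i\<bar>)"
    using bdd_lipschitzE[OF assms] by metis
  show ?thesis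
  proof (rule bdd_lipschitzI[of B L])
    fix x y assume "x \<in> topspace (nsphere k)" "y \<in> topspace (nsphere k)"
    then show "\<bar>h x - h y\<bar> \<le> L * (\<Sum>i\<le>k. \<bar>x i - y i\<bar>)"
      using BL(4)[of x y] sub[of x] sub[of y] by simp
  qed (use BL sub in blast)+
qed

lemma bdd_lipschitz_cong:
  "bdd_lipschitz k h \<Longrightarrow> (\<And>x. x \<in> topspace (nsphere k) \<Longrightarrow> h x = h' x) \<Longrightarrow> bdd_lipschitz k h'"
  by (simp add: bdd_lipschitz_def)

lemma bdd_lipschitz_iprod:
  assumes "\<And>i. i \<le> n \<Longrightarrow> bdd_lipschitz k (\<lambda>x. f x i)" "\<And>i. i \<le> n \<Longrightarrow> bdd_lipschitz k (\<lambda>x. g x i)"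
  shows "bdd_lipschitz k (\<lambda>x. iprod n (f x) (g x))"
  unfolding iprod_def using assms by (intro bdd_lipschitz_sum bdd_lipschitz_mult) auto

lemma bdd_lipschitz_unitize:
  assumes "\<And>i. i \<le> n \<Longrightarrow> bdd_lipschitz k (\<lambda>x. f x i)"
    and "\<rho> > 0" "\<And>x. x \<in> topspace (nsphere k) \<Longrightarrow> iprod n (f x) (f x) \<ge> \<rho>"
  shows "bdd_lipschitz k (\<lambda>x. unitize n (f x) i)"
proof (cases "i \<le> n")
  case True
  have "bdd_lipschitz k (\<lambda>x. f x i * inverse (sqrt (iprod n (f x) (f x))))"
    using assms True by (intro bdd_lipschitz_mult bdd_lipschitz_inverse_sqrt[where \<rho> = \<rho>] bdd_lipschitz_iprod) auto
  then show ?thesis using True by (simp add: unitize_def)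
qed (simp add: unitize_def bdd_lipschitz_const)

lemma abs_le_1_nsphere:
  assumes x: "x \<in> topspace (nsphere n)"
  shows "\<bar>x i\<bar> \<le> 1"
proof (cases "i \<le> n")
  case True
  have "(x i)\<^sup>2 \<le> (\<Sum>i\<le>n. (x i)\<^sup>2)" using True by (intro member_le_sum) auto
  also have "\<dots> = 1" using x unfolding topspace_nsphere by blast
  finally show ?thesis by (simp add: abs_square_le_1)
next
  case False
  then have "x i = 0" using x unfolding topspace_nsphere by auto
  then show ?thesis by simp
qed

text \<open>The cone over the map is Lipschitz from dimension \<open>k + 1\<close> to dimension \<open>k + 2\<close>,
  so it cannot reach all points of a fine grid.\<close>

lemma bdd_lipschitz_nsphere_not_surj:
  assumes bl: "\<And>i. i \<le> Suc k \<Longrightarrow> bdd_lipschitz k (\<lambda>x. g x i)"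
  shows "\<exists>q\<in>topspace (nsphere (Suc k)). \<forall>x\<in>topspace (nsphere k). g x \<noteq> q"
proof (rule ccontr)
  assume "\<not> ?thesis"
  then have surj: "\<exists>x\<in>topspace (nsphere k). g x = q" if "q \<in> topspace (nsphere (Suc k))" for q
    using that by blast
  define P where "P = (\<lambda>i B L. B \<ge> 0 \<and> L \<ge> 0 \<and> (\<forall>x\<in>topspace (nsphere k). \<bar>g x i\<bar> \<le> B \<and>
    (\<forall>y\<in>topspace (nsphere k). \<bar>g x i - g y i\<bar> \<le> L * (\<Sum>i\<le>k. \<bar>x i - y i\<bar>))))"
  have "\<exists>B L. P i B L" if "i \<le> Suc k" for i
    using bl[OF that] unfolding bdd_lipschitz_def P_def .
  then obtain B L where "\<And>i. i \<le> Suc k \<Longrightarrow> P i (B i) (L i)" by metis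
  note BL = this[unfolded P_def]
  \<comment> \<open>Bounds the Lipschitz constants of all coordinates of the cone map, which sends t
    x to t g(x) for t up to k + 2.\<close>
  define L' where "L' = (\<Sum>i\<le>Suc k. B i + L i * (real k + 2))"
  have term_nonneg: "B i + L i * (real k + 2) \<ge> 0" if "i \<le> Suc k" for i
    using BL[OF that] by simp
  have L'_ge: "B i + L i * (real k + 2) \<le> L'" if "i \<le> Suc k" for i
    unfolding L'_def using term_nonneg that by (intro member_le_sum[of i "{..Suc k}" "\<lambda>i. B i + L i * (real k + 2)"]) auto
  have L'_nonneg: "L' \<ge> 0" using L'_ge[of 0] term_nonneg[of 0] by linarith
  \<comment> \<open>\<open>M\<close> exceeds the factor between the number of boxes of side
    \<open>1 / K\<close> and \<open>M ^ (k + 1)\<close>, so the \<open>M ^ (k + 2)\<close> grid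
    points outnumber the boxes. \<open>c\<close> makes the boxes so small that the cone map varies
    by less than \<open>1 / M\<close> inside each.\<close>
  define c where "c = nat \<lceil>L' * (real k + 1)\<rceil> + 1"
  define M where "M = (3 * c * (k + 2)) ^ (k + 1) + 1"
  define K where "K = c * M"
  have c0: "c \<ge> 1" and M0: "M \<ge> 1" and K0: "K \<ge> 1" by (simp_all add: c_def M_def K_def)
  have cL: "L' * (real k + 1) < real c" unfolding c_def by linarith
  define A where "A = ({..Suc k} \<rightarrow>\<^sub>E {1..M})"
  define y where "y = (\<lambda>(a::nat\<Rightarrow>nat) i. real (a i) / real M)"
  define r where "r = (\<lambda>a. sqrt (iprod (Suc k) (y a) (y a)))"
  have y01: "0 < y a i" "y a i \<le> 1" if "a \<in> A" "i \<le> Suc k" for a i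
    using that M0 by (auto simp: A_def y_def PiE_def Pi_def)
  have ypos: "iprod (Suc k) (y a) (y a) > 0" if "a \<in> A" for a
    using y01[OF that] by (auto simp: iprod_self_pos) (metis less_irrefl zero_le)
  have "\<forall>a\<in>A. \<exists>x\<in>topspace (nsphere k). g x = unitize (Suc k) (y a)"
    using surj unitize_in_nsphere ypos by blast
  then obtain x where x: "\<And>a. a \<in> A \<Longrightarrow> x a \<in> topspace (nsphere k)"
    "\<And>a. a \<in> A \<Longrightarrow> g (x a) = unitize (Suc k) (y a)" by metis
  have rpos: "r a > 0" if "a \<in> A" for a using ypos[OF that] by (simp add: r_def)
  have yg: "y a i = r a * g (x a) i" if "a \<in> A" "i \<le> Suc k" for a i
    using that rpos[OF that(1)] by (simp add: x(2) unitize_def r_def)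
  \<comment> \<open>The point of the cone that is mapped to the grid point \<open>y a\<close>; its
    Euclidean length is \<open>r a\<close>.\<close>
  define z where "z = (\<lambda>a i. r a * x a i)"
  have rle: "r a \<le> real k + 2" if "a \<in> A" for a
  proof -
    have "iprod (Suc k) (y a) (y a) \<le> (\<Sum>i\<le>Suc k. 1 * 1)"
      unfolding iprod_def using y01[OF that] by (intro sum_mono mult_mono) (auto intro: less_imp_le)
    then have "iprod (Suc k) (y a) (y a) \<le> real k + 2" by simp
    also have "\<dots> \<le> (real k + 2)\<^sup>2" by (simp add: power2_eq_square)
    finally show ?thesis unfolding r_def by (intro real_le_lsqrt) auto
  qed
  define key where "key = (\<lambda>a. restrict (\<lambda>i. \<lfloor>real K * z a i\<rfloor>) {..k})"
  let ?T = "{..k} \<rightarrow>\<^sub>E {- int (K * (k+2)) .. int (K * (k+2))}"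
  have "key ` A \<subseteq> ?T"
  proof
    fix t assume "t \<in> key ` A"
    then obtain a where a: "a \<in> A" "t = key a" by blast
    have "\<lfloor>real K * z a i\<rfloor> \<in> {- int (K * (k+2)) .. int (K * (k+2))}" for i
    proof -
      have "\<bar>z a i\<bar> = r a * \<bar>x a i\<bar>" using rpos[OF a(1)] by (simp add: z_def abs_mult)
      also have "\<dots> \<le> (real k + 2) * 1"
        using rle[OF a(1)] abs_le_1_nsphere[OF x(1)[OF a(1)]] by (intro mult_mono) auto
      finally have "\<bar>real K * z a i\<bar> \<le> real K * (real k + 2)"
        by (simp add: abs_mult mult_left_mono)
      then have "real K * z a i \<le> real_of_int (int (K * (k+2)))" "- real_of_int (int (K * (k+2))) \<le> real K * z a i"
        by (simp_all add: abs_le_iff algebra_simps)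
      then show ?thesis by (simp add: le_floor_iff floor_le_iff)
    qed
    then show "t \<in> ?T" by (auto simp: a(2) key_def)
  qed
  then have "card (key ` A) \<le> card ?T" by (intro card_mono finite_PiE) auto
  also have "\<dots> = (2 * (K * (k+2)) + 1) ^ (k + 1)"
    by (subst card_PiE) (auto simp: nat_add_distrib nat_mult_distrib)
  also have "\<dots> \<le> (3 * c * (k + 2) * M) ^ (k + 1)"
  proof (rule power_mono)
    have "1 \<le> K * (k + 2)" using K0 by (metis One_nat_def Suc_le_eq add_2_eq_Suc' nat_0_less_mult_iff zero_less_Suc)
    then have "2 * (K * (k+2)) + 1 \<le> 3 * (K * (k + 2))" by linarith
    also have "\<dots> = 3 * c * (k + 2) * M" by (simp add: K_def algebra_simps)
    finally show "2 * (K * (k+2)) + 1 \<le> 3 * c * (k + 2) * M" .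
  qed simp
  also have "\<dots> = (3 * c * (k + 2)) ^ (k + 1) * M ^ (k + 1)" by (simp only: power_mult_distrib)
  also have "\<dots> < M * M ^ (k + 1)" using M0 by (intro mult_strict_right_mono) (auto simp: M_def)
  also have "\<dots> = card A" by (simp add: A_def card_PiE)
  finally have "\<not> inj_on key A" by (rule pigeonhole)
  then obtain a a' where aa: "a \<in> A" "a' \<in> A" "a \<noteq> a'" "key a = key a'"
    unfolding inj_on_def by blast
  define d where "d = (\<Sum>i\<le>k. \<bar>z a i - z a' i\<bar>)"
  have d0: "d \<ge> 0" by (simp add: d_def sum_nonneg)
  have "\<bar>z a i - z a' i\<bar> \<le> 1 / real K" if "i \<le> k" for i
  proof -
    have "\<lfloor>real K * z a i\<rfloor> = \<lfloor>real K * z a' i\<rfloor>"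
      using aa(4) that unfolding key_def by (metis atMost_iff restrict_apply')
    then have "\<bar>real K * z a i - real K * z a' i\<bar> \<le> 1" by linarith
    moreover have "\<bar>real K * z a i - real K * z a' i\<bar> = real K * \<bar>z a i - z a' i\<bar>"
      by (simp add: abs_mult flip: right_diff_distrib)
    ultimately show ?thesis using K0 by (simp add: field_simps)
  qed
  then have "d \<le> (\<Sum>i\<le>k. 1 / real K)" unfolding d_def by (intro sum_mono) auto
  then have dK: "d \<le> (real k + 1) / real K" by (simp add: add.commute)
  have zr: "r b = L2_set (z b) {..k}" if "b \<in> A" for b
  proof -
    have "L2_set (z b) {..k} = r b * L2_set (x b) {..k}"
      using rpos[OF that] unfolding z_def by (subst L2_set_right_distrib) auto
    also have "L2_set (x b) {..k} = 1"
      using x(1)[OF that] by (simp add: L2_set_def topspace_nsphere)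
    finally show ?thesis by simp
  qed
  have tri: "L2_set p {..k} \<le> L2_set q {..k} + (\<Sum>i\<le>k. \<bar>p i - q i\<bar>)" for p q :: "nat \<Rightarrow> real"
    using L2_set_triangle_ineq[of q "\<lambda>i. p i - q i" "{..k}"] L2_set_le_sum_abs[of "\<lambda>i. p i - q i" "{..k}"]
    by simp
  have rr: "\<bar>r a - r a'\<bar> \<le> d"
    using tri[of "z a" "z a'"] tri[of "z a'" "z a"] zr aa unfolding d_def
    by (simp add: abs_minus_commute)
  \<comment> \<open>Directions are controlled only after weighting by the radius: near the apex,
    close points can have distant directions.\<close>
  have xx: "r a' * (\<Sum>i\<le>k. \<bar>x a i - x a' i\<bar>) \<le> (real k + 2) * d"
  proof -
    have "r a' * (\<Sum>i\<le>k. \<bar>x a i - x a' i\<bar>) = (\<Sum>i\<le>k. \<bar>r a' * x a i - r a' * x a' i\<bar>)"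
      using rpos[OF aa(2)] by (simp add: sum_distrib_left abs_mult flip: right_diff_distrib)
    also have "\<dots> \<le> (\<Sum>i\<le>k. d + \<bar>z a i - z a' i\<bar>)"
    proof (rule sum_mono)
      fix i
      have "\<bar>r a' * x a i - r a' * x a' i\<bar> \<le> \<bar>(r a' - r a) * x a i\<bar> + \<bar>z a i - z a' i\<bar>"
        unfolding z_def by (simp add: algebra_simps)
      moreover have "\<bar>(r a' - r a) * x a i\<bar> \<le> d * 1"
        unfolding abs_mult using rr abs_le_1_nsphere[OF x(1)[OF aa(1)], of i]
        by (intro mult_mono) auto
      ultimately show "\<bar>r a' * x a i - r a' * x a' i\<bar> \<le> d + \<bar>z a i - z a' i\<bar>" by linarith
    qed
    also have "\<dots> = (real k + 2) * d" by (simp add: sum.distrib d_def algebra_simps)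
    finally show ?thesis .
  qed
  have "y a i = y a' i" if i: "i \<le> Suc k" for i
  proof -
    note bl' = BL[OF i]
    have "\<bar>y a i - y a' i\<bar> = \<bar>(r a - r a') * g (x a) i + r a' * (g (x a) i - g (x a') i)\<bar>"
      using yg aa i by (simp add: algebra_simps)
    also have "\<dots> \<le> \<bar>r a - r a'\<bar> * \<bar>g (x a) i\<bar> + r a' * \<bar>g (x a) i - g (x a') i\<bar>"
      using rpos[OF aa(2)] by (intro order_trans[OF abs_triangle_ineq]) (simp add: abs_mult)
    also have "\<dots> \<le> d * B i + r a' * (L i * (\<Sum>i\<le>k. \<bar>x a i - x a' i\<bar>))"
    proof (intro add_mono)
      show "\<bar>r a - r a'\<bar> * \<bar>g (x a) i\<bar> \<le> d * B i"
        using bl' x(1)[OF aa(1)] rr d0 by (intro mult_mono) auto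
      show "r a' * \<bar>g (x a) i - g (x a') i\<bar> \<le> r a' * (L i * (\<Sum>i\<le>k. \<bar>x a i - x a' i\<bar>))"
        using bl' x(1)[OF aa(1)] x(1)[OF aa(2)] rpos[OF aa(2)] by (intro mult_left_mono) auto
    qed
    also have "\<dots> = d * B i + L i * (r a' * (\<Sum>i\<le>k. \<bar>x a i - x a' i\<bar>))" by (simp add: mult_ac)
    also have "\<dots> \<le> d * B i + L i * ((real k + 2) * d)"
      using bl' xx by (intro add_left_mono mult_left_mono) auto
    also have "\<dots> = (B i + L i * (real k + 2)) * d" by (simp add: algebra_simps)
    also have "\<dots> \<le> L' * d"
      using L'_ge[OF i] d0 by (rule mult_right_mono)
    also have "\<dots> \<le> L' * ((real k + 1) / real K)"
      using dK L'_nonneg by (rule mult_left_mono)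
    also have "\<dots> = (L' * (real k + 1)) / real K" by simp
    also have "\<dots> < real c / real K" using cL K0 by (intro divide_strict_right_mono) auto
    also have "\<dots> = 1 / real M" using c0 by (simp add: K_def)
    finally have "\<bar>real (a i) - real (a' i)\<bar> < 1"
      using M0 by (simp add: y_def field_simps flip: diff_divide_distrib)
    then have "a i = a' i" by linarith
    then show ?thesis by (simp add: y_def)
  qed
  then have "a i = a' i" if "i \<le> Suc k" for i
    using that M0 by (simp add: y_def)
  then have "a = a'" using aa(1,2) unfolding A_def by (intro PiE_ext) auto
  then show False using aa by simp
qed

section \<open>Odd maps and their degree\<close>

lemma neg_in_nsphere: "x \<in> topspace (nsphere n) \<Longrightarrow> (\<lambda>i. - x i) \<in> topspace (nsphere n)"
  by (simp add: topspace_nsphere)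

lemma equator_subset_nsphere:
  "x \<in> topspace (nsphere k) \<Longrightarrow> x \<in> topspace (nsphere (Suc k)) \<and> x (Suc k) = 0"
  by (auto simp: topspace_nsphere)

lemma continuous_map_nsphere_equator:
  assumes f: "continuous_map (nsphere (Suc k)) (nsphere (Suc k)) f"
    and im: "\<And>x. x \<in> topspace (nsphere k) \<Longrightarrow> f x (Suc k) = 0"
  shows "continuous_map (nsphere k) (nsphere k) f"
proof -
  let ?E = "{x. x (Suc k) = (0::real)}"
  have "continuous_map (subtopology (nsphere (Suc k)) ?E) (nsphere (Suc k)) f"
    using f by (rule continuous_map_from_subtopology)
  then have "continuous_map (nsphere k) (nsphere (Suc k)) f"
    by (simp only: subtopology_nsphere_equator)
  then have "continuous_map (nsphere k) (subtopology (nsphere (Suc k)) ?E) f"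
    using im by (simp add: continuous_map_in_subtopology Pi_iff)
  then show ?thesis by (simp only: subtopology_nsphere_equator)
qed

text \<open>Strict Cauchy-Schwarz: \<open>1 - (iprod n x q)\<^sup>2\<close> is the squared length of
  the component of \<open>x\<close> orthogonal to \<open>q\<close>, and this component vanishes only
  at the two excluded points.\<close>

lemma iprod_cauchy_schwarz_nsphere:
  assumes x: "x \<in> topspace (nsphere n)" and q: "q \<in> topspace (nsphere n)"
    and ne: "x \<noteq> q" "x \<noteq> (\<lambda>i. - q i)"
  shows "(iprod n x q)\<^sup>2 < 1"
proof -
  let ?s = "iprod n x q"
  let ?d = "\<lambda>i. 1 * x i + (- ?s) * q i"
  have *: "iprod n ?d ?d = 1 - ?s\<^sup>2"
    unfolding iprod_self_lincomb using x q by (simp add: in_nsphere_iff power2_eq_square)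
  have "iprod n ?d ?d > 0"
  proof (rule ccontr)
    assume neg: "\<not> iprod n ?d ?d > 0"
    then have zero: "?d i = 0" if "i \<le> n" for i using that iprod_self_pos by blast
    have eq: "x i = ?s * q i" for i
      using zero[of i] x q by (cases "i \<le> n") (auto simp: in_nsphere_iff)
    have "?s\<^sup>2 = 1"
      using * neg iprod_self_nonneg[of n ?d] by simp
    then have "?s = 1 \<or> ?s = -1" by (simp add: power2_eq_1_iff)
    then show False using eq ne by (metis (no_types) ext mult_1 mult_minus1)
  qed
  then show ?thesis using * by simp
qed

text \<open>The reflection in the hyperplane orthogonal to \<open>u\<close>. Division by zero makes
  it the identity if \<open>u\<close> vanishes on the coordinates up to \<open>n\<close>. The factor
  1 brings it into the shape of the rules for linear combinations.\<close>

definition reflect :: "nat \<Rightarrow> (nat \<Rightarrow> real) \<Rightarrow> (nat \<Rightarrow> real) \<Rightarrow> nat \<Rightarrow> real" where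
  "reflect n u x = (\<lambda>i. 1 * x i + (- (2 * iprod n x u / iprod n u u)) * u i)"

lemma reflect_degenerate: "iprod n u u = 0 \<Longrightarrow> reflect n u x = x"
  unfolding reflect_def fun_eq_iff by simp

lemma iprod_reflect: "iprod n (reflect n u x) (reflect n u y) = iprod n x y"
proof (cases "iprod n u u = 0")
  case True then show ?thesis by (simp only: reflect_degenerate)
next
  case False
  define a where "a = 2 * iprod n x u / iprod n u u"
  define b where "b = 2 * iprod n y u / iprod n u u"
  have "iprod n (reflect n u x) (reflect n u y)
      = iprod n x y - b * iprod n x u - a * (iprod n y u - b * iprod n u u)"
    unfolding reflect_def a_def[symmetric] b_def[symmetric] iprod_lincomb_left iprod_lincomb_right
    by (simp add: iprod_commute[of n u y] algebra_simps)
  also have "b * iprod n u u = 2 * iprod n y u" using False by (simp add: b_def)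
  also have "b * iprod n x u = a * iprod n y u" by (simp add: a_def b_def)
  finally show ?thesis by (simp add: algebra_simps)
qed

lemma reflect_minus: "reflect n u (\<lambda>i. - x i) = (\<lambda>i. - reflect n u x i)"
  by (simp add: reflect_def iprod_minus_left)

lemma continuous_map_reflect:
  assumes "\<And>i. i > n \<Longrightarrow> u i = 0"
  shows "continuous_map (nsphere n) (nsphere n) (reflect n u)"
proof -
  have "reflect n u x \<in> topspace (nsphere n)" if "x \<in> topspace (nsphere n)" for x
    using that iprod_reflect[of n u x x] assms by (simp add: in_nsphere_iff reflect_def)
  then have *: "reflect n u \<in> topspace (nsphere n) \<rightarrow> {x. (\<Sum>i\<le>n. (x i)\<^sup>2) = 1 \<and> (\<forall>i>n. x i = 0)}"
    by (auto simp: topspace_nsphere)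
  have "continuous_map (nsphere n) (powertop_real UNIV) (reflect n u)"
    unfolding reflect_def continuous_map_componentwise_UNIV divide_inverse
    by (intro allI continuous_intros continuous_map_nsphere_projection continuous_map_iprod)
  then show ?thesis
    using * unfolding nsphere[of n] continuous_map_in_subtopology by (simp add: nsphere)
qed

text \<open>An odd map is pushed, without meeting antipodes, to one that preserves an equator. This is
  possible because its restriction to the equator omits a pair of antipodal points.\<close>

theorem odd_map_imp_odd_degree:
  assumes "continuous_map (nsphere n) (nsphere n) f"
    and "\<And>x. x \<in> topspace (nsphere n) \<Longrightarrow> f (\<lambda>i. - x i) = (\<lambda>i. - f x i)"
    and "\<And>i. i \<le> n \<Longrightarrow> bdd_lipschitz n (\<lambda>x. f x i)"
  shows "odd (Brouwer_degree2 n f)"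
  using assms
proof (induction n arbitrary: f)
  case 0
  let ?e = "\<lambda>i::nat. if i = 0 then 1 else (0::real)"
  have e: "?e \<in> topspace (nsphere 0)" by (simp add: topspace_nsphere)
  have S: "x = ?e \<or> x = (\<lambda>i. - ?e i)" if "x \<in> topspace (nsphere 0)" for x
  proof -
    have "x 0 = 1 \<or> x 0 = -1" "\<forall>i>0. x i = 0" using that by (auto simp: topspace_nsphere power2_eq_1_iff)
    then show ?thesis by (auto simp: fun_eq_iff)
  qed
  have fe: "f ?e \<in> topspace (nsphere 0)"
    using 0(1) e continuous_map_image_subset_topspace by blast
  have fm: "f (\<lambda>i. - ?e i) = (\<lambda>i. - f ?e i)" using 0(2)[OF e] .
  from S[OF fe] show ?case
  proof
    assume a: "f ?e = ?e"
    have "f x = id x" if "x \<in> topspace (nsphere 0)" for x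
      using S[OF that]
    proof
      assume "x = ?e" then show ?thesis by (simp only: a id_apply)
    next
      assume x: "x = (\<lambda>i. - ?e i)"
      then have "f x = (\<lambda>i. - f ?e i)" by (simp only: fm)
      then show ?thesis by (simp only: a x id_apply)
    qed
    then have "Brouwer_degree2 0 f = Brouwer_degree2 0 id" by (rule Brouwer_degree2_eq)
    then show ?thesis by simp
  next
    assume a: "f ?e = (\<lambda>i. - ?e i)"
    have "f x = (\<lambda>i. if i = 0 then - x i else x i)" if "x \<in> topspace (nsphere 0)" for x
      using S[OF that]
    proof
      assume "x = ?e"
      then have "f x = (\<lambda>i. - ?e i)" by (simp only: a)
      then show ?thesis by (simp add: \<open>x = ?e\<close> fun_eq_iff)
    next
      assume x: "x = (\<lambda>i. - ?e i)"
      then have "f x = (\<lambda>i. - f ?e i)" by (simp only: fm)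
      then show ?thesis by (simp add: a x fun_eq_iff)
    qed
    then have "Brouwer_degree2 0 f = Brouwer_degree2 0 (\<lambda>x i. if i = 0 then - x i else x i)"
      by (rule Brouwer_degree2_eq)
    then show ?thesis using Brouwer_degree2_reflection[of 0] by simp
  qed
next
  case (Suc k)
  let ?n = "Suc k"
  note cont = Suc.prems(1) and odd = Suc.prems(2) and lip = Suc.prems(3)
  have fS: "f x \<in> topspace (nsphere ?n)" if "x \<in> topspace (nsphere ?n)" for x
    using cont that continuous_map_image_subset_topspace by blast
  obtain q where q: "q \<in> topspace (nsphere ?n)" and ne: "\<And>x. x \<in> topspace (nsphere k) \<Longrightarrow> f x \<noteq> q"
    using bdd_lipschitz_nsphere_not_surj[of k f] bdd_lipschitz_equator lip by metis
  have ne': "f x \<noteq> (\<lambda>i. - q i)" if x: "x \<in> topspace (nsphere k)" for x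
  proof
    assume "f x = (\<lambda>i. - q i)"
    then have "f (\<lambda>i. - x i) = q" using odd[of x] equator_subset_nsphere[OF x] by simp
    then show False using ne neg_in_nsphere[OF x] by blast
  qed
  define s where "s = (\<lambda>x. iprod ?n (f x) q)"
  \<comment> \<open>Removes the whole \<open>q\<close>-component on the equator and nothing at the
    poles; the absolute value keeps the weight even, so that oddness survives.\<close>
  define c where "c = (\<lambda>x. (1 - \<bar>x ?n\<bar>) * s x)"
  define v where "v = (\<lambda>x i. 1 * f x i + (- c x) * q i)"
  define w where "w = (\<lambda>x. unitize ?n (v x))"
  \<comment> \<open>Keeps the angle between \<open>f x\<close> and \<open>v x\<close> acute: on the
    equator because \<open>f\<close> misses \<open>q\<close> and its antipode there, off it because
    the weight is below 1.\<close>
  have key: "(s x)\<^sup>2 * (1 - \<bar>x ?n\<bar>) < 1" if x: "x \<in> topspace (nsphere ?n)" for x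
  proof (cases "x ?n = 0")
    case True
    then have "x \<in> topspace (nsphere k)" using x topspace_nsphere_minus1 by fastforce
    then have "(s x)\<^sup>2 < 1"
      unfolding s_def using ne ne' q fS[OF x] by (intro iprod_cauchy_schwarz_nsphere) auto
    then show ?thesis using True by simp
  next
    case False
    let ?d = "\<lambda>i. 1 * f x i + (- s x) * q i"
    have "iprod ?n ?d ?d = 1 - (s x)\<^sup>2"
      unfolding iprod_self_lincomb using fS[OF x] q by (simp add: s_def in_nsphere_iff power2_eq_square)
    then have "(s x)\<^sup>2 \<le> 1" using iprod_self_nonneg[of ?n ?d] by simp
    moreover have "\<bar>x ?n\<bar> \<le> 1" using abs_le_1_nsphere[OF x] .
    ultimately have "(s x)\<^sup>2 * (1 - \<bar>x ?n\<bar>) \<le> 1 * (1 - \<bar>x ?n\<bar>)" by (intro mult_right_mono) auto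
    then show ?thesis using False by simp
  qed
  have vv: "iprod ?n (v x) (v x) > 0" if x: "x \<in> topspace (nsphere ?n)" for x
  proof -
    let ?a = "\<bar>x ?n\<bar>"
    have "iprod ?n (v x) (v x) = 1 - 2 * c x * s x + (c x)\<^sup>2"
      unfolding v_def iprod_self_lincomb using fS[OF x] q by (simp add: s_def in_nsphere_iff)
    also have "\<dots> = 1 - ((s x)\<^sup>2 * (1 - ?a)) * (1 + ?a)"
      unfolding c_def by (simp add: power2_eq_square algebra_simps)
    finally have e: "iprod ?n (v x) (v x) = 1 - (s x)\<^sup>2 * (1 - ?a\<^sup>2)"
      by (simp add: power2_eq_square algebra_simps)
    have "?a \<le> 1" using abs_le_1_nsphere[OF x] .
    show ?thesis
    proof (cases "?a = 0")
      case True then show ?thesis using key[OF x] e by simp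
    next
      case False
      let ?d = "\<lambda>i. 1 * f x i + (- s x) * q i"
      have "iprod ?n ?d ?d = 1 - (s x)\<^sup>2"
        unfolding iprod_self_lincomb using fS[OF x] q by (simp add: s_def in_nsphere_iff power2_eq_square)
      then have "(s x)\<^sup>2 \<le> 1" using iprod_self_nonneg[of ?n ?d] by simp
      moreover define A where "A = ?a\<^sup>2"
      moreover have "A \<le> 1" using \<open>?a \<le> 1\<close> by (simp add: A_def abs_square_le_1)
      ultimately have "(s x)\<^sup>2 * (1 - A) \<le> 1 * (1 - A)" by (intro mult_right_mono) auto
      also have "\<dots> < 1" using False by (simp add: A_def)
      finally show ?thesis by (simp only: e A_def diff_gt_0_iff_gt)
    qed
  qed
  have fv: "iprod ?n (f x) (v x) > 0" if x: "x \<in> topspace (nsphere ?n)" for x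
  proof -
    have "iprod ?n (f x) (v x) = 1 - (s x)\<^sup>2 * (1 - \<bar>x ?n\<bar>)"
      unfolding v_def iprod_lincomb_right using fS[OF x]
      by (simp add: s_def c_def in_nsphere_iff power2_eq_square)
    then show ?thesis using key[OF x] by simp
  qed
  have comp: "continuous_map (nsphere ?n) euclideanreal (\<lambda>x. f x i)" for i
    using cont by (rule continuous_map_nsphere_component)
  have cont_v: "continuous_map (nsphere ?n) euclideanreal (\<lambda>x. v x i)" for i
    unfolding v_def c_def s_def
    by (intro continuous_intros comp continuous_map_iprod continuous_map_nsphere_projection)
  have cont_w: "continuous_map (nsphere ?n) (nsphere ?n) w"
    unfolding w_def by (intro continuous_map_unitize cont_v vv)
  have deg_w: "Brouwer_degree2 ?n f = Brouwer_degree2 ?n w"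
  proof (rule Brouwer_degree2_eq_if_iprod_pos[OF cont cont_w])
    fix x assume "x \<in> topspace (nsphere ?n)"
    then show "iprod ?n (f x) (w x) > 0"
      unfolding w_def iprod_unitize using fv vv by simp
  qed
  have s_odd: "s (\<lambda>i. - x i) = - s x" if "x \<in> topspace (nsphere ?n)" for x
    using odd[OF that] by (simp add: s_def iprod_minus_left)
  have w_odd: "w (\<lambda>i. - x i) = (\<lambda>i. - w x i)" if "x \<in> topspace (nsphere ?n)" for x
  proof -
    have "v (\<lambda>i. - x i) = (\<lambda>i. - v x i)"
      using odd[OF that] s_odd[OF that] by (simp add: v_def c_def fun_eq_iff)
    then show ?thesis by (simp add: w_def unitize_minus)
  qed
  define e where "e = (\<lambda>i. if i = ?n then 1 else (0::real))"
  \<comment> \<open>Normal of the mirror that carries \<open>q\<close> to the last basis vector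
    \<open>e\<close>; it is zero if the two agree.\<close>
  define u where "u = (\<lambda>i. 1 * q i + (-1) * e i)"
  have iprod_e: "iprod ?n x e = x ?n" for x
    unfolding iprod_def e_def by (simp add: if_distrib cong: if_cong)
  have ee: "iprod ?n e e = 1" unfolding iprod_e by (simp add: e_def)
  have u0: "u i = 0" if "i > ?n" for i using q that by (simp add: u_def e_def in_nsphere_iff)
  have Rq: "reflect ?n u q = e"
  proof (cases "iprod ?n u u = 0")
    case True
    then have "u i = 0" if "i \<le> ?n" for i using that iprod_self_pos[of ?n u] by auto
    then have "u i = 0" for i using u0[of i] by (cases "i \<le> ?n") auto
    then have "q = e" by (simp add: u_def fun_eq_iff)
    then show ?thesis using True by (simp only: reflect_degenerate)
  next
    case False
    have "iprod ?n u u = 2 * (1 - q ?n)"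
      unfolding u_def iprod_self_lincomb iprod_e using q ee iprod_e[of e] by (simp add: in_nsphere_iff)
    moreover have "iprod ?n q u = 1 - q ?n"
      unfolding u_def iprod_lincomb_right iprod_e using q by (simp add: in_nsphere_iff)
    ultimately have "2 * iprod ?n q u / iprod ?n u u = 1" using False by simp
    then show ?thesis by (simp add: reflect_def u_def)
  qed
  define g where "g = reflect ?n u \<circ> w"
  have cont_R: "continuous_map (nsphere ?n) (nsphere ?n) (reflect ?n u)"
    using u0 by (rule continuous_map_reflect)
  have cont_g: "continuous_map (nsphere ?n) (nsphere ?n) g"
    unfolding g_def using cont_w cont_R by (rule continuous_map_compose)
  have deg_g: "Brouwer_degree2 ?n g = Brouwer_degree2 ?n (reflect ?n u) * Brouwer_degree2 ?n w"
    unfolding g_def using cont_w cont_R by (rule Brouwer_degree2_compose)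
  have g_odd: "g (\<lambda>i. - x i) = (\<lambda>i. - g x i)" if "x \<in> topspace (nsphere ?n)" for x
    using w_odd[OF that] by (simp add: g_def reflect_minus)
  \<comment> \<open>On the equator \<open>v x\<close> is orthogonal to \<open>q\<close>, hence
    \<open>g x\<close> is orthogonal to \<open>e\<close>. The parity step below needs a map that
    preserves the equator.\<close>
  have g0: "g x ?n = 0" if x: "x \<in> topspace (nsphere k)" for x
  proof -
    have x': "x \<in> topspace (nsphere ?n)" "x ?n = 0" using equator_subset_nsphere[OF x] by auto
    have "iprod ?n q (v x) = 0"
      unfolding v_def iprod_lincomb_right using x' q
      by (simp add: c_def s_def in_nsphere_iff iprod_commute[of ?n q "f x"])
    then have "iprod ?n (w x) q = 0" unfolding w_def by (subst iprod_commute) (simp add: iprod_unitize)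
    then have "iprod ?n (g x) (reflect ?n u q) = 0" by (simp add: g_def iprod_reflect)
    then show ?thesis by (simp add: Rq iprod_e)
  qed
  have gS: "g x \<in> topspace (nsphere k)" if x: "x \<in> topspace (nsphere k)" for x
  proof -
    have "g x \<in> topspace (nsphere ?n)"
      using cont_g equator_subset_nsphere[OF x] continuous_map_image_subset_topspace by blast
    then show ?thesis using topspace_nsphere_minus1[of "g x" ?n] g0[OF x] by simp
  qed
  have "even (Brouwer_degree2 ?n g - Brouwer_degree2 (?n - Suc 0) g)"
  proof (rule Borsuk_odd_mapping_degree_step[OF cont_g])
    show "(g \<circ> (\<lambda>x i. - x i)) x = ((\<lambda>x i. - x i) \<circ> g) x" if "x \<in> topspace (nsphere ?n)" for x
      using g_odd[OF that] by simp
    show "g \<in> topspace (nsphere (?n - Suc 0)) \<rightarrow> topspace (nsphere (?n - Suc 0))"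
      using gS by simp
  qed
  moreover have "odd (Brouwer_degree2 k g)"
  proof (rule Suc.IH)
    show "continuous_map (nsphere k) (nsphere k) g"
      using cont_g g0 by (rule continuous_map_nsphere_equator)
    show "g (\<lambda>i. - x i) = (\<lambda>i. - g x i)" if "x \<in> topspace (nsphere k)" for x
      using g_odd equator_subset_nsphere[OF that] by blast
    have lipf: "bdd_lipschitz k (\<lambda>x. f x i)" if "i \<le> ?n" for i
      using lip[OF that] by (rule bdd_lipschitz_equator)
    have lips: "bdd_lipschitz k s"
      unfolding s_def using lipf by (intro bdd_lipschitz_iprod bdd_lipschitz_const)
    \<comment> \<open>The weight in \<open>c\<close> is 1 on the equator, so \<open>v\<close>
      involves no absolute value there.\<close>
    have lipv: "bdd_lipschitz k (\<lambda>x. v x i)" if "i \<le> ?n" for i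
    proof (rule bdd_lipschitz_cong)
      show "bdd_lipschitz k (\<lambda>x. f x i - s x * q i)"
        using lipf[OF that] lips by (intro bdd_lipschitz_diff bdd_lipschitz_mult bdd_lipschitz_const)
    qed (use equator_subset_nsphere in \<open>auto simp: v_def c_def\<close>)
    have "\<exists>\<rho>>0. \<forall>x\<in>topspace (nsphere ?n). iprod ?n (v x) (v x) \<ge> \<rho>"
      by (intro nsphere_positive_lower_bound continuous_map_iprod cont_v vv)
    then obtain \<rho> where "\<rho> > 0" "\<And>x. x \<in> topspace (nsphere k) \<Longrightarrow> iprod ?n (v x) (v x) \<ge> \<rho>"
      using equator_subset_nsphere by blast
    then have lipw: "bdd_lipschitz k (\<lambda>x. w x i)" for i
      unfolding w_def using lipv by (intro bdd_lipschitz_unitize) auto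
    show "bdd_lipschitz k (\<lambda>x. g x i)" for i
      unfolding g_def o_def reflect_def divide_inverse
      by (intro bdd_lipschitz_add bdd_lipschitz_mult bdd_lipschitz_const bdd_lipschitz_minus
          bdd_lipschitz_iprod lipw)
  qed
  ultimately have "odd (Brouwer_degree2 ?n g)" by simp
  \<comment> \<open>The degree of \<open>g\<close> is the product of the degrees of the reflection
    and of \<open>w\<close>, so both factors are odd.\<close>
  then show ?case using deg_g deg_w by simp
qed

text \<open>A map without zeros would normalise to an odd map from the n-sphere to the sphere of
  dimension n - 1. Its restriction to the equator has odd degree, but as a self-map of the n-sphere
  it is not surjective and has degree 0; the two degrees must have equal parity.\<close>

theorem Borsuk_Ulam_bdd_lipschitz:
  fixes F :: "(nat \<Rightarrow> real) \<Rightarrow> nat \<Rightarrow> real"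
  assumes cont: "\<And>i. i < n \<Longrightarrow> continuous_map (nsphere n) euclideanreal (\<lambda>x. F x i)"
    and lip: "\<And>i. i < n \<Longrightarrow> bdd_lipschitz n (\<lambda>x. F x i)"
    and odd: "\<And>x i. x \<in> topspace (nsphere n) \<Longrightarrow> i < n \<Longrightarrow> F (\<lambda>i. - x i) i = - F x i"
  shows "\<exists>x\<in>topspace (nsphere n). \<forall>i<n. F x i = 0"
proof (cases n)
  case 0
  then show ?thesis using in_topspace_nsphere[of 0] by auto
next
  case (Suc k)
  show ?thesis
  proof (rule ccontr)
    assume "\<not> ?thesis"
    then have nz: "\<exists>i\<le>k. F x i \<noteq> 0" if "x \<in> topspace (nsphere n)" for x
      using that unfolding Suc less_Suc_eq_le by blast
    have pos: "iprod k (F x) (F x) > 0" if "x \<in> topspace (nsphere n)" for x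
      using nz[OF that] by (simp add: iprod_self_pos)
    define f where "f = (\<lambda>x. unitize k (F x))"
    have cont_k: "continuous_map (nsphere n) (nsphere k) f"
      unfolding f_def using cont pos by (intro continuous_map_unitize) (auto simp: Suc)
    then have "continuous_map (nsphere n) (subtopology (nsphere (Suc k)) {x. x (Suc k) = 0}) f"
      by (simp only: subtopology_nsphere_equator)
    then have cont_n: "continuous_map (nsphere (Suc k)) (nsphere (Suc k)) f"
      unfolding Suc by (rule continuous_map_into_fulltopology)
    have fk: "f x \<in> topspace (nsphere k)" if "x \<in> topspace (nsphere n)" for x
      using cont_k that continuous_map_image_subset_topspace by blast
    have f_odd: "f (\<lambda>i. - x i) = (\<lambda>i. - f x i)" if "x \<in> topspace (nsphere n)" for x
    proof -
      have "unitize k (F (\<lambda>i. - x i)) = unitize k (\<lambda>i. - F x i)"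
        using odd[OF that] by (simp add: unitize_def iprod_def Suc fun_eq_iff)
      then show ?thesis by (simp add: f_def unitize_minus)
    qed
    have "f ` topspace (nsphere (Suc k)) \<noteq> topspace (nsphere (Suc k))"
    proof
      assume eq: "f ` topspace (nsphere (Suc k)) = topspace (nsphere (Suc k))"
      have "(\<lambda>i. if i = Suc k then 1 else (0::real)) \<in> topspace (nsphere (Suc k))"
        by (simp add: topspace_nsphere if_distrib[where f = "\<lambda>x. x\<^sup>2"] cong: if_cong)
      then obtain x where "x \<in> topspace (nsphere n)" "f x = (\<lambda>i. if i = Suc k then 1 else (0::real))"
        using eq Suc by (metis imageE)
      then show False using equator_subset_nsphere[OF fk[of x]] by simp
    qed
    then have "Brouwer_degree2 (Suc k) f = 0"
      using cont_n by (intro Brouwer_degree2_nonsurjective)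
    moreover have "even (Brouwer_degree2 (Suc k) f - Brouwer_degree2 (Suc k - Suc 0) f)"
    proof (rule Borsuk_odd_mapping_degree_step[OF cont_n])
      show "(f \<circ> (\<lambda>x i. - x i)) x = ((\<lambda>x i. - x i) \<circ> f) x" if "x \<in> topspace (nsphere (Suc k))" for x
        using f_odd[of x] that Suc by simp
      show "f \<in> topspace (nsphere (Suc k - Suc 0)) \<rightarrow> topspace (nsphere (Suc k - Suc 0))"
        using fk equator_subset_nsphere Suc by fastforce
    qed
    moreover have "odd (Brouwer_degree2 k f)"
    proof (rule odd_map_imp_odd_degree)
      show "continuous_map (nsphere k) (nsphere k) f"
      proof (rule continuous_map_nsphere_equator[OF cont_n])
        show "f x (Suc k) = 0" if "x \<in> topspace (nsphere k)" for x
          using fk[of x] equator_subset_nsphere[OF that] equator_subset_nsphere[of "f x"] Suc by blast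
      qed
      show "f (\<lambda>i. - x i) = (\<lambda>i. - f x i)" if "x \<in> topspace (nsphere k)" for x
        using f_odd equator_subset_nsphere[OF that] Suc by blast
      have "\<exists>\<rho>>0. \<forall>x\<in>topspace (nsphere n). iprod k (F x) (F x) \<ge> \<rho>"
        using cont pos by (intro nsphere_positive_lower_bound continuous_map_iprod) (auto simp: Suc)
      then obtain \<rho> where \<rho>: "\<rho> > 0" "\<And>x. x \<in> topspace (nsphere k) \<Longrightarrow> iprod k (F x) (F x) \<ge> \<rho>"
        using equator_subset_nsphere Suc by blast
      have "bdd_lipschitz k (\<lambda>x. F x i)" if "i \<le> k" for i
        using lip[of i] that by (auto simp: Suc intro: bdd_lipschitz_equator)
      then show "bdd_lipschitz k (\<lambda>x. f x i)" for i
        unfolding f_def using \<rho> by (intro bdd_lipschitz_unitize) auto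
    qed
    ultimately show False by simp
  qed
qed

section \<open>Ham-sandwich cuts\<close>

text \<open>A continuous odd substitute for the sign function: the number of points on one side
  jumps, while sums of clamped values satisfy the hypotheses of Borsuk-Ulam.\<close>

definition clamp1 :: "real \<Rightarrow> real" where "clamp1 t = max (-1) (min 1 t)"

lemma clamp1_minus: "clamp1 (- t) = - clamp1 t"
  by (simp add: clamp1_def max_def min_def)

lemma bdd_lipschitz_coordinate: "j \<le> n \<Longrightarrow> bdd_lipschitz n (\<lambda>x. x j)"
proof (rule bdd_lipschitzI[of 1 1])
  assume j: "j \<le> n"
  show "\<bar>x j - y j\<bar> \<le> 1 * (\<Sum>i\<le>n. \<bar>x i - y i\<bar>)" for x y :: "nat \<Rightarrow> real"
    using j member_le_sum[of j "{..n}" "\<lambda>i. \<bar>x i - y i\<bar>"] by simp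
qed (auto intro: abs_le_1_nsphere)

lemma bdd_lipschitz_clamp1:
  assumes "bdd_lipschitz n h" shows "bdd_lipschitz n (\<lambda>x. clamp1 (h x))"
proof -
  obtain B L where 1: "B \<ge> 0" "L \<ge> 0" "\<And>x. x \<in> topspace (nsphere n) \<Longrightarrow> \<bar>h x\<bar> \<le> B"
    "\<And>x y. x \<in> topspace (nsphere n) \<Longrightarrow> y \<in> topspace (nsphere n) \<Longrightarrow>
       \<bar>h x - h y\<bar> \<le> L * (\<Sum>i\<le>n. \<bar>x i - y i\<bar>)"
    using bdd_lipschitzE[OF assms] by metis
  have c: "\<bar>clamp1 a - clamp1 b\<bar> \<le> \<bar>a - b\<bar>" "\<bar>clamp1 a\<bar> \<le> 1" for a b
    by (auto simp: clamp1_def max_def min_def)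
  show ?thesis
  proof (rule bdd_lipschitzI[of 1 L])
    fix x y assume "x \<in> topspace (nsphere n)" "y \<in> topspace (nsphere n)"
    then show "\<bar>clamp1 (h x) - clamp1 (h y)\<bar> \<le> L * (\<Sum>i\<le>n. \<bar>x i - y i\<bar>)"
      using c(1) 1(4) order_trans by blast
  qed (use 1 c in auto)
qed

text \<open>Where the limit is positive, the clamped value is eventually exactly 1; every other
  point contributes at least -1. A vanishing sum therefore limits the number of the former.\<close>

lemma card_le_half_if_clamp_sums_vanish:
  fixes g :: "nat \<Rightarrow> 'v \<Rightarrow> real"
  assumes P: "finite P" and r: "filterlim r at_top sequentially"
    and lim: "\<And>p. p \<in> P \<Longrightarrow> (\<lambda>k. g k p) \<longlonglongrightarrow> l p"
    and zero: "\<And>k. (\<Sum>p\<in>P. clamp1 (real (r k) * g k p)) = 0"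
  shows "2 * card {p\<in>P. l p > 0} \<le> card P"
proof -
  let ?T = "{p\<in>P. l p > 0}"
  have "\<forall>\<^sub>F k in sequentially. \<forall>p\<in>?T. clamp1 (real (r k) * g k p) = 1"
  proof (rule eventually_ball_finite)
    show "\<forall>p\<in>?T. \<forall>\<^sub>F k in sequentially. clamp1 (real (r k) * g k p) = 1"
    proof
      fix p assume p: "p \<in> ?T"
      have "filterlim (\<lambda>k. real (r k)) at_top sequentially"
        using filterlim_compose[OF filterlim_real_sequentially r] .
      then have "filterlim (\<lambda>k. g k p * real (r k)) at_top sequentially"
        using filterlim_tendsto_pos_mult_at_top[OF lim] p by blast
      then have "\<forall>\<^sub>F k in sequentially. g k p * real (r k) \<ge> 1"
        by (simp add: filterlim_at_top)
      then show "\<forall>\<^sub>F k in sequentially. clamp1 (real (r k) * g k p) = 1"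
        by eventually_elim (simp add: clamp1_def mult.commute)
    qed
  qed (use P in auto)
  then obtain k where k: "\<And>p. p \<in> ?T \<Longrightarrow> clamp1 (real (r k) * g k p) = 1"
    using eventually_happens[of _ sequentially] by auto
  have "0 = (\<Sum>p\<in>?T. clamp1 (real (r k) * g k p)) + (\<Sum>p\<in>P - ?T. clamp1 (real (r k) * g k p))"
    using zero[of k] sum.subset_diff[of ?T P "\<lambda>p. clamp1 (real (r k) * g k p)"] P
    by (simp only: mem_Collect_eq subset_iff) (simp add: add.commute)
  moreover have "(\<Sum>p\<in>?T. clamp1 (real (r k) * g k p)) = real (card ?T)"
    using k by simp
  moreover have "(\<Sum>p\<in>P - ?T. clamp1 (real (r k) * g k p)) \<ge> (\<Sum>p\<in>P - ?T. - 1)"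
    by (intro sum_mono) (simp add: clamp1_def)
  ultimately have "real (card ?T) \<le> real (card (P - ?T))" by simp
  moreover have "card (P - ?T) = card P - card ?T" "card ?T \<le> card P"
    using P by (auto intro: card_Diff_subset card_mono)
  ultimately show ?thesis by linarith
qed

text \<open>Coefficient vectors that balance the sums clamped at scale \<open>h\<close> lie on a
  compact sphere. A limit for growing \<open>h\<close> has the required property, in which points of
  value 0 count for neither side.\<close>

theorem ham_sandwich:
  fixes \<phi> :: "'v \<Rightarrow> nat \<Rightarrow> real"
  assumes P: "\<And>i. i < n \<Longrightarrow> finite (P i)"
  shows "\<exists>c. (\<exists>j\<le>n. c j \<noteq> 0) \<and> (\<forall>i<n. 2 * card {p\<in>P i. (\<Sum>j\<le>n. c j * \<phi> p j) > 0} \<le> card (P i)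
      \<and> 2 * card {p\<in>P i. (\<Sum>j\<le>n. c j * \<phi> p j) < 0} \<le> card (P i))"
proof -
  let ?S = "topspace (nsphere n)"
  let ?e = "\<lambda>c p. \<Sum>j\<le>n. c j * \<phi> p j"
  have "\<exists>c\<in>?S. \<forall>i<n. (\<Sum>p\<in>P i. clamp1 (real h * ?e c p)) = 0" for h :: nat
  proof (rule Borsuk_Ulam_bdd_lipschitz)
    fix i
    show "continuous_map (nsphere n) euclideanreal (\<lambda>c. \<Sum>p\<in>P i. clamp1 (real h * ?e c p))" if "i < n"
      unfolding clamp1_def using P[OF that]
      by (intro continuous_intros continuous_map_nsphere_projection) auto
    show "bdd_lipschitz n (\<lambda>c. \<Sum>p\<in>P i. clamp1 (real h * ?e c p))"
      by (intro bdd_lipschitz_sum bdd_lipschitz_clamp1 bdd_lipschitz_mult bdd_lipschitz_const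
          bdd_lipschitz_coordinate) auto
    show "(\<Sum>p\<in>P i. clamp1 (real h * ?e (\<lambda>i. - c i) p)) = - (\<Sum>p\<in>P i. clamp1 (real h * ?e c p))" for c
      by (simp add: sum_negf clamp1_minus)
  qed
  then obtain C where C: "\<And>h. C h \<in> ?S" "\<And>h i. i < n \<Longrightarrow> (\<Sum>p\<in>P i. clamp1 (real h * ?e (C h) p)) = 0"
    by metis
  have "seq_compact ?S" using compact_topspace_nsphere by (rule compact_imp_seq_compact)
  then obtain c r where c: "c \<in> ?S" and r: "strict_mono r" and lim: "(C \<circ> r) \<longlonglongrightarrow> c"
    using C(1) unfolding seq_compact_def by metis
  have coord: "(\<lambda>k. C (r k) j) \<longlonglongrightarrow> c j" for j
  proof -
    have "isCont (\<lambda>x::nat\<Rightarrow>real. x j) c"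
      using continuous_on_product_coordinates[of j] continuous_on_eq_continuous_at[OF open_UNIV] by blast
    from isCont_tendsto_compose[OF this lim] show ?thesis by (simp add: o_def)
  qed
  have e: "(\<lambda>k. ?e (C (r k)) p) \<longlonglongrightarrow> ?e c p" for p
    by (intro tendsto_intros coord)
  have r': "filterlim r at_top sequentially" using r by (rule filterlim_subseq)
  have "2 * card {p\<in>P i. ?e c p > 0} \<le> card (P i)" "2 * card {p\<in>P i. ?e c p < 0} \<le> card (P i)"
    if i: "i < n" for i
  proof -
    show "2 * card {p\<in>P i. ?e c p > 0} \<le> card (P i)"
      using C(2)[OF i] by (intro card_le_half_if_clamp_sums_vanish[OF P[OF i] r' e]) auto
    have "(\<Sum>p\<in>P i. clamp1 (real (r k) * - ?e (C (r k)) p)) = 0" for k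
      using C(2)[OF i, of "r k"] by (simp add: clamp1_minus sum_negf)
    from card_le_half_if_clamp_sums_vanish[OF P[OF i] r' tendsto_minus[OF e] this]
    show "2 * card {p\<in>P i. ?e c p < 0} \<le> card (P i)" by simp
  qed
  moreover have "\<exists>j\<le>n. c j \<noteq> 0"
    using c iprod_self_pos[of n c] by (auto simp: in_nsphere_iff)
  ultimately show ?thesis by blast
qed

subsection \<open>Polynomial functions\<close>

text \<open>Gaussian elimination over arbitrary index types: points and monomials both occur below
  as unknowns and as equations.\<close>

lemma underdetermined_system:
  fixes a :: "'j \<Rightarrow> 'i \<Rightarrow> real"
  assumes "finite J" "finite I" "card J < card I"
  shows "\<exists>x. (\<exists>i\<in>I. x i \<noteq> 0) \<and> (\<forall>j\<in>J. (\<Sum>i\<in>I. a j i * x i) = 0)"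
  using assms
proof (induction J arbitrary: I a rule: finite_induct)
  case empty
  then have "I \<noteq> {}" by auto
  then show ?case by (intro exI[of _ "\<lambda>_. 1"]) auto
next
  case (insert k J)
  show ?case
  proof (cases "\<forall>i\<in>I. a k i = 0")
    case True
    have "card J < card I" using insert.prems insert.hyps by simp
    then obtain x where "\<exists>i\<in>I. x i \<noteq> 0" "\<forall>j\<in>J. (\<Sum>i\<in>I. a j i * x i) = 0"
      using insert.IH[of I a] insert.prems by blast
    then show ?thesis using True by (intro exI[of _ x]) auto
  next
    case False
    then obtain i0 where i0: "i0 \<in> I" "a k i0 \<noteq> 0" by blast
    let ?I = "I - {i0}"
    let ?a = "\<lambda>j i. a j i - a j i0 * a k i / a k i0"
    have "card J < card ?I" using insert.prems insert.hyps i0 by simp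
    then obtain x where x: "\<exists>i\<in>?I. x i \<noteq> 0" "\<forall>j\<in>J. (\<Sum>i\<in>?I. ?a j i * x i) = 0"
      using insert.IH[of ?I ?a] insert.prems by blast
    define y where "y = x(i0 := - (\<Sum>i\<in>?I. a k i * x i) / a k i0)"
    have y: "(\<Sum>i\<in>I. a j i * y i) = (\<Sum>i\<in>?I. a j i * x i) - a j i0 * (\<Sum>i\<in>?I. a k i * x i) / a k i0" for j
    proof -
      have "(\<Sum>i\<in>I. a j i * y i) = a j i0 * y i0 + (\<Sum>i\<in>?I. a j i * y i)"
        using i0 insert.prems by (simp add: sum.remove)
      also have "(\<Sum>i\<in>?I. a j i * y i) = (\<Sum>i\<in>?I. a j i * x i)"
        by (intro sum.cong) (auto simp: y_def)
      finally show ?thesis by (simp add: y_def)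
    qed
    have "(\<Sum>i\<in>I. a j i * y i) = 0" if "j \<in> J" for j
    proof -
      have "(\<Sum>i\<in>I. a j i * y i) = (\<Sum>i\<in>?I. ?a j i * x i)"
        unfolding y by (simp add: sum_subtractf sum_distrib_left sum_divide_distrib algebra_simps)
      then show ?thesis using x that by simp
    qed
    moreover have "(\<Sum>i\<in>I. a k i * y i) = 0" unfolding y using i0 by simp
    moreover have "\<exists>i\<in>I. y i \<noteq> 0" using x(1) by (auto simp: y_def)
    ultimately show ?thesis by (intro exI[of _ y]) auto
  qed
qed

definition monomial :: "('D::finite \<Rightarrow> nat) \<Rightarrow> real ^ 'D \<Rightarrow> real" where
  "monomial \<alpha> x = (\<Prod>i\<in>UNIV. (x $ i) ^ \<alpha> i)"

lemma finite_exponents_le: "finite {\<alpha> :: 'D::finite \<Rightarrow> nat. (\<Sum>i\<in>UNIV. \<alpha> i) \<le> k}"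
proof (rule finite_subset)
  show "{\<alpha> :: 'D \<Rightarrow> nat. (\<Sum>i\<in>UNIV. \<alpha> i) \<le> k} \<subseteq> PiE UNIV (\<lambda>_. {..k})"
  proof
    fix \<alpha> :: "'D \<Rightarrow> nat" assume "\<alpha> \<in> {\<alpha>. (\<Sum>i\<in>UNIV. \<alpha> i) \<le> k}"
    then have "\<alpha> i \<le> k" for i using member_le_sum[of i UNIV \<alpha>] by auto
    then show "\<alpha> \<in> PiE UNIV (\<lambda>_. {..k})" by auto
  qed
qed (simp add: finite_PiE)

lemma polynomial_deg_le_iff:
  "polynomial_deg_le k f \<longleftrightarrow> (\<exists>a. \<forall>x. f x = (\<Sum>\<alpha> | (\<Sum>i\<in>UNIV. \<alpha> i) \<le> k. a \<alpha> * monomial \<alpha> x))"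
  by (simp add: polynomial_deg_le_def monomial_def)

lemma polynomial_deg_le_add:
  assumes "polynomial_deg_le k f" "polynomial_deg_le k g"
  shows "polynomial_deg_le k (\<lambda>x. f x + g x)"
proof -
  obtain a b where "\<And>x. f x = (\<Sum>\<alpha> | (\<Sum>i\<in>UNIV. \<alpha> i) \<le> k. a \<alpha> * monomial \<alpha> x)"
     "\<And>x. g x = (\<Sum>\<alpha> | (\<Sum>i\<in>UNIV. \<alpha> i) \<le> k. b \<alpha> * monomial \<alpha> x)"
    using assms unfolding polynomial_deg_le_iff by blast
  then show ?thesis unfolding polynomial_deg_le_iff
    by (intro exI[of _ "\<lambda>\<alpha>. a \<alpha> + b \<alpha>"]) (simp add: sum.distrib distrib_right)
qed

lemma polynomial_deg_le_cmult:
  assumes "polynomial_deg_le k f"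
  shows "polynomial_deg_le k (\<lambda>x. c * f x)"
proof -
  obtain a where "\<And>x. f x = (\<Sum>\<alpha> | (\<Sum>i\<in>UNIV. \<alpha> i) \<le> k. a \<alpha> * monomial \<alpha> x)"
    using assms unfolding polynomial_deg_le_iff by blast
  then show ?thesis unfolding polynomial_deg_le_iff
    by (intro exI[of _ "\<lambda>\<alpha>. c * a \<alpha>"]) (simp add: sum_distrib_left mult.assoc)
qed

lemma polynomial_deg_le_monomial:
  assumes "(\<Sum>i\<in>UNIV. \<alpha> i) \<le> k"
  shows "polynomial_deg_le k (monomial \<alpha>)"
  unfolding polynomial_deg_le_iff
proof (intro exI allI)
  fix x
  have "(\<Sum>\<beta> | (\<Sum>i\<in>UNIV. \<beta> i) \<le> k. (if \<beta> = \<alpha> then 1 else 0) * monomial \<beta> x)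
    = (\<Sum>\<beta> | (\<Sum>i\<in>UNIV. \<beta> i) \<le> k. if \<beta> = \<alpha> then monomial \<beta> x else 0)"
    by (intro sum.cong) auto
  also have "\<dots> = monomial \<alpha> x"
    using assms by (subst sum.delta) (auto simp: finite_exponents_le)
  finally show "monomial \<alpha> x = (\<Sum>\<beta> | (\<Sum>i\<in>UNIV. \<beta> i) \<le> k. (if \<beta> = \<alpha> then 1 else 0) * monomial \<beta> x)"
    by simp
qed

lemma polynomial_deg_le_0: "polynomial_deg_le k (\<lambda>x. 0)"
  using polynomial_deg_le_cmult[OF polynomial_deg_le_monomial[of "\<lambda>_. 0" k], of 0] by simp

lemma polynomial_deg_le_sum:
  "(\<And>i. i \<in> A \<Longrightarrow> polynomial_deg_le k (f i)) \<Longrightarrow> polynomial_deg_le k (\<lambda>x. \<Sum>i\<in>A. f i x)"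
  by (induction A rule: infinite_finite_induct) (auto intro: polynomial_deg_le_0 polynomial_deg_le_add)

text \<open>Reduces a closure property of polynomials to monomials.\<close>

lemma polynomial_deg_le_induct:
  assumes "polynomial_deg_le k f"
    and sum: "\<And>(A :: ('D::finite \<Rightarrow> nat) set) a. finite A \<Longrightarrow> (\<And>\<alpha>. \<alpha> \<in> A \<Longrightarrow> P (monomial \<alpha>)) \<Longrightarrow>
       P (\<lambda>x. \<Sum>\<alpha>\<in>A. a \<alpha> * monomial \<alpha> x)"
    and mono: "\<And>\<alpha>. (\<Sum>i\<in>UNIV. \<alpha> i) \<le> k \<Longrightarrow> P (monomial \<alpha>)"
  shows "P f"
proof -
  obtain a where "\<And>x. f x = (\<Sum>\<alpha> | (\<Sum>i\<in>UNIV. \<alpha> i) \<le> k. a \<alpha> * monomial \<alpha> x)"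
    using assms(1) unfolding polynomial_deg_le_iff by blast
  then have "f = (\<lambda>x. \<Sum>\<alpha> | (\<Sum>i\<in>UNIV. \<alpha> i) \<le> k. a \<alpha> * monomial \<alpha> x)" by blast
  then show ?thesis
    using sum[of "{\<alpha>. (\<Sum>i\<in>UNIV. \<alpha> i) \<le> k}" a] mono finite_exponents_le by auto
qed

lemma polynomial_deg_le_mono:
  fixes f :: "real ^ 'a::finite \<Rightarrow> real"
  assumes "polynomial_deg_le k f" "k \<le> k'"
  shows "polynomial_deg_le k' f"
  using assms(1)
proof (rule polynomial_deg_le_induct)
  fix \<alpha> :: "'a \<Rightarrow> nat" assume "(\<Sum>i\<in>UNIV. \<alpha> i) \<le> k"
  then show "polynomial_deg_le k' (monomial \<alpha>)"
    using assms(2) by (intro polynomial_deg_le_monomial) simp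
qed (intro polynomial_deg_le_sum polynomial_deg_le_cmult)

lemma monomial_mult: "monomial \<alpha> x * monomial \<beta> x = monomial (\<lambda>i. \<alpha> i + \<beta> i) x"
  by (simp add: monomial_def power_add prod.distrib)

lemma polynomial_deg_le_mult:
  fixes f g :: "real ^ 'a::finite \<Rightarrow> real"
  assumes f: "polynomial_deg_le k f" and g: "polynomial_deg_le l g"
  shows "polynomial_deg_le (k + l) (\<lambda>x. f x * g x)"
  using f
proof (rule polynomial_deg_le_induct)
  fix \<alpha> :: "'a \<Rightarrow> nat" assume \<alpha>: "(\<Sum>i\<in>UNIV. \<alpha> i) \<le> k"
  show "polynomial_deg_le (k + l) (\<lambda>x. monomial \<alpha> x * g x)"
    using g
  proof (rule polynomial_deg_le_induct)
    fix \<beta> :: "'a \<Rightarrow> nat" assume "(\<Sum>i\<in>UNIV. \<beta> i) \<le> l"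
    then show "polynomial_deg_le (k + l) (\<lambda>x. monomial \<alpha> x * monomial \<beta> x)"
      unfolding monomial_mult using \<alpha> by (intro polynomial_deg_le_monomial) (simp add: sum.distrib)
  next
    fix A :: "('a \<Rightarrow> nat) set" and a assume "\<And>\<beta>. \<beta> \<in> A \<Longrightarrow> polynomial_deg_le (k + l) (\<lambda>x. monomial \<alpha> x * monomial \<beta> x)"
    then have "polynomial_deg_le (k + l) (\<lambda>x. \<Sum>\<beta>\<in>A. a \<beta> * (monomial \<alpha> x * monomial \<beta> x))"
      by (intro polynomial_deg_le_sum polynomial_deg_le_cmult)
    then show "polynomial_deg_le (k + l) (\<lambda>x. monomial \<alpha> x * (\<Sum>\<beta>\<in>A. a \<beta> * monomial \<beta> x))"
      by (simp add: sum_distrib_left mult.left_commute)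
  qed
next
  fix A :: "('a \<Rightarrow> nat) set" and a assume "\<And>\<alpha>. \<alpha> \<in> A \<Longrightarrow> polynomial_deg_le (k + l) (\<lambda>x. monomial \<alpha> x * g x)"
  then have "polynomial_deg_le (k + l) (\<lambda>x. \<Sum>\<alpha>\<in>A. a \<alpha> * (monomial \<alpha> x * g x))"
    by (intro polynomial_deg_le_sum polynomial_deg_le_cmult)
  then show "polynomial_deg_le (k + l) (\<lambda>x. (\<Sum>\<alpha>\<in>A. a \<alpha> * monomial \<alpha> x) * g x)"
    by (simp add: sum_distrib_right mult.assoc)
qed

lemma polynomial_deg_le_const: "polynomial_deg_le k (\<lambda>x. c)"
  using polynomial_deg_le_cmult[OF polynomial_deg_le_monomial[of "\<lambda>_. 0" k], of c]
  by (simp add: monomial_def)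

lemma polynomial_deg_le_component: "polynomial_deg_le 1 (\<lambda>x :: real^'D::finite. x $ i)"
proof -
  have "monomial (\<lambda>j. if j = i then 1 else 0) x = x $ i" for x :: "real^'D"
    unfolding monomial_def by (subst prod.remove[of _ i]) auto
  moreover have "polynomial_deg_le 1 (monomial (\<lambda>j. if j = i then 1 else 0) :: real^'D \<Rightarrow> real)"
    by (rule polynomial_deg_le_monomial) simp
  ultimately show ?thesis by (metis (no_types, lifting) ext)
qed

lemma polynomial_deg_le_prod_list:
  "(\<And>f. f \<in> set fs \<Longrightarrow> polynomial_deg_le k f) \<Longrightarrow>
    polynomial_deg_le (length fs * k) (\<lambda>x. prod_list (map (\<lambda>f. f x) fs))"
proof (induction fs)
  case (Cons f fs)
  then show ?case using polynomial_deg_le_mult[of k f "length fs * k"] by simp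
qed (simp add: polynomial_deg_le_const)

lemma polynomial_deg_le_prod:
  "(\<And>i. i \<in> A \<Longrightarrow> polynomial_deg_le k (f i)) \<Longrightarrow>
    polynomial_deg_le (card A * k) (\<lambda>x. \<Prod>i\<in>A. f i x)"
proof (induction A rule: infinite_finite_induct)
  case (insert i A)
  then show ?case using polynomial_deg_le_mult[of k "f i" "card A * k"] by simp
qed (auto intro: polynomial_deg_le_const)

lemma continuous_on_monomial: "continuous_on S (monomial \<alpha>)"
  unfolding monomial_def by (intro continuous_intros)

lemma polynomial_deg_le_continuous_on:
  assumes "polynomial_deg_le k f" shows "continuous_on S f"
  using assms by (rule polynomial_deg_le_induct) (auto intro!: continuous_intros continuous_on_monomial)

lemma polynomial_deg_le_partial_derivative:
  fixes f :: "real ^ 'D::finite \<Rightarrow> real"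
  assumes "polynomial_deg_le k f"
  shows "\<exists>f'. polynomial_deg_le (k - 1) f' \<and>
    (\<forall>x. ((\<lambda>t. f (x + t *\<^sub>R axis i 1)) has_real_derivative f' x) (at 0))"
  using assms
proof (rule polynomial_deg_le_induct)
  fix \<alpha> :: "'D \<Rightarrow> nat" assume \<alpha>: "(\<Sum>i\<in>UNIV. \<alpha> i) \<le> k"
  define c where "c = (\<lambda>x :: real^'D. \<Prod>j\<in>UNIV - {i}. (x $ j) ^ \<alpha> j)"
  have split: "monomial \<beta> x = (x $ i) ^ \<beta> i * (\<Prod>j\<in>UNIV - {i}. (x $ j) ^ \<beta> j)" for \<beta> and x :: "real^'D"
    unfolding monomial_def by (subst prod.remove[of _ i]) auto
  have line: "monomial \<alpha> (x + t *\<^sub>R axis i 1) = (x $ i + t) ^ \<alpha> i * c x" for x t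
    unfolding split c_def by (intro arg_cong2[of _ _ _ _ "(*)"] prod.cong) (auto simp: axis_def)
  let ?f' = "\<lambda>x. real (\<alpha> i) * monomial (\<alpha>(i := \<alpha> i - 1)) x"
  show "\<exists>f'. polynomial_deg_le (k - 1) f' \<and>
    (\<forall>x. ((\<lambda>t. monomial \<alpha> (x + t *\<^sub>R axis i 1)) has_real_derivative f' x) (at 0))"
  proof (intro exI[of _ ?f'] conjI allI)
    show "polynomial_deg_le (k - 1) ?f'"
    \<comment> \<open>The subtractions in \<open>k - 1\<close> and \<open>\<alpha> i - 1\<close> are
      truncated; for exponent 0 the derivative vanishes.\<close>
    proof (cases "\<alpha> i = 0")
      case True then show ?thesis by (simp add: polynomial_deg_le_0)
    next
      case False
      have "(\<Sum>j\<in>UNIV. \<alpha> j) = \<alpha> i + (\<Sum>j\<in>UNIV-{i}. \<alpha> j)"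
        by (subst sum.remove[of _ i]) auto
      moreover have "(\<Sum>j\<in>UNIV. (\<alpha>(i := \<alpha> i - 1)) j) = (\<alpha> i - 1) + (\<Sum>j\<in>UNIV-{i}. \<alpha> j)"
        by (subst sum.remove[of _ i]) auto
      ultimately have "(\<Sum>j\<in>UNIV. (\<alpha>(i := \<alpha> i - 1)) j) \<le> k - 1" using False \<alpha> by linarith
      then show ?thesis by (intro polynomial_deg_le_cmult polynomial_deg_le_monomial)
    qed
    fix x
    have eq: "?f' x = real (\<alpha> i) * (x $ i) ^ (\<alpha> i - 1) * c x"
      unfolding split[of "\<alpha>(i := \<alpha> i - 1)"] c_def by simp
    moreover have "((\<lambda>t. (x $ i + t) ^ \<alpha> i * c x) has_real_derivative
        real (\<alpha> i) * (x $ i) ^ (\<alpha> i - 1) * c x) (at 0)"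
      by (auto intro!: derivative_eq_intros)
    ultimately show "((\<lambda>t. monomial \<alpha> (x + t *\<^sub>R axis i 1)) has_real_derivative ?f' x) (at 0)"
      by (simp only: line eq)
  qed
next
  fix A a
  assume A: "finite A" and "\<And>\<alpha>. \<alpha> \<in> A \<Longrightarrow> \<exists>f'. polynomial_deg_le (k - 1) f' \<and>
    (\<forall>x :: real^'D. ((\<lambda>t. monomial \<alpha> (x + t *\<^sub>R axis i 1)) has_real_derivative f' x) (at 0))"
  then obtain f' where f': "\<And>\<alpha>. \<alpha> \<in> A \<Longrightarrow> polynomial_deg_le (k - 1) (f' \<alpha>)"
    "\<And>\<alpha> x :: real^'D. \<alpha> \<in> A \<Longrightarrow> ((\<lambda>t. monomial \<alpha> (x + t *\<^sub>R axis i 1)) has_real_derivative f' \<alpha> x) (at 0)"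
    by metis
  show "\<exists>f'. polynomial_deg_le (k - 1) f' \<and> (\<forall>x :: real^'D.
    ((\<lambda>t. \<Sum>\<alpha>\<in>A. a \<alpha> * monomial \<alpha> (x + t *\<^sub>R axis i 1)) has_real_derivative f' x) (at 0))"
    using f' by (intro exI[of _ "\<lambda>x. \<Sum>\<alpha>\<in>A. a \<alpha> * f' \<alpha> x"])
      (auto intro!: polynomial_deg_le_sum polynomial_deg_le_cmult DERIV_sum DERIV_cmult)
qed

text \<open>On the common zeros every polynomial is a linear combination of the \<open>e ^ CARD('D)\<close> monomials
  with all exponents below \<open>e\<close>.\<close>

lemma card_common_zeros_le:
  fixes Z :: "(real ^ 'D::finite) set"
  assumes Z: "finite Z" and q: "\<And>i. polynomial_deg_le (e - 1) (q i)" and e: "e \<ge> 1"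
    and zero: "\<And>x i. x \<in> Z \<Longrightarrow> (x $ i) ^ e = q i x"
  shows "card Z \<le> e ^ CARD('D)"
proof (rule ccontr)
  assume many: "\<not> ?thesis"
  define J where "J = (PiE UNIV (\<lambda>_. {..<e}) :: ('D \<Rightarrow> nat) set)"
  have J: "finite J" "card J = e ^ CARD('D)"
    by (simp_all add: J_def finite_PiE card_PiE)
  \<comment> \<open>A nontrivial relation between the evaluations at the points of \<open>Z\<close>
    on the reduced monomials; it exists because the points outnumber these monomials.\<close>
  obtain c where c: "\<exists>z\<in>Z. c z \<noteq> 0" "\<forall>\<alpha>\<in>J. (\<Sum>z\<in>Z. monomial \<alpha> z * c z) = 0"
    using underdetermined_system[of J Z monomial] J Z many by auto
  \<comment> \<open>The relation extends to all polynomials: on \<open>Z\<close> a factor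
    \<open>(x $ i) ^ e\<close> may be replaced by \<open>q i x\<close>, which lowers the
    degree.\<close>
  have van: "(\<Sum>z\<in>Z. c z * h z) = 0" if "polynomial_deg_le n h" for n and h :: "real ^ 'D \<Rightarrow> real"
    using that
  proof (induction n arbitrary: h rule: less_induct)
    case (less n)
    from less.prems show ?case
    proof (rule polynomial_deg_le_induct)
      fix \<alpha> :: "'D \<Rightarrow> nat" assume \<alpha>: "(\<Sum>i\<in>UNIV. \<alpha> i) \<le> n"
      show "(\<Sum>z\<in>Z. c z * monomial \<alpha> z) = 0"
      proof (cases "\<alpha> \<in> J")
        case True then show ?thesis using c(2) by (simp add: mult.commute)
      next
        case False
        then have "\<exists>i. \<alpha> i \<ge> e" by (auto simp: J_def PiE_UNIV_domain simp flip: not_le)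
        then obtain i where i: "\<alpha> i \<ge> e" by blast
        define \<beta> where "\<beta> = \<alpha>(i := \<alpha> i - e)"
        have split: "monomial \<gamma> x = (x $ i) ^ \<gamma> i * (\<Prod>j\<in>UNIV - {i}. (x $ j) ^ \<gamma> j)"
          for \<gamma> and x :: "real^'D"
          unfolding monomial_def by (subst prod.remove[of _ i]) auto
        have eq: "monomial \<alpha> x = monomial \<beta> x * (x $ i) ^ e" for x :: "real^'D"
        proof -
          have "(x $ i) ^ \<alpha> i = (x $ i) ^ (\<alpha> i - e) * (x $ i) ^ e"
            using i by (simp flip: power_add)
          then show ?thesis unfolding split[of \<alpha>] split[of \<beta>] by (simp add: \<beta>_def)
        qed
        have "(\<Sum>j\<in>UNIV. \<alpha> j) = \<alpha> i + (\<Sum>j\<in>UNIV-{i}. \<alpha> j)"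
          by (subst sum.remove[of _ i]) auto
        moreover have "(\<Sum>j\<in>UNIV. \<beta> j) = (\<alpha> i - e) + (\<Sum>j\<in>UNIV-{i}. \<alpha> j)"
          unfolding \<beta>_def by (subst sum.remove[of _ i]) auto
        ultimately have deg: "(\<Sum>j\<in>UNIV. \<beta> j) + (e - 1) < n + 0" "n \<ge> 1" using i e \<alpha> by linarith+
        have "polynomial_deg_le ((\<Sum>j\<in>UNIV. \<beta> j) + (e - 1)) (\<lambda>x. monomial \<beta> x * q i x)"
          by (intro polynomial_deg_le_mult polynomial_deg_le_monomial q) simp
        from less.IH[OF _ this] deg have "(\<Sum>z\<in>Z. c z * (monomial \<beta> z * q i z)) = 0" by simp
        moreover have "(\<Sum>z\<in>Z. c z * monomial \<alpha> z) = (\<Sum>z\<in>Z. c z * (monomial \<beta> z * q i z))"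
          using zero eq by (intro sum.cong) auto
        ultimately show ?thesis by simp
      qed
    next
      fix A :: "('D \<Rightarrow> nat) set" and a
      assume A: "\<And>\<alpha>. \<alpha> \<in> A \<Longrightarrow> (\<Sum>z\<in>Z. c z * monomial \<alpha> z) = 0"
      have "(\<Sum>z\<in>Z. c z * (\<Sum>\<alpha>\<in>A. a \<alpha> * monomial \<alpha> z)) = (\<Sum>\<alpha>\<in>A. a \<alpha> * (\<Sum>z\<in>Z. c z * monomial \<alpha> z))"
        by (simp add: sum_distrib_left mult_ac) (rule sum.swap)
      then show "(\<Sum>z\<in>Z. c z * (\<Sum>\<alpha>\<in>A. a \<alpha> * monomial \<alpha> z)) = 0" using A by simp
    qed
  qed
  obtain z0 where z0: "z0 \<in> Z" "c z0 \<noteq> 0" using c(1) by blast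
  have "\<exists>i. z0 $ i \<noteq> z $ i" if "z \<noteq> z0" for z using that unfolding vec_eq_iff by metis
  then obtain \<iota> where \<iota>: "\<And>z. z \<noteq> z0 \<Longrightarrow> z0 $ \<iota> z \<noteq> z $ \<iota> z" by metis
  \<comment> \<open>Vanishes on \<open>Z\<close> except at \<open>z0\<close>, where the relation has
    a nonzero coefficient.\<close>
  define h where "h = (\<lambda>x :: real^'D. \<Prod>z\<in>Z - {z0}. x $ \<iota> z + - z $ \<iota> z)"
  have "polynomial_deg_le (card (Z - {z0}) * 1) h"
    unfolding h_def
    by (intro polynomial_deg_le_prod polynomial_deg_le_add polynomial_deg_le_component polynomial_deg_le_const)
  then have "(\<Sum>z\<in>Z. c z * h z) = 0" by (rule van)
  moreover have "h z = 0" if "z \<in> Z - {z0}" for z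
    unfolding h_def using that Z by (intro prod_zero) auto
  then have "(\<Sum>z\<in>Z. c z * h z) = c z0 * h z0"
    using z0 Z by (simp add: sum.remove)
  moreover have "h z0 \<noteq> 0"
    unfolding h_def using \<iota> Z by (auto simp: prod_zero_iff)
  ultimately show False using z0 by simp
qed

lemma polynomial_deg_le_growth:
  fixes f :: "real ^ 'D::finite \<Rightarrow> real"
  assumes "polynomial_deg_le k f"
  shows "\<exists>C\<ge>0. \<forall>x. \<bar>f x\<bar> \<le> C * (1 + norm x) ^ k"
  using assms
proof (rule polynomial_deg_le_induct)
  fix \<alpha> :: "'D \<Rightarrow> nat" assume \<alpha>: "(\<Sum>i\<in>UNIV. \<alpha> i) \<le> k"
  have "\<bar>monomial \<alpha> x\<bar> \<le> 1 * (1 + norm x) ^ k" for x :: "real^'D"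
  proof -
    have "\<bar>monomial \<alpha> x\<bar> = (\<Prod>i\<in>UNIV. \<bar>x $ i\<bar> ^ \<alpha> i)"
      by (simp add: monomial_def abs_prod power_abs)
    also have "\<dots> \<le> (\<Prod>i\<in>UNIV. (1 + norm x) ^ \<alpha> i)"
    proof (intro prod_mono conjI power_mono)
      show "\<bar>x $ i\<bar> \<le> 1 + norm x" for i using component_le_norm_cart[of x i] by linarith
    qed auto
    also have "\<dots> = (1 + norm x) ^ (\<Sum>i\<in>UNIV. \<alpha> i)" by (simp add: power_sum)
    also have "\<dots> \<le> (1 + norm x) ^ k" using \<alpha> by (intro power_increasing) auto
    finally show ?thesis by simp
  qed
  then show "\<exists>C\<ge>0. \<forall>x. \<bar>monomial \<alpha> x\<bar> \<le> C * (1 + norm x) ^ k"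
    by (intro exI[of _ 1]) auto
next
  fix A :: "('D \<Rightarrow> nat) set" and a
  assume A: "finite A" "\<And>\<alpha>. \<alpha> \<in> A \<Longrightarrow> \<exists>C\<ge>0. \<forall>x. \<bar>monomial \<alpha> x\<bar> \<le> C * (1 + norm x) ^ k"
  then obtain C where C: "\<And>\<alpha>. \<alpha> \<in> A \<Longrightarrow> C \<alpha> \<ge> 0" "\<And>\<alpha> x. \<alpha> \<in> A \<Longrightarrow> \<bar>monomial \<alpha> x\<bar> \<le> C \<alpha> * (1 + norm x) ^ k"
    by metis
  have "\<bar>\<Sum>\<alpha>\<in>A. a \<alpha> * monomial \<alpha> x\<bar> \<le> (\<Sum>\<alpha>\<in>A. \<bar>a \<alpha>\<bar> * C \<alpha>) * (1 + norm x) ^ k" for x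
  proof -
    have "\<bar>\<Sum>\<alpha>\<in>A. a \<alpha> * monomial \<alpha> x\<bar> \<le> (\<Sum>\<alpha>\<in>A. \<bar>a \<alpha>\<bar> * \<bar>monomial \<alpha> x\<bar>)"
      using sum_abs[of "\<lambda>\<alpha>. a \<alpha> * monomial \<alpha> x" A] by (simp add: abs_mult)
    also have "\<dots> \<le> (\<Sum>\<alpha>\<in>A. \<bar>a \<alpha>\<bar> * (C \<alpha> * (1 + norm x) ^ k))"
      using C by (intro sum_mono mult_left_mono) auto
    finally show ?thesis by (simp add: sum_distrib_right mult.assoc)
  qed
  moreover have "(\<Sum>\<alpha>\<in>A. \<bar>a \<alpha>\<bar> * C \<alpha>) \<ge> 0" using C(1) by (intro sum_nonneg mult_nonneg_nonneg) auto
  ultimately show "\<exists>C\<ge>0. \<forall>x. \<bar>\<Sum>\<alpha>\<in>A. a \<alpha> * monomial \<alpha> x\<bar> \<le> C * (1 + norm x) ^ k"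
    by blast
qed

text \<open>The norm is at most the sum of the absolute coordinates, so one coordinate carries at
  least the average share; evenness makes all other summands nonnegative.\<close>

lemma power_sum_lower_bound:
  fixes x :: "real ^ 'D::finite"
  assumes "even m"
  shows "(norm x / CARD('D)) ^ m \<le> (\<Sum>i\<in>UNIV. (x $ i) ^ m)"
proof -
  have "\<exists>i. norm x / CARD('D) \<le> \<bar>x $ i\<bar>"
  proof (rule ccontr)
    assume "\<not> ?thesis"
    then have "(\<Sum>i\<in>UNIV. \<bar>x $ i\<bar>) < (\<Sum>i\<in>(UNIV :: 'D set). norm x / CARD('D))"
      by (intro sum_strict_mono) (auto simp: not_le)
    then show False using norm_le_l1_cart[of x] by simp
  qed
  then obtain i where i: "norm x / CARD('D) \<le> \<bar>x $ i\<bar>" by blast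
  then have "(norm x / CARD('D)) ^ m \<le> \<bar>x $ i\<bar> ^ m" by (intro power_mono) auto
  also have "\<dots> = (x $ i) ^ m" using assms by (simp add: power_even_abs)
  also have "\<dots> \<le> (\<Sum>i\<in>UNIV. (x $ i) ^ m)"
    using assms by (intro member_le_sum[of i UNIV "\<lambda>i. (x $ i) ^ m"]) auto
  finally show ?thesis .
qed

subsection \<open>Components of the complement of a zero set\<close>

text \<open>In each component, \<open>g\<^sup>2 - \<epsilon> \<Sum> x\<^sub>i\<^bsup>2k+2\<^esup>\<close> attains a positive local maximum, and the critical
  equations have the shape required by the previous bound on common zeros.\<close>

theorem card_components_nonzero_le:
  fixes g :: "real ^ 'D::finite \<Rightarrow> real"
  assumes g: "polynomial_deg_le k g" and A: "finite A" and nz: "\<And>p. p \<in> A \<Longrightarrow> g p \<noteq> 0"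
    and sep: "\<And>p p'. p \<in> A \<Longrightarrow> p' \<in> A \<Longrightarrow> connected_component {x. g x \<noteq> 0} p p' \<Longrightarrow> p = p'"
  shows "card A \<le> (2 * k + 1) ^ CARD('D)"
proof (cases "A = {}")
  case False
  let ?G = "{x. g x \<noteq> 0}"
  define s where "s = (\<lambda>x :: real^'D. \<Sum>i\<in>UNIV. (x $ i) ^ (2 * k + 2))"
  have s0: "s x \<ge> 0" for x unfolding s_def by (intro sum_nonneg zero_le_even_power) simp
  have contg: "continuous_on S g" for S using g by (rule polynomial_deg_le_continuous_on)
  have openG: "open ?G" by (intro open_Collect_neq contg continuous_on_const)
  \<comment> \<open>Small enough that \<open>\<psi>\<close> is positive at every point of
    \<open>A\<close>; the added 1 keeps the denominators positive.\<close>
  define \<epsilon> where "\<epsilon> = Min ((\<lambda>p. (g p)\<^sup>2 / (s p + 1)) ` A)"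
  have pos: "(g p)\<^sup>2 / (s p + 1) > 0" if "p \<in> A" for p
    using nz[OF that] s0[of p] by (simp add: divide_pos_pos)
  have eps: "\<epsilon> > 0" unfolding \<epsilon>_def using A False pos by (subst Min_gr_iff) auto
  define \<psi> where "\<psi> = (\<lambda>x. (g x)\<^sup>2 - \<epsilon> * s x)"
  have \<psi>pos: "\<psi> p > 0" if "p \<in> A" for p
  proof -
    have "\<epsilon> \<le> (g p)\<^sup>2 / (s p + 1)" unfolding \<epsilon>_def using A that by (intro Min_le) auto
    then have "\<epsilon> * (s p + 1) \<le> (g p)\<^sup>2" using s0[of p] by (simp add: field_simps)
    then show ?thesis using eps by (simp add: \<psi>_def algebra_simps)
  qed
  have cont\<psi>: "continuous_on S \<psi>" for S
    unfolding \<psi>_def s_def by (intro continuous_intros contg)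
  obtain C where C: "C \<ge> 0" "\<And>x. \<bar>g x\<bar> \<le> C * (1 + norm x) ^ k"
    using polynomial_deg_le_growth[OF g] by blast
  let ?d = "real CARD('D)"
  \<comment> \<open>Beyond radius \<open>K + 1\<close> the subtracted term of degree 2k + 2
    dominates the square of \<open>g\<close>, which grows with degree 2k; the maximum is thus sought
    in a bounded set.\<close>
  define K where "K = C\<^sup>2 * 4 ^ k * ?d ^ (2 * k + 2) / \<epsilon>"
  have K0: "K \<ge> 0" unfolding K_def using eps by simp
  have neg: "\<psi> x < 0" if x: "norm x > K + 1" for x
  proof -
    let ?n = "norm x"
    have n1: "?n > 1" using x K0 by linarith
    have "(g x)\<^sup>2 \<le> (C * (1 + ?n) ^ k)\<^sup>2"
      using C(2)[of x] by (metis abs_ge_zero power2_abs power_mono)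
    also have "\<dots> \<le> (C * (2 * ?n) ^ k)\<^sup>2"
      using n1 C(1) by (intro power_mono mult_left_mono) auto
    also have "\<dots> = C\<^sup>2 * 4 ^ k * ?n ^ (2 * k)"
    proof -
      have "(4::real) ^ k = 2 ^ (k * 2)" by (simp add: power_mult mult.commute[of k])
      then show ?thesis
        by (simp only: power_mult_distrib power_mult[symmetric] mult.commute[of 2 k] mult.assoc)
    qed
    finally have 1: "(g x)\<^sup>2 \<le> C\<^sup>2 * 4 ^ k * ?n ^ (2 * k)" .
    have "?n * 1 < ?n * ?n" using n1 by (intro mult_strict_left_mono) auto
    then have "K < ?n\<^sup>2" using x unfolding power2_eq_square by linarith
    then have "C\<^sup>2 * 4 ^ k * ?d ^ (2 * k + 2) < \<epsilon> * ?n\<^sup>2"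
      unfolding K_def using eps by (simp add: divide_less_eq mult.commute)
    then have "C\<^sup>2 * 4 ^ k < \<epsilon> * ?n\<^sup>2 / ?d ^ (2 * k + 2)" by (simp add: less_divide_eq)
    then have "C\<^sup>2 * 4 ^ k * ?n ^ (2 * k) < \<epsilon> * ?n\<^sup>2 / ?d ^ (2 * k + 2) * ?n ^ (2 * k)"
      using n1 by (intro mult_strict_right_mono zero_less_power) linarith+
    also have "\<dots> = \<epsilon> * (?n / ?d) ^ (2 * k + 2)"
      by (simp add: power_divide power_add power2_eq_square mult_ac)
    also have "\<dots> \<le> \<epsilon> * s x"
      unfolding s_def using eps by (intro mult_left_mono power_sum_lower_bound) auto
    finally show ?thesis using 1 by (simp add: \<psi>_def)
  qed
  have "\<exists>g'. \<forall>i. polynomial_deg_le (2 * k - 1) (g' i) \<and>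
    (\<forall>x. ((\<lambda>t. g (x + t *\<^sub>R axis i 1) * g (x + t *\<^sub>R axis i 1)) has_real_derivative g' i x) (at 0))"
    using polynomial_deg_le_partial_derivative[OF polynomial_deg_le_mult[OF g g]]
    by (intro choice allI) (simp only: mult_2)
  then obtain g' where g': "\<And>i. polynomial_deg_le (2 * k - 1) (g' i)"
    "\<And>i x. ((\<lambda>t. g (x + t *\<^sub>R axis i 1) * g (x + t *\<^sub>R axis i 1)) has_real_derivative g' i x) (at 0)"
    by blast
  have ex: "\<exists>y. connected_component ?G p y \<and> (\<forall>i. g' i y = \<epsilon> * (real (2 * k + 2) * (y $ i) ^ (2 * k + 1)))"
    if p: "p \<in> A" for p
  proof -
    let ?C = "connected_component_set ?G p"
    \<comment> \<open>The closure provides compactness. A maximiser still lies in the component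
      itself, since \<open>\<psi>\<close> is at most 0 where \<open>g\<close> vanishes but positive
      at \<open>p\<close>.\<close>
    let ?T = "closure ?C \<inter> {x. \<psi> x \<ge> 0}"
    have pC: "p \<in> ?C" using nz[OF p] by simp
    have "closed ?T" by (intro closed_Int closed_closure closed_Collect_le cont\<psi> continuous_on_const)
    moreover have "bounded ?T"
      unfolding bounded_iff using neg by (intro exI[of _ "K + 1"]) (force simp: not_le[symmetric])
    ultimately have "compact ?T" by (simp add: compact_eq_bounded_closed)
    moreover have "p \<in> ?T" using pC closure_subset[of ?C] \<psi>pos[OF p] by auto
    ultimately obtain y where y: "y \<in> ?T" "\<And>x. x \<in> ?T \<Longrightarrow> \<psi> x \<le> \<psi> y"
      using continuous_attains_sup[OF _ _ cont\<psi>] by (metis empty_iff)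
    have y0: "\<psi> y > 0" using y(2)[OF \<open>p \<in> ?T\<close>] \<psi>pos[OF p] by linarith
    then have "g y \<noteq> 0" using eps s0[of y] by (auto simp: \<psi>_def mult_less_0_iff)
    have "connected (insert y ?C)"
      using y(1) by (intro connected_intermediate_closure[OF connected_connected_component[of ?G p]])
        (auto intro: closure_subset[THEN subsetD])
    moreover have "insert y ?C \<subseteq> ?G" using \<open>g y \<noteq> 0\<close> connected_component_subset[of ?G p] by auto
    ultimately have "insert y ?C \<subseteq> ?C" using pC by (intro connected_component_maximal) auto
    then have yC: "y \<in> ?C" by blast
    have "open ?C" using openG by (rule open_connected_component)
    then obtain r where r: "r > 0" "ball y r \<subseteq> ?C" using yC open_contains_ball by blast
    have "g' i y = \<epsilon> * (real (2 * k + 2) * (y $ i) ^ (2 * k + 1))" for i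
    proof -
      let ?l = "\<lambda>t. y + t *\<^sub>R axis i (1::real)"
      have ds: "((\<lambda>t. s (?l t)) has_real_derivative real (2 * k + 2) * (y $ i) ^ (2 * k + 1)) (at 0)"
      proof -
        have pw: "((\<lambda>t. (a + t * b) ^ Suc n) has_real_derivative real (Suc n) * a ^ n * b) (at 0)"
          for a b :: real and n
          by (auto intro!: derivative_eq_intros simp del: power_Suc)
        have m: "2 * k + 2 = Suc (2 * k + 1)" by simp
        have "((\<lambda>t. \<Sum>j\<in>UNIV. (y $ j + t * axis i 1 $ j) ^ (2 * k + 2)) has_real_derivative
           (\<Sum>j\<in>UNIV. real (2 * k + 2) * (y $ j) ^ (2 * k + 1) * axis i 1 $ j)) (at 0)"
          unfolding m by (intro DERIV_sum pw)
        moreover have "(\<Sum>j\<in>UNIV. real (2 * k + 2) * (y $ j) ^ (2 * k + 1) * axis i 1 $ j)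
           = (\<Sum>j\<in>UNIV. if j = i then real (2 * k + 2) * (y $ j) ^ (2 * k + 1) else 0)"
          by (intro sum.cong) (auto simp: axis_def)
        ultimately show ?thesis by (simp add: s_def)
      qed
      have "((\<lambda>t. g (?l t) * g (?l t) - \<epsilon> * s (?l t)) has_real_derivative
          (g' i y - \<epsilon> * (real (2 * k + 2) * (y $ i) ^ (2 * k + 1)))) (at 0)"
        by (intro DERIV_diff DERIV_cmult g'(2) ds)
      then have D: "((\<lambda>t. \<psi> (?l t)) has_real_derivative
          (g' i y - \<epsilon> * (real (2 * k + 2) * (y $ i) ^ (2 * k + 1)))) (at 0)"
        by (simp add: \<psi>_def power2_eq_square)
      \<comment> \<open>Inside the ball, points with negative \<open>\<psi>\<close> are trivially
        below the maximum, and all others lie in \<open>?T\<close>.\<close>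
      have M: "\<forall>t. \<bar>0 - t\<bar> < r \<longrightarrow> \<psi> (?l t) \<le> \<psi> (?l 0)"
      proof (intro allI impI)
        fix t :: real assume "\<bar>0 - t\<bar> < r"
        then have "?l t \<in> ball y r" by (simp add: dist_norm)
        then have "?l t \<in> closure ?C" using r closure_subset by blast
        then show "\<psi> (?l t) \<le> \<psi> (?l 0)"
          using y(2)[of "?l t"] y0 by (cases "\<psi> (?l t) \<ge> 0") auto
      qed
      have "g' i y - \<epsilon> * (real (2 * k + 2) * (y $ i) ^ (2 * k + 1)) = 0"
        by (rule DERIV_local_max[OF D r(1) M])
      then show ?thesis by simp
    qed
    then show ?thesis using yC by auto
  qed
  have "\<exists>\<xi>. \<forall>p\<in>A. connected_component ?G p (\<xi> p) \<and>
      (\<forall>i. g' i (\<xi> p) = \<epsilon> * (real (2 * k + 2) * (\<xi> p $ i) ^ (2 * k + 1)))"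
    using ex by (intro bchoice ballI)
  then obtain \<xi> where "\<forall>p\<in>A. connected_component ?G p (\<xi> p) \<and>
      (\<forall>i. g' i (\<xi> p) = \<epsilon> * (real (2 * k + 2) * (\<xi> p $ i) ^ (2 * k + 1)))" ..
  note \<xi> = this[rule_format, THEN conjunct1] this[rule_format, THEN conjunct2, rule_format]
  have "inj_on \<xi> A"
  proof (rule inj_onI)
    fix p p' assume p: "p \<in> A" "p' \<in> A" "\<xi> p = \<xi> p'"
    have "connected_component ?G p (\<xi> p)" using \<xi>(1) p(1) .
    moreover have "connected_component ?G p' (\<xi> p)" unfolding p(3) using \<xi>(1) p(2) .
    ultimately have "connected_component ?G p p'"
      by (rule connected_component_trans[OF _ connected_component_sym])
    then show "p = p'" by (rule sep[OF p(1,2)])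
  qed
  then have "card A = card (\<xi> ` A)" by (simp add: card_image)
  also have "\<dots> \<le> (2 * k + 1) ^ CARD('D)"
  \<comment> \<open>The critical equations express the power 2k + 1 of each coordinate by a
    polynomial of smaller degree, a partial derivative of the square of \<open>g\<close>.\<close>
  proof (rule card_common_zeros_le)
    let ?c = "\<epsilon> * real (2 * k + 2)"
    show "polynomial_deg_le (2 * k + 1 - 1) (\<lambda>x. inverse ?c * g' i x)" for i
      using g'(1)[of i] by (intro polynomial_deg_le_cmult polynomial_deg_le_mono[OF g'(1)]) simp
    fix x i assume "x \<in> \<xi> ` A"
    then have "g' i x = ?c * (x $ i) ^ (2 * k + 1)" using \<xi>(2) by auto
    moreover have "inverse ?c * ?c = 1" using eps by (intro left_inverse) simp
    ultimately show "(x $ i) ^ (2 * k + 1) = inverse ?c * g' i x"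
      by (simp only: mult.assoc[symmetric] mult_1)
  qed (use A in auto)
  finally show ?thesis .
qed simp

subsection \<open>Generic points\<close>

lemma base_expansion_unique:
  fixes a b :: "nat \<Rightarrow> nat"
  assumes "\<And>j. j < n \<Longrightarrow> a j < B" "\<And>j. j < n \<Longrightarrow> b j < B"
    and "(\<Sum>j<n. a j * B ^ j) = (\<Sum>j<n. b j * B ^ j)"
  shows "\<forall>j<n. a j = b j"
  using assms
proof (induction n arbitrary: a b)
  case (Suc n)
  have e: "(\<Sum>j<Suc n. f j * B ^ j) = f 0 + B * (\<Sum>j<n. f (Suc j) * B ^ j)" for f
    by (subst sum.lessThan_Suc_shift) (simp add: sum_distrib_left mult_ac)
  have a0: "a 0 < B" "b 0 < B" using Suc.prems by auto
  have eq: "a 0 + B * (\<Sum>j<n. a (Suc j) * B ^ j) = b 0 + B * (\<Sum>j<n. b (Suc j) * B ^ j)"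
    using Suc.prems(3) unfolding e .
  have "(a 0 + B * (\<Sum>j<n. a (Suc j) * B ^ j)) mod B = a 0" using a0 by simp
  moreover have "(b 0 + B * (\<Sum>j<n. b (Suc j) * B ^ j)) mod B = b 0" using a0 by simp
  ultimately have 0: "a 0 = b 0" using eq by simp
  then have "(\<Sum>j<n. a (Suc j) * B ^ j) = (\<Sum>j<n. b (Suc j) * B ^ j)" using eq a0 by simp
  then have "\<forall>j<n. a (Suc j) = b (Suc j)"
    using Suc.prems(1,2) by (intro Suc.IH) auto
  then show ?case using 0 by (metis Suc_less_eq not0_implies_Suc)
qed simp

text \<open>The exponents are bounded in each coordinate separately: there are exactly (q + 1)^D of
  them, and they can be read as numerals in base q + 1.\<close>

definition exponent_box :: "nat \<Rightarrow> ('D::finite \<Rightarrow> nat) set" where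
  "exponent_box q = PiE UNIV (\<lambda>_. {..<Suc q})"

lemma finite_exponent_box: "finite (exponent_box q)"
  by (simp add: exponent_box_def finite_PiE)

lemma card_exponent_box: "card (exponent_box q :: ('D::finite \<Rightarrow> nat) set) = (q + 1) ^ CARD('D)"
  by (simp add: exponent_box_def card_PiE)

definition box_poly :: "nat \<Rightarrow> (('D::finite \<Rightarrow> nat) \<Rightarrow> real) \<Rightarrow> real ^ 'D \<Rightarrow> real" where
  "box_poly q c x = (\<Sum>\<alpha>\<in>exponent_box q. c \<alpha> * monomial \<alpha> x)"

lemma polynomial_deg_le_box_poly:
  "polynomial_deg_le (CARD('D) * q) (box_poly q c :: real ^ 'D::finite \<Rightarrow> real)"
proof -
  have "(\<Sum>i\<in>UNIV. \<alpha> i) \<le> CARD('D) * q" if "\<alpha> \<in> exponent_box q" for \<alpha> :: "'D \<Rightarrow> nat"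
  proof -
    have "\<alpha> i \<le> q" for i using that by (auto simp: exponent_box_def PiE_UNIV_domain Pi_iff less_Suc_eq_le)
    then show ?thesis using sum_bounded_above[of UNIV \<alpha> q] by simp
  qed
  then have "polynomial_deg_le (CARD('D) * q) (\<lambda>x::real^'D. \<Sum>\<alpha>\<in>exponent_box q. c \<alpha> * monomial \<alpha> x)"
    by (intro polynomial_deg_le_sum polynomial_deg_le_cmult polynomial_deg_le_monomial)
  then show ?thesis unfolding box_poly_def[abs_def] .
qed

text \<open>The substitution \<open>x\<^sub>i = t ^ (q + 1) ^ h i\<close> sends distinct monomials to distinct powers of \<open>t\<close>.\<close>

lemma box_poly_nonzero:
  fixes c :: "('D::finite \<Rightarrow> nat) \<Rightarrow> real"
  assumes \<alpha>0: "\<alpha>0 \<in> exponent_box q" "c \<alpha>0 \<noteq> 0"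
  shows "\<exists>x. box_poly q c x \<noteq> 0"
proof (rule ccontr)
  assume "\<not> ?thesis"
  then have zero: "box_poly q c x = 0" for x by blast
  obtain h :: "'D \<Rightarrow> nat" where h: "bij_betw h UNIV {..<CARD('D)}"
    using finite_same_card_bij[of "UNIV :: 'D set" "{..<CARD('D)}"] by auto
  define N where "N = (\<lambda>\<alpha> :: 'D \<Rightarrow> nat. \<Sum>i\<in>UNIV. \<alpha> i * (q + 1) ^ h i)"
  have inj: "\<alpha> = \<beta>" if "\<alpha> \<in> exponent_box q" "\<beta> \<in> exponent_box q" "N \<alpha> = N \<beta>" for \<alpha> \<beta>
  proof -
    let ?g = "the_inv_into UNIV h"
    have g: "?g (h i) = i" for i using h by (simp add: bij_betw_def the_inv_into_f_f)
    have re: "N \<gamma> = (\<Sum>j<CARD('D). \<gamma> (?g j) * (q + 1) ^ j)" for \<gamma>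
      unfolding N_def using sum.reindex_bij_betw[OF h, of "\<lambda>j. \<gamma> (?g j) * (q + 1) ^ j"] g by simp
    have "\<forall>j<CARD('D). \<alpha> (?g j) = \<beta> (?g j)"
      using that by (intro base_expansion_unique[where B = "q + 1"])
        (auto simp: re exponent_box_def PiE_UNIV_domain Pi_iff)
    moreover have "h i < CARD('D)" for i using h by (auto simp: bij_betw_def)
    ultimately show ?thesis using g by (metis ext)
  qed
  define p where "p = (\<Sum>\<alpha>\<in>exponent_box q. Polynomial.monom (c \<alpha>) (N \<alpha>))"
  have "poly p t = 0" for t
  proof -
    have "monomial \<alpha> (\<chi> i. t ^ ((q + 1) ^ h i)) = t ^ N \<alpha>" for \<alpha> :: "'D \<Rightarrow> nat"
      by (simp add: monomial_def N_def power_sum mult.commute flip: power_mult)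
    then show ?thesis
      using zero[of "\<chi> i. t ^ ((q + 1) ^ h i)"] by (simp add: p_def box_poly_def poly_sum poly_monom)
  qed
  then have "p = 0" using poly_all_0_iff_0[of p] by blast
  have "Polynomial.coeff p (N \<alpha>0) = (\<Sum>\<alpha>\<in>exponent_box q. if \<alpha> = \<alpha>0 then c \<alpha> else 0)"
    unfolding p_def coeff_sum using inj \<alpha>0 by (intro sum.cong) auto
  also have "\<dots> = c \<alpha>0" using \<alpha>0 by (subst sum.delta) (auto simp: finite_exponent_box)
  finally show False using \<open>p = 0\<close> \<alpha>0 by simp
qed

lemma polynomial_deg_le_on_line:
  fixes f :: "real ^ 'D::finite \<Rightarrow> real"
  assumes "polynomial_deg_le k f"
  shows "\<exists>P. \<forall>t. f (y + t *\<^sub>R w) = poly P t"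
  using assms
proof (rule polynomial_deg_le_induct)
  fix \<alpha> :: "'D \<Rightarrow> nat"
  show "\<exists>P. \<forall>t. monomial \<alpha> (y + t *\<^sub>R w) = poly P t"
    by (intro exI[of _ "\<Prod>i\<in>UNIV. [:y $ i, w $ i:] ^ \<alpha> i"]) (simp add: monomial_def poly_prod)
next
  fix A :: "('D \<Rightarrow> nat) set" and a
  assume "\<And>\<alpha>. \<alpha> \<in> A \<Longrightarrow> \<exists>P. \<forall>t. monomial \<alpha> (y + t *\<^sub>R w) = poly P t"
  then obtain P where "\<And>\<alpha> t. \<alpha> \<in> A \<Longrightarrow> monomial \<alpha> (y + t *\<^sub>R w) = poly (P \<alpha>) t" by metis
  then show "\<exists>P. \<forall>t. (\<Sum>\<alpha>\<in>A. a \<alpha> * monomial \<alpha> (y + t *\<^sub>R w)) = poly P t"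
    by (intro exI[of _ "\<Sum>\<alpha>\<in>A. Polynomial.smult (a \<alpha>) (P \<alpha>)"]) (simp add: poly_sum)
qed

text \<open>On the line from \<open>y\<close> to the point \<open>y0\<close> the polynomial is a
  nonzero polynomial in one variable, so it has only finitely many zeros near
  \<open>y\<close>.\<close>

lemma polynomial_nonzero_dense:
  fixes f :: "real ^ 'D::finite \<Rightarrow> real"
  assumes f: "polynomial_deg_le k f" "f y0 \<noteq> 0" and U: "open U" "y \<in> U"
  shows "\<exists>z\<in>U. f z \<noteq> 0"
proof -
  let ?w = "y0 - y"
  obtain P where P: "\<And>t. f (y + t *\<^sub>R ?w) = poly P t"
    using polynomial_deg_le_on_line[OF f(1)] by blast
  have "poly P 1 \<noteq> 0" using P[of 1] f(2) by simp
  then have "P \<noteq> 0" by auto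
  then have fin: "finite {t. poly P t = 0}" by (rule poly_roots_finite)
  obtain r where r: "r > 0" "ball y r \<subseteq> U" using U open_contains_ball by blast
  let ?d = "r / (norm ?w + 1)"
  have "?d > 0" using r by (intro divide_pos_pos) (auto intro: add_nonneg_pos)
  then have "infinite {0<..<?d}" by simp
  then have "\<not> {0<..<?d} \<subseteq> {t. poly P t = 0}" using fin finite_subset by blast
  then obtain t where "t \<in> {0<..<?d}" "poly P t \<noteq> 0" by blast
  then have t: "0 < t" "t < ?d" "poly P t \<noteq> 0" by auto
  have "norm (t *\<^sub>R ?w) \<le> t * (norm ?w + 1)" using t by simp
  also have "\<dots> < r"
    using t(2) pos_less_divide_eq[of "norm ?w + 1" t r] norm_ge_zero[of ?w] by linarith
  finally have "y + t *\<^sub>R ?w \<in> ball y r" by (simp add: dist_norm norm_minus_commute)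
  then have "y + t *\<^sub>R ?w \<in> U" using r(2) by blast
  moreover have "f (y + t *\<^sub>R ?w) \<noteq> 0" using P t(3) by simp
  ultimately show ?thesis ..
qed

lemma polynomials_nonzero_dense:
  fixes F :: "(real ^ 'D::finite \<Rightarrow> real) set"
  assumes "finite F" "\<And>f. f \<in> F \<Longrightarrow> polynomial_deg_le k f" "\<And>f. f \<in> F \<Longrightarrow> \<exists>y. f y \<noteq> 0"
    and "open U" "U \<noteq> {}"
  shows "\<exists>z\<in>U. \<forall>f\<in>F. f z \<noteq> 0"
  using assms
proof (induction F arbitrary: U rule: finite_induct)
  case (insert f F)
  obtain y0 where "f y0 \<noteq> 0" using insert.prems by blast
  let ?V = "U \<inter> {x. f x \<noteq> 0}"
  have "open {x. f x \<noteq> 0}"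
    using polynomial_deg_le_continuous_on insert.prems(1)[of f]
    by (intro open_Collect_neq continuous_on_const) auto
  then have "open ?V" using insert.prems by auto
  moreover have "?V \<noteq> {}"
    using polynomial_nonzero_dense[of k f y0 U] insert.prems \<open>f y0 \<noteq> 0\<close> by blast
  ultimately obtain z where "z \<in> ?V" "\<forall>f\<in>F. f z \<noteq> 0"
    using insert.IH[of ?V] insert.prems by blast
  then show ?case by blast
qed auto

section \<open>Points in general position for box polynomials\<close>

text \<open>Linear independence of the evaluation functionals at the points \<open>x v\<close> on
  the space of box polynomials.\<close>

definition eval_independent :: "nat \<Rightarrow> ('v \<Rightarrow> real ^ 'D::finite) \<Rightarrow> 'v set \<Rightarrow> bool" where
  "eval_independent q x B \<longleftrightarrow>
     (\<forall>l. (\<forall>\<alpha>\<in>exponent_box q. (\<Sum>v\<in>B. l v * monomial \<alpha> (x v)) = 0) \<longrightarrow> (\<forall>v\<in>B. l v = 0))"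

text \<open>Pairing a relation with the coefficients of a polynomial that vanishes at the points of
  \<open>B\<close> but not at \<open>x v0\<close> isolates the coefficient of
  \<open>v0\<close>.\<close>

lemma eval_independent_insert:
  assumes ind: "eval_independent q x B" and fin: "finite B" "v0 \<notin> B"
    and van: "\<And>v. v \<in> B \<Longrightarrow> box_poly q c (x v) = 0" and nz: "box_poly q c (x v0) \<noteq> 0"
  shows "eval_independent q x (insert v0 B)"
  unfolding eval_independent_def
proof (intro allI impI)
  fix l assume l: "\<forall>\<alpha>\<in>exponent_box q. (\<Sum>v\<in>insert v0 B. l v * monomial \<alpha> (x v)) = 0"
  have "0 = (\<Sum>\<alpha>\<in>exponent_box q. c \<alpha> * (\<Sum>v\<in>insert v0 B. l v * monomial \<alpha> (x v)))"
    using l by simp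
  also have "\<dots> = (\<Sum>v\<in>insert v0 B. l v * box_poly q c (x v))"
    unfolding box_poly_def sum_distrib_left
    by (subst sum.swap) (simp add: mult.left_commute)
  also have "\<dots> = l v0 * box_poly q c (x v0)" using fin van by simp
  finally have "l v0 = 0" using nz by simp
  then have "\<forall>v\<in>B. l v = 0"
    using ind l fin unfolding eval_independent_def by simp
  then show "\<forall>v\<in>insert v0 B. l v = 0" using \<open>l v0 = 0\<close> by simp
qed

text \<open>The bound is the dimension of the space of box polynomials. It is best possible: any
  smaller number of points lies in the zero set of some nonzero box polynomial.\<close>

definition generic :: "nat \<Rightarrow> ('v \<Rightarrow> real ^ 'D::finite) \<Rightarrow> 'v set \<Rightarrow> bool" where
  "generic q x Q \<longleftrightarrow> (\<forall>c. (\<exists>\<alpha>\<in>exponent_box q. c \<alpha> \<noteq> 0) \<longrightarrow>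
     card {v\<in>Q. box_poly q c (x v) = 0} < (q + 1) ^ CARD('D))"

lemma generic_subset:
  fixes x :: "'v \<Rightarrow> real ^ 'D::finite"
  assumes "generic q x Q" "finite Q" "Q' \<subseteq> Q"
  shows "generic q x Q'"
  unfolding generic_def
proof (intro allI impI)
  fix c :: "('D \<Rightarrow> nat) \<Rightarrow> real"
  assume c: "\<exists>\<alpha>\<in>exponent_box q. c \<alpha> \<noteq> 0"
  have "card {v\<in>Q'. box_poly q c (x v) = 0} \<le> card {v\<in>Q. box_poly q c (x v) = 0}"
    using assms by (intro card_mono) auto
  also have "\<dots> < (q + 1) ^ CARD('D)" using assms(1) c unfolding generic_def by blast
  finally show "card {v\<in>Q'. box_poly q c (x v) = 0} < (q + 1) ^ CARD('D)" .
qed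

text \<open>Evaluations at zeros of one nonzero polynomial lie in a hyperplane of the dual space, so
  as many of them as the dimension are dependent.\<close>

lemma genericI:
  fixes x :: "'v \<Rightarrow> real ^ 'D::finite"
  assumes Q: "finite Q"
    and ind: "\<And>B. B \<subseteq> Q \<Longrightarrow> card B \<le> (q + 1) ^ CARD('D) \<Longrightarrow> eval_independent q x B"
  shows "generic q x Q"
  unfolding generic_def
proof (intro allI impI, rule ccontr)
  fix c :: "('D \<Rightarrow> nat) \<Rightarrow> real"
  let ?E = "exponent_box q :: ('D \<Rightarrow> nat) set" and ?N = "(q + 1) ^ CARD('D)"
  assume "\<exists>\<alpha>\<in>?E. c \<alpha> \<noteq> 0" and many: "\<not> card {v\<in>Q. box_poly q c (x v) = 0} < ?N"
  then obtain \<alpha>0 where \<alpha>0: "\<alpha>0 \<in> ?E" "c \<alpha>0 \<noteq> 0" by blast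
  obtain B where B: "B \<subseteq> {v\<in>Q. box_poly q c (x v) = 0}" "card B = ?N" "finite B"
    using obtain_subset_with_card_n[of ?N "{v\<in>Q. box_poly q c (x v) = 0}"] many by (auto simp: not_less)
  have "card (?E - {\<alpha>0}) < card B"
    using \<alpha>0 B by (simp add: card_exponent_box finite_exponent_box)
  then obtain l where l: "\<exists>v\<in>B. l v \<noteq> 0" "\<forall>\<alpha>\<in>?E - {\<alpha>0}. (\<Sum>v\<in>B. monomial \<alpha> (x v) * l v) = 0"
    using underdetermined_system[of "?E - {\<alpha>0}" B "\<lambda>\<alpha> v. monomial \<alpha> (x v)"] B finite_exponent_box by auto
  \<comment> \<open>The equation for \<open>\<alpha>0\<close> was left out of the system; it follows
    from the others because the polynomial vanishes on \<open>B\<close>.\<close>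
  have "0 = (\<Sum>v\<in>B. l v * box_poly q c (x v))"
    using B by (intro sum.neutral[symmetric]) auto
  also have "\<dots> = (\<Sum>\<alpha>\<in>?E. c \<alpha> * (\<Sum>v\<in>B. monomial \<alpha> (x v) * l v))"
    unfolding box_poly_def sum_distrib_left by (subst sum.swap) (simp add: mult_ac)
  also have "\<dots> = c \<alpha>0 * (\<Sum>v\<in>B. monomial \<alpha>0 (x v) * l v)"
    using l(2) \<alpha>0 finite_exponent_box by (subst sum.remove[of _ \<alpha>0]) auto
  finally have "(\<Sum>v\<in>B. monomial \<alpha>0 (x v) * l v) = 0" using \<alpha>0 by simp
  then have "\<forall>\<alpha>\<in>?E. (\<Sum>v\<in>B. l v * monomial \<alpha> (x v)) = 0"
    using l(2) by (simp add: mult.commute) blast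
  moreover have "eval_independent q x B" using B by (intro ind) auto
  ultimately show False using l(1) unfolding eval_independent_def by blast
qed

text \<open>The points are placed one after the other. Every set of fewer than (q + 1)^D earlier
  points determines a choice of a nonzero box polynomial that vanishes on it, and the new point
  avoids the zero sets of these finitely many polynomials.\<close>

theorem generic_perturbation:
  fixes p :: "'v \<Rightarrow> real ^ 'D::finite"
  assumes Q: "finite Q" and \<epsilon>: "\<epsilon> > 0"
  shows "\<exists>x. (\<forall>v\<in>Q. dist (p v) (x v) < \<epsilon>) \<and> generic q x Q"
proof -
  let ?N = "(q + 1) ^ CARD('D)" and ?E = "exponent_box q :: ('D \<Rightarrow> nat) set"
  have "\<exists>x. (\<forall>v\<in>Q. dist (p v) (x v) < \<epsilon>) \<and> (\<forall>B\<subseteq>Q. card B \<le> ?N \<longrightarrow> eval_independent q x B)"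
    using Q
  proof (induction Q rule: finite_induct)
    case empty
    show ?case by (simp add: eval_independent_def)
  next
    case (insert v0 Q)
    then obtain x where x: "\<And>v. v \<in> Q \<Longrightarrow> dist (p v) (x v) < \<epsilon>"
      "\<And>B. B \<subseteq> Q \<Longrightarrow> card B \<le> ?N \<Longrightarrow> eval_independent q x B" by blast
    let ?S = "{B. B \<subseteq> Q \<and> card B < ?N}"
    have "\<exists>c. (\<exists>\<alpha>\<in>?E. c \<alpha> \<noteq> 0) \<and> (\<forall>v\<in>B. box_poly q c (x v) = 0)" if "B \<in> ?S" for B
    proof -
      have "finite B" "card B < card ?E"
        using that insert.hyps finite_subset by (auto simp: card_exponent_box)
      from underdetermined_system[OF this(1) finite_exponent_box this(2), of "\<lambda>v \<alpha>. monomial \<alpha> (x v)"]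
      show ?thesis by (simp add: box_poly_def mult.commute)
    qed
    then have "\<exists>C. \<forall>B\<in>?S. (\<exists>\<alpha>\<in>?E. C B \<alpha> \<noteq> 0) \<and> (\<forall>v\<in>B. box_poly q (C B) (x v) = 0)"
      by (intro bchoice ballI)
    then obtain C where C: "\<forall>B\<in>?S. (\<exists>\<alpha>\<in>?E. C B \<alpha> \<noteq> 0) \<and> (\<forall>v\<in>B. box_poly q (C B) (x v) = 0)" ..
    have "\<exists>y\<in>ball (p v0) \<epsilon>. \<forall>f\<in>(\<lambda>B. box_poly q (C B)) ` ?S. f y \<noteq> 0"
    proof (rule polynomials_nonzero_dense)
      show "\<exists>y. f y \<noteq> 0" if "f \<in> (\<lambda>B. box_poly q (C B)) ` ?S" for f
      proof -
        from that obtain B where B: "f = box_poly q (C B)" "B \<in> ?S" by (rule imageE)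
        from bspec[OF C B(2)] obtain \<alpha> where "\<alpha> \<in> ?E" "C B \<alpha> \<noteq> 0" by (elim conjE bexE)
        then show ?thesis unfolding B(1) by (rule box_poly_nonzero)
      qed
      show "polynomial_deg_le (CARD('D) * q) f" if "f \<in> (\<lambda>B. box_poly q (C B)) ` ?S" for f
        using that by (elim imageE) (simp only: polynomial_deg_le_box_poly)
      have "finite ?S" using insert.hyps(1) by simp
      then show "finite ((\<lambda>B. box_poly q (C B)) ` ?S)" by (rule finite_imageI)
    qed (use \<epsilon> in auto)
    then obtain y where y: "dist (p v0) y < \<epsilon>" "\<And>B. B \<in> ?S \<Longrightarrow> box_poly q (C B) y \<noteq> 0" by auto
    let ?x = "x(v0 := y)"
    have eqB: "eval_independent q ?x B \<longleftrightarrow> eval_independent q x B" if "v0 \<notin> B" for B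
    proof -
      have "(\<Sum>v\<in>B. l v * monomial \<alpha> (?x v)) = (\<Sum>v\<in>B. l v * monomial \<alpha> (x v))" for l \<alpha>
        using that by (intro sum.cong) auto
      then show ?thesis by (simp add: eval_independent_def)
    qed
    have "eval_independent q ?x B" if B: "B \<subseteq> insert v0 Q" "card B \<le> ?N" for B
    proof (cases "v0 \<in> B")
      case False
      then show ?thesis using B x(2)[of B] eqB by blast
    next
      case True
      have fB: "finite B" using B(1) insert.hyps by (meson finite_insert finite_subset)
      let ?B = "B - {v0}"
      have "card ?B < card B" using card_Diff1_less[OF fB True] .
      then have S: "?B \<in> ?S" using B by auto
      have "eval_independent q ?x (insert v0 ?B)"
      proof (rule eval_independent_insert)
        show "eval_independent q ?x ?B" using S x(2)[of ?B] eqB[of ?B] by simp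
        show "box_poly q (C ?B) (?x v) = 0" if "v \<in> ?B" for v using bspec[OF C S] that by simp
        show "box_poly q (C ?B) (?x v0) \<noteq> 0" using y(2)[OF S] by simp
      qed (use fB in auto)
      then show ?thesis using True by (simp add: insert_absorb)
    qed
    moreover have "dist (p v) (?x v) < \<epsilon>" if "v \<in> insert v0 Q" for v
      using that x(1) y(1) by (cases "v = v0") auto
    ultimately show ?case by blast
  qed
  then show ?thesis using genericI[OF Q] by blast
qed

subsection \<open>Polynomial partitioning\<close>

text \<open>A connected set that joins \<open>a\<close> and \<open>b\<close> has a connected image
  under \<open>g\<close>, which omits 0.\<close>

lemma sign_constant_on_component:
  fixes g G :: "real ^ 'D::finite \<Rightarrow> real"
  assumes g: "polynomial_deg_le k g" and cc: "connected_component {z. G z \<noteq> 0} a b"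
    and sub: "\<And>z. G z \<noteq> 0 \<Longrightarrow> g z \<noteq> 0"
  shows "g a > 0 \<longleftrightarrow> g b > 0"
proof -
  obtain T where T: "connected T" "T \<subseteq> {z. G z \<noteq> 0}" "a \<in> T" "b \<in> T"
    using cc unfolding connected_component_def by blast
  have conn: "connected (g ` T)"
    using T(1) polynomial_deg_le_continuous_on[OF g] by (rule connected_continuous_image[rotated])
  have nz: "0 \<notin> g ` T" using T(2) sub by force
  have ab: "g a \<in> g ` T" "g b \<in> g ` T" using T by auto
  show ?thesis
  proof (rule ccontr)
    assume "\<not> ?thesis"
    then have "(g a \<le> 0 \<and> 0 \<le> g b) \<or> (g b \<le> 0 \<and> 0 \<le> g a)" by linarith
    then have "0 \<in> g ` T" using connectedD_interval[OF conn] ab by blast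
    then show False using nz by blast
  qed
qed

text \<open>A ham-sandwich polynomial may vanish at some of the points. By genericity these are
  fewer than (q + 1)^D, and a small constant shift moves them to the positive side; the additive
  error pays for them.\<close>

lemma halving_polynomial:
  fixes x :: "'v \<Rightarrow> real ^ 'D::finite"
  assumes Q: "finite Q" and gen: "generic q x Q" and M: "M < (q + 1) ^ CARD('D)"
    and P: "\<And>i. i < M \<Longrightarrow> P i \<subseteq> Q"
  shows "\<exists>g. polynomial_deg_le (CARD('D) * q) g \<and> (\<forall>v\<in>Q. g (x v) \<noteq> 0) \<and>
    (\<forall>i<M. 2 * card {v\<in>P i. g (x v) > 0} \<le> card (P i) + 2 * (q + 1) ^ CARD('D) \<and>
           2 * card {v\<in>P i. \<not> g (x v) > 0} \<le> card (P i) + 2 * (q + 1) ^ CARD('D))"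
proof -
  let ?N = "(q + 1) ^ CARD('D)" and ?E = "exponent_box q :: ('D \<Rightarrow> nat) set"
  obtain n where n: "?N = Suc n" by (cases ?N) auto
  obtain e where e: "bij_betw e {..n} ?E"
    using finite_same_card_bij[of "{..n}" ?E] n by (auto simp: card_exponent_box finite_exponent_box)
  \<comment> \<open>Empty sets fill the family up to the \<open>n\<close> sets that
    \<open>n + 1\<close> coefficients can bisect.\<close>
  let ?P = "\<lambda>i. if i < M then P i else {}"
  have finP: "finite (?P i)" for i using P[of i] Q finite_subset by auto
  from ham_sandwich[of n ?P "\<lambda>v j. monomial (e j) (x v)", OF finP]
  obtain c where c': "(\<exists>j\<le>n. c j \<noteq> 0) \<and>
    (\<forall>i<n. 2 * card {v\<in>?P i. (\<Sum>j\<le>n. c j * monomial (e j) (x v)) > 0} \<le> card (?P i)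
      \<and> 2 * card {v\<in>?P i. (\<Sum>j\<le>n. c j * monomial (e j) (x v)) < 0} \<le> card (?P i))" ..
  note c = conjunct1[OF c'] conjunct2[OF c']
  define C where "C = (\<lambda>\<alpha>. c (the_inv_into {..n} e \<alpha>))"
  have Ce: "C (e j) = c j" if "j \<le> n" for j
    using that e by (simp add: C_def bij_betw_def the_inv_into_f_f)
  let ?g0 = "box_poly q C"
  have g0: "?g0 z = (\<Sum>j\<le>n. c j * monomial (e j) z)" for z
    unfolding box_poly_def using sum.reindex_bij_betw[OF e, of "\<lambda>\<alpha>. C \<alpha> * monomial \<alpha> z"] Ce by simp
  have "\<exists>\<alpha>\<in>?E. C \<alpha> \<noteq> 0" using c(1) Ce e by (force simp: bij_betw_def)
  then have zeros: "card {v\<in>Q. ?g0 (x v) = 0} < ?N" using gen unfolding generic_def by blast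
  \<comment> \<open>At most half the distance of any negative value from 0, so that the shift
    changes no negative sign.\<close>
  define \<eta> where "\<eta> = Min (insert 1 ((\<lambda>v. - ?g0 (x v) / 2) ` {v\<in>Q. ?g0 (x v) < 0}))"
  have eta: "\<eta> > 0" unfolding \<eta>_def using Q by (subst Min_gr_iff) auto
  have eta': "?g0 (x v) + \<eta> < 0" if "v \<in> Q" "?g0 (x v) < 0" for v
  proof -
    have "\<eta> \<le> - ?g0 (x v) / 2" unfolding \<eta>_def using Q that by (intro Min_le) auto
    then show ?thesis using that by simp
  qed
  define g where "g = (\<lambda>z. ?g0 z + \<eta>)"
  have pos: "g (x v) > 0 \<longleftrightarrow> ?g0 (x v) > 0 \<or> ?g0 (x v) = 0" if "v \<in> Q" for v
    using eta eta'[OF that] unfolding g_def by (smt (verit))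
  have neg: "\<not> g (x v) > 0 \<longleftrightarrow> ?g0 (x v) < 0" if "v \<in> Q" for v
    using eta eta'[OF that] unfolding g_def by (smt (verit))
  have "g (x v) \<noteq> 0" if "v \<in> Q" for v
    using eta eta'[OF that] unfolding g_def by (smt (verit))
  moreover have "polynomial_deg_le (CARD('D) * q) g"
    unfolding g_def by (intro polynomial_deg_le_add polynomial_deg_le_box_poly polynomial_deg_le_const)
  moreover have "2 * card {v\<in>P i. g (x v) > 0} \<le> card (P i) + 2 * ?N \<and>
      2 * card {v\<in>P i. \<not> g (x v) > 0} \<le> card (P i) + 2 * ?N" if i: "i < M" for i
  proof
    have fin: "finite (P i)" using P[OF i] Q by (rule finite_subset)
    have "i < n" using i M n by linarith
    then have h: "2 * card {v\<in>P i. ?g0 (x v) > 0} \<le> card (P i)"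
      "2 * card {v\<in>P i. ?g0 (x v) < 0} \<le> card (P i)"
      using c(2)[rule_format, OF \<open>i < n\<close>] i by (simp_all add: g0)
    have "card {v\<in>P i. g (x v) > 0} \<le> card ({v\<in>P i. ?g0 (x v) > 0} \<union> {v\<in>Q. ?g0 (x v) = 0})"
      using pos P[OF i] fin Q by (intro card_mono) auto
    also have "\<dots> \<le> card {v\<in>P i. ?g0 (x v) > 0} + card {v\<in>Q. ?g0 (x v) = 0}" by (rule card_Un_le)
    finally show "2 * card {v\<in>P i. g (x v) > 0} \<le> card (P i) + 2 * ?N" using h zeros by linarith
    have "{v\<in>P i. \<not> g (x v) > 0} = {v\<in>P i. ?g0 (x v) < 0}" using neg P[OF i] by blast
    then show "2 * card {v\<in>P i. \<not> g (x v) > 0} \<le> card (P i) + 2 * ?N" using h by simp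
  qed
  ultimately show ?thesis by blast
qed

text \<open>\<open>J\<close> rounds of halving; \<open>lab\<close> is the binary number formed by
  the signs of the factors. The error 2 (q + 1)^D per class is a fixed point of halving, so it does
  not accumulate. Every round uses the same degree, which costs a factor \<open>J\<close> that the
  slack \<open>\<delta>\<close> absorbs later.\<close>

lemma sign_partition:
  fixes x :: "'v \<Rightarrow> real ^ 'D::finite"
  assumes Q: "finite Q" and gen: "generic q x Q" and J: "2 ^ J \<le> (q + 1) ^ CARD('D)"
  shows "\<exists>G lab. polynomial_deg_le (J * (CARD('D) * q)) G \<and>
    (\<forall>v\<in>Q. G (x v) \<noteq> 0 \<and> lab v < (2::nat) ^ J) \<and>
    (\<forall>i. 2 ^ J * card {v\<in>Q. lab v = i} \<le> card Q + 2 ^ J * (2 * (q + 1) ^ CARD('D))) \<and>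
    (\<forall>v\<in>Q. \<forall>w\<in>Q. connected_component {z. G z \<noteq> 0} (x v) (x w) \<longrightarrow> lab v = lab w)"
  using J
proof (induction J)
  case 0
  have "card {v\<in>Q. 0 = i} \<le> card Q" for i :: nat using Q by (intro card_mono) auto
  then show ?case
    by (intro exI[of _ "\<lambda>_. 1"] exI[of _ "\<lambda>_. 0"]) (auto intro: polynomial_deg_le_const trans_le_add1)
next
  case (Suc J)
  let ?N = "(q + 1) ^ CARD('D)"
  have J: "2 ^ J < ?N" using Suc.prems by (simp add: less_le_trans[of "2 ^ J" "2 * 2 ^ J"])
  from Suc.IH[OF less_imp_le[OF J]]
  obtain G lab where G: "polynomial_deg_le (J * (CARD('D) * q)) G"
    "\<forall>v\<in>Q. G (x v) \<noteq> 0 \<and> lab v < (2::nat) ^ J"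
    "\<forall>i. 2 ^ J * card {v\<in>Q. lab v = i} \<le> card Q + 2 ^ J * (2 * ?N)"
    "\<forall>v\<in>Q. \<forall>w\<in>Q. connected_component {z. G z \<noteq> 0} (x v) (x w) \<longrightarrow> lab v = lab w"
    by (elim exE conjE)
  have sub: "{v\<in>Q. lab v = i} \<subseteq> Q" for i by blast
  from halving_polynomial[OF Q gen J, of "\<lambda>i. {v\<in>Q. lab v = i}", OF sub]
  obtain g where g: "polynomial_deg_le (CARD('D) * q) g" "\<forall>v\<in>Q. g (x v) \<noteq> 0"
    "\<forall>i<2^J. 2 * card {v\<in>{v\<in>Q. lab v = i}. g (x v) > 0} \<le> card {v\<in>Q. lab v = i} + 2 * ?N \<and>
           2 * card {v\<in>{v\<in>Q. lab v = i}. \<not> g (x v) > 0} \<le> card {v\<in>Q. lab v = i} + 2 * ?N"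
    by (elim exE conjE)
  define lab' where "lab' = (\<lambda>v. 2 * lab v + (if g (x v) > 0 then 1 else 0))"
  have "polynomial_deg_le (Suc J * (CARD('D) * q)) (\<lambda>z. G z * g z)"
    using polynomial_deg_le_mult[OF G(1) g(1)] by (simp add: add.commute)
  moreover have "G (x v) * g (x v) \<noteq> 0 \<and> lab' v < 2 ^ Suc J" if "v \<in> Q" for v
  proof -
    have "lab v < 2 ^ J" "G (x v) \<noteq> 0" "g (x v) \<noteq> 0" using that G(2) g(2) by auto
    then show ?thesis by (auto simp: lab'_def)
  qed
  moreover have "2 ^ Suc J * card {v\<in>Q. lab' v = i} \<le> card Q + 2 ^ Suc J * (2 * ?N)" for i
  proof (cases "i div 2 < 2 ^ J")
    case False
    then have "{v\<in>Q. lab' v = i} = {}" using G(2) by (auto simp: lab'_def)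
    then show ?thesis by (simp only: card.empty mult_0_right le0)
  next
    case True
    let ?i = "i div 2"
    have "{v\<in>Q. lab' v = i} = {v\<in>{v\<in>Q. lab v = ?i}. g (x v) > 0} \<or>
          {v\<in>Q. lab' v = i} = {v\<in>{v\<in>Q. lab v = ?i}. \<not> g (x v) > 0}"
    proof (cases "even i")
      case True
      then have "lab' v = i \<longleftrightarrow> lab v = ?i \<and> \<not> g (x v) > 0" for v by (auto simp: lab'_def elim!: evenE) presburger+
      then show ?thesis by auto
    next
      case False
      then have "lab' v = i \<longleftrightarrow> lab v = ?i \<and> g (x v) > 0" for v by (auto simp: lab'_def elim!: oddE) presburger+
      then show ?thesis by auto
    qed
    then have "2 * card {v\<in>Q. lab' v = i} \<le> card {v\<in>Q. lab v = ?i} + 2 * ?N"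
      using g(3) True by (elim disjE) simp_all
    then have "2 ^ J * (2 * card {v\<in>Q. lab' v = i}) \<le> 2 ^ J * (card {v\<in>Q. lab v = ?i} + 2 * ?N)"
      by (rule mult_le_mono2)
    moreover have "2 ^ J * card {v\<in>Q. lab v = ?i} \<le> card Q + 2 ^ J * (2 * ?N)" using G(3) by blast
    ultimately show ?thesis by (simp add: algebra_simps)
  qed
  moreover have "lab' v = lab' w"
    if vw: "v \<in> Q" "w \<in> Q" and cc: "connected_component {z. G z * g z \<noteq> 0} (x v) (x w)" for v w
  proof -
    have "connected_component {z. G z \<noteq> 0} (x v) (x w)"
      by (rule connected_component_of_subset[OF cc]) auto
    then have "lab v = lab w" using G(4) vw by blast
    moreover have "g (x v) > 0 \<longleftrightarrow> g (x w) > 0"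
      by (rule sign_constant_on_component[OF g(1) cc]) simp
    ultimately show ?thesis by (simp add: lab'_def)
  qed
  ultimately show ?case
    by (intro exI[of _ "\<lambda>z. G z * g z"] exI[of _ lab']) blast
qed

section \<open>Cells as sets of input points\<close>

text \<open>A cell is the set of input points in one component, not the component itself: components
  without input points do not count.\<close>

definition cell_of :: "('v \<Rightarrow> real ^ 'D::finite) \<Rightarrow> 'v set \<Rightarrow> (real ^ 'D \<Rightarrow> real) \<Rightarrow> 'v \<Rightarrow> 'v set" where
  "cell_of x Q G v = {w\<in>Q. connected_component {z. G z \<noteq> 0} (x v) (x w)}"

definition cells :: "('v \<Rightarrow> real ^ 'D::finite) \<Rightarrow> 'v set \<Rightarrow> (real ^ 'D \<Rightarrow> real) \<Rightarrow> 'v set set" where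
  "cells x Q G = cell_of x Q G ` Q"

lemma in_cell_of: "v \<in> Q \<Longrightarrow> G (x v) \<noteq> 0 \<Longrightarrow> v \<in> cell_of x Q G v"
  by (simp add: cell_of_def)

lemma cell_of_eq: "w \<in> cell_of x Q G v \<Longrightarrow> cell_of x Q G w = cell_of x Q G v"
  unfolding cell_of_def
  by (metis (mono_tags, lifting) connected_component_sym connected_component_trans mem_Collect_eq)

lemma cells_disjoint: "\<Delta> \<in> cells x Q G \<Longrightarrow> \<Delta>' \<in> cells x Q G \<Longrightarrow> v \<in> \<Delta> \<Longrightarrow> v \<in> \<Delta>' \<Longrightarrow> \<Delta> = \<Delta>'"
  unfolding cells_def by (auto dest: cell_of_eq)

lemma card_cells_le:
  fixes x :: "'v \<Rightarrow> real ^ 'D::finite"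
  assumes Q: "finite Q" and G: "polynomial_deg_le k G" and nz: "\<And>v. v \<in> Q \<Longrightarrow> G (x v) \<noteq> 0"
  shows "card (cells x Q G) \<le> (2 * k + 1) ^ CARD('D)"
proof -
  let ?c = "cell_of x Q G"
  obtain R where R: "R \<subseteq> Q" "inj_on ?c R" "?c ` R = cells x Q G"
    unfolding cells_def by (metis subset_image_inj subset_refl)
  have sep: "v = w" if "v \<in> R" "w \<in> R" "connected_component {z. G z \<noteq> 0} (x v) (x w)" for v w
  proof -
    have "w \<in> ?c v" using that R(1) by (auto simp: cell_of_def)
    then have "?c w = ?c v" by (rule cell_of_eq)
    then show ?thesis using R(2) that by (metis inj_onD)
  qed
  have "inj_on x R"
  proof (rule inj_onI)
    fix v w assume vw: "v \<in> R" "w \<in> R" "x v = x w"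
    have "G (x v) \<noteq> 0" using vw R(1) nz by blast
    then have "connected_component {z. G z \<noteq> 0} (x v) (x w)" using vw(3) by simp
    then show "v = w" by (rule sep[OF vw(1,2)])
  qed
  then have "card (cells x Q G) = card (x ` R)"
    using R by (metis card_image)
  also have "\<dots> \<le> (2 * k + 1) ^ CARD('D)"
  proof (rule card_components_nonzero_le[OF G])
    show "finite (x ` R)" using R(1) Q finite_subset by blast
    show "G p \<noteq> 0" if "p \<in> x ` R" for p using that R(1) nz by blast
    fix p p' assume "p \<in> x ` R" "p' \<in> x ` R" and cc: "connected_component {x. G x \<noteq> 0} p p'"
    then obtain v w where "v \<in> R" "w \<in> R" "p = x v" "p' = x w" by blast
    then show "p = p'" using sep cc by blast
  qed
  finally show ?thesis .
qed

text \<open>Every old cell contains a new one, and a crossed cell contains at least two: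
  \<open>H\<close> vanishes wherever some \<open>f\<close> does, so \<open>f\<close> has constant
  sign on each new cell. New cells inside different old cells are distinct.\<close>

lemma card_cells_refine:
  fixes x :: "'v \<Rightarrow> real ^ 'D::finite"
  assumes Q: "finite Q" and nz: "\<And>v. v \<in> Q \<Longrightarrow> G (x v) * H (x v) \<noteq> 0"
    and fs: "\<And>f. f \<in> F \<Longrightarrow> polynomial_deg_le k f" "\<And>f z. f \<in> F \<Longrightarrow> f z = 0 \<Longrightarrow> H z = 0"
  shows "card (cells x Q G) + card {\<Delta>\<in>cells x Q G. \<exists>v\<in>\<Delta>. \<exists>w\<in>\<Delta>. \<exists>f\<in>F. (f (x v) > 0) \<noteq> (f (x w) > 0)}
      \<le> card (cells x Q (\<lambda>z. G z * H z))"
proof -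
  let ?G' = "\<lambda>z. G z * H z"
  let ?C = "cells x Q G" and ?C' = "cells x Q ?G'"
  define X where "X = {\<Delta>\<in>?C. \<exists>v\<in>\<Delta>. \<exists>w\<in>\<Delta>. \<exists>f\<in>F. (f (x v) > 0) \<noteq> (f (x w) > 0)}"
  have finC: "finite ?C" "finite ?C'" using Q by (simp_all add: cells_def)
  have sub: "cell_of x Q ?G' v \<subseteq> cell_of x Q G v" for v
    unfolding cell_of_def by (auto elim!: connected_component_of_subset)
  define fb where "fb = (\<lambda>\<Delta>. {\<Delta>'\<in>?C'. \<Delta>' \<noteq> {} \<and> \<Delta>' \<subseteq> \<Delta>})"
  have fin: "finite (fb \<Delta>)" for \<Delta> using finC by (simp add: fb_def)
  have in': "v \<in> cell_of x Q ?G' v" "cell_of x Q ?G' v \<in> ?C'" if "v \<in> Q" for v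
    using that nz by (auto simp: cells_def intro!: in_cell_of)
  have fib: "cell_of x Q ?G' v \<in> fb \<Delta>" if \<Delta>: "\<Delta> \<in> ?C" "v \<in> \<Delta>" for v \<Delta>
  proof -
    obtain u where u: "u \<in> Q" "\<Delta> = cell_of x Q G u" using \<Delta>(1) by (auto simp: cells_def)
    then have "v \<in> cell_of x Q G u" using \<Delta>(2) by simp
    then have "v \<in> Q" "\<Delta> = cell_of x Q G v"
      using cell_of_eq[of v x Q G u] u(2) by (auto simp only: cell_of_def[of x Q G u] mem_Collect_eq)
    then show ?thesis using in'[of v] sub[of v] by (auto simp: fb_def)
  qed
  have ne: "\<exists>v. v \<in> \<Delta>" if "\<Delta> \<in> ?C" for \<Delta>
    using that nz in_cell_of by (fastforce simp: cells_def)
  have "1 + (if \<Delta> \<in> X then 1 else 0) \<le> card (fb \<Delta>)" if \<Delta>: "\<Delta> \<in> ?C" for \<Delta>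
  proof -
    show ?thesis
    proof (cases "\<Delta> \<in> X")
      case False
      obtain v where "v \<in> \<Delta>" using ne[OF \<Delta>] ..
      from fib[OF \<Delta> this] have "fb \<Delta> \<noteq> {}" by (intro notI) (simp only: empty_iff)
      then show ?thesis using False fin[of \<Delta>] by (simp add: Suc_le_eq card_gt_0_iff)
    next
      case True
      then obtain v w f where vw: "v \<in> \<Delta>" "w \<in> \<Delta>" "f \<in> F" "(f (x v) > 0) \<noteq> (f (x w) > 0)"
        unfolding X_def by (elim CollectE conjE bexE)
      have "cell_of x Q ?G' v \<noteq> cell_of x Q ?G' w"
      proof
        assume eq: "cell_of x Q ?G' v = cell_of x Q ?G' w"
        have "w \<in> Q" using \<Delta> vw(2) by (auto simp: cells_def cell_of_def)
        then have "w \<in> cell_of x Q ?G' v" using in'(1) eq by simp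
        then have cc: "connected_component {z. ?G' z \<noteq> 0} (x v) (x w)" by (simp add: cell_of_def)
        have "f (x v) > 0 \<longleftrightarrow> f (x w) > 0"
          using fs(2)[OF vw(3)] by (intro sign_constant_on_component[OF fs(1)[OF vw(3)] cc]) force
        then show False using vw(4) by blast
      qed
      then have "card {cell_of x Q ?G' v, cell_of x Q ?G' w} = 2" by simp
      moreover have "card {cell_of x Q ?G' v, cell_of x Q ?G' w} \<le> card (fb \<Delta>)"
        using fib[OF \<Delta> vw(1)] fib[OF \<Delta> vw(2)]
        by (intro card_mono fin insert_subsetI empty_subsetI)
      ultimately show ?thesis using True by simp
    qed
  qed
  then have "(\<Sum>\<Delta>\<in>?C. 1 + (if \<Delta> \<in> X then 1 else 0)) \<le> (\<Sum>\<Delta>\<in>?C. card (fb \<Delta>))"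
    by (rule sum_mono)
  also have "\<dots> = card (\<Union>\<Delta>\<in>?C. fb \<Delta>)"
  proof (rule card_UN_disjoint[symmetric])
    show "\<forall>\<Delta>\<in>?C. \<forall>\<Delta>'\<in>?C. \<Delta> \<noteq> \<Delta>' \<longrightarrow> fb \<Delta> \<inter> fb \<Delta>' = {}"
    proof (intro ballI impI, rule ccontr)
      fix \<Delta> \<Delta>' assume \<Delta>: "\<Delta> \<in> ?C" "\<Delta>' \<in> ?C" "\<Delta> \<noteq> \<Delta>'" "fb \<Delta> \<inter> fb \<Delta>' \<noteq> {}"
      then obtain c where "c \<noteq> {}" "c \<subseteq> \<Delta>" "c \<subseteq> \<Delta>'" by (auto simp: fb_def)
      then obtain v where "v \<in> \<Delta>" "v \<in> \<Delta>'" by blast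
      then show False using cells_disjoint[OF \<Delta>(1,2)] \<Delta>(3) by blast
    qed
  qed (use finC fin in auto)
  also have "\<dots> \<le> card ?C'" using finC by (intro card_mono) (auto simp: fb_def)
  finally have "(\<Sum>\<Delta>\<in>?C. 1 + (if \<Delta> \<in> X then 1 else 0)) \<le> card ?C'" .
  moreover have "(\<Sum>\<Delta>\<in>?C. 1 + (if \<Delta> \<in> X then 1 else (0::nat))) = card ?C + card X"
  proof -
    have "?C \<inter> X = X" by (auto simp: X_def)
    then show ?thesis using finC by (simp only: sum.distrib) (simp add: sum.If_cases)
  qed
  ultimately show ?thesis unfolding X_def by linarith
qed

text \<open>Greedy step: as long as some range crosses many cells, multiplying the partitioning polynomial
  by the polynomials of that range increases the number of cells, which is bounded.\<close>

theorem polynomial_partition: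
  fixes x :: "'v \<Rightarrow> real ^ 'D::finite" and fs :: "'u \<Rightarrow> (real ^ 'D \<Rightarrow> real) list"
  assumes Q: "finite Q" and gen: "generic q x Q" and J: "2 ^ J \<le> (q + 1) ^ CARD('D)" and T: "T \<ge> 1"
    and fs: "\<And>u. u \<in> U \<Longrightarrow> length (fs u) \<le> b"
      "\<And>u f. u \<in> U \<Longrightarrow> f \<in> set (fs u) \<Longrightarrow> polynomial_deg_le b f"
      "\<And>u f v. u \<in> U \<Longrightarrow> f \<in> set (fs u) \<Longrightarrow> v \<in> Q \<Longrightarrow> f (x v) \<noteq> 0"
    and M: "M = (2 * (J * (CARD('D) * q) + T * (b * b)) + 1) ^ CARD('D)"
  shows "\<exists>\<P>. \<Union>\<P> = Q \<and> card \<P> \<le> M \<and>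
     (\<forall>\<Delta>\<in>\<P>. 2 ^ J * card \<Delta> \<le> card Q + 2 ^ J * (2 * (q + 1) ^ CARD('D))) \<and>
     (\<forall>\<Delta>\<in>\<P>. \<forall>\<Delta>'\<in>\<P>. \<Delta> \<noteq> \<Delta>' \<longrightarrow> \<Delta> \<inter> \<Delta>' = {}) \<and>
     (\<forall>u\<in>U. T * card {\<Delta>\<in>\<P>. \<exists>v\<in>\<Delta>. \<exists>w\<in>\<Delta>. \<exists>f\<in>set (fs u). (f (x v) > 0) \<noteq> (f (x w) > 0)} \<le> M)"
proof -
  obtain G0 lab where G0: "polynomial_deg_le (J * (CARD('D) * q)) G0"
    "\<forall>v\<in>Q. G0 (x v) \<noteq> 0 \<and> lab v < (2::nat) ^ J"
    "\<forall>i. 2 ^ J * card {v\<in>Q. lab v = i} \<le> card Q + 2 ^ J * (2 * (q + 1) ^ CARD('D))"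
    "\<forall>v\<in>Q. \<forall>w\<in>Q. connected_component {z. G0 z \<noteq> 0} (x v) (x w) \<longrightarrow> lab v = lab w"
    using sign_partition[OF Q gen J] by (elim exE conjE)
  define H where "H = (\<lambda>u z. prod_list (map (\<lambda>f. f z) (fs u)))"
  define G where "G = (\<lambda>us z. G0 z * prod_list (map (\<lambda>u. H u z) us))"
  define X where "X = (\<lambda>u us. {\<Delta>\<in>cells x Q (G us). \<exists>v\<in>\<Delta>. \<exists>w\<in>\<Delta>. \<exists>f\<in>set (fs u). (f (x v) > 0) \<noteq> (f (x w) > 0)})"
  have Hdeg: "polynomial_deg_le (b * b) (H u)" if "u \<in> U" for u
  proof (rule polynomial_deg_le_mono)
    show "polynomial_deg_le (length (fs u) * b) (H u)"
      unfolding H_def[abs_def] using fs(2)[OF that] by (rule polynomial_deg_le_prod_list)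
    show "length (fs u) * b \<le> b * b" using fs(1)[OF that] by simp
  qed
  have Hnz: "H u (x v) \<noteq> 0" if "u \<in> U" "v \<in> Q" for u v
    using fs(3)[OF that(1) _ that(2)] by (auto simp: H_def prod_list_zero_iff)
  have Gdeg: "polynomial_deg_le (J * (CARD('D) * q) + length us * (b * b)) (G us)" if "set us \<subseteq> U" for us
  proof -
    have "polynomial_deg_le (length us * (b * b)) (\<lambda>z. prod_list (map (\<lambda>u. H u z) us))"
      using polynomial_deg_le_prod_list[of "map H us" "b * b"] Hdeg that by (auto simp: o_def)
    then show ?thesis unfolding G_def[abs_def] by (rule polynomial_deg_le_mult[OF G0(1)])
  qed
  have Gnz: "G us (x v) \<noteq> 0" if "set us \<subseteq> U" "v \<in> Q" for us v
    using that G0(2) Hnz by (auto simp: G_def prod_list_zero_iff)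
  have step: "card (cells x Q (G us)) + card (X u us) \<le> card (cells x Q (G (u # us)))"
    if us: "set us \<subseteq> U" "u \<in> U" for u us
  proof -
    have "(\<lambda>z. G us z * H u z) = G (u # us)" by (simp add: G_def mult_ac fun_eq_iff)
    moreover have "H u z = 0" if "f \<in> set (fs u)" "f z = 0" for f z
      using that by (force simp: H_def prod_list_zero_iff)
    ultimately show ?thesis
      using card_cells_refine[OF Q, where G = "G us" and H = "H u" and F = "set (fs u)" and k = b and x = x]
        Gnz[OF us(1)] Hnz[OF us(2)] fs(2)[OF us(2)] by (simp add: X_def)
  qed
  have bound: "card (cells x Q (G us)) \<le> M" if "set us \<subseteq> U" "length us \<le> T" for us
  proof -
    have "polynomial_deg_le (J * (CARD('D) * q) + T * (b * b)) (G us)"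
      using that by (intro polynomial_deg_le_mono[OF Gdeg]) auto
    then show ?thesis unfolding M using Gnz that by (intro card_cells_le[OF Q]) auto
  qed
  have "\<exists>us. set us \<subseteq> U \<and> length us \<le> T \<and> (\<forall>u\<in>U. T * card (X u us) \<le> M)"
  proof (rule ccontr)
    assume neg: "\<not> ?thesis"
    have bad: "\<exists>u\<in>U. M + 1 \<le> T * card (X u us)" if "set us \<subseteq> U" "length us \<le> T" for us
    proof (rule ccontr)
      assume "\<not> (\<exists>u\<in>U. M + 1 \<le> T * card (X u us))"
      then have "\<forall>u\<in>U. T * card (X u us) \<le> M" by (simp add: not_le Suc_le_eq not_less)
      then show False using neg that by blast
    qed
    \<comment> \<open>Each range that crosses more than \<open>M / T\<close> cells creates as many
      new cells, so \<open>T\<close> rounds would yield more than \<open>M\<close> cells, against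
      \<open>bound\<close>.\<close>
    have ex: "\<exists>us. set us \<subseteq> U \<and> length us = t \<and> t * (M + 1) \<le> T * card (cells x Q (G us))" if "t \<le> T" for t
      using that
    proof (induction t)
      case 0
      show ?case by (intro exI[of _ "[]"]) simp
    next
      case (Suc t)
      from Suc.IH[OF Suc_leD[OF Suc.prems]] obtain us
        where us: "set us \<subseteq> U" "length us = t" "t * (M + 1) \<le> T * card (cells x Q (G us))"
        by (elim exE conjE)
      have "length us \<le> T" using us(2) Suc.prems by simp
      from bad[OF us(1) this] obtain u where u: "u \<in> U" "M + 1 \<le> T * card (X u us)" by (elim bexE)
      have "T * (card (cells x Q (G us)) + card (X u us)) \<le> T * card (cells x Q (G (u # us)))"
        using step[OF us(1) u(1)] by (rule mult_le_mono2)
      then have "Suc t * (M + 1) \<le> T * card (cells x Q (G (u # us)))"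
        using us(3) u(2) unfolding distrib_left mult_Suc by linarith
      moreover have "set (u # us) \<subseteq> U" "length (u # us) = Suc t" using us u(1) by auto
      ultimately show ?case by (intro exI[of _ "u # us"] conjI)
    qed
    from ex[OF order_refl] obtain us where us: "set us \<subseteq> U" "length us = T" "T * (M + 1) \<le> T * card (cells x Q (G us))"
      by (elim exE conjE)
    have "0 < T" using T by simp
    then have "M + 1 \<le> card (cells x Q (G us))" using us(3) by (simp only: mult_le_cancel1)
    then show False using bound[OF us(1)] us(2) by simp
  qed
  then obtain us where us': "set us \<subseteq> U \<and> length us \<le> T \<and> (\<forall>u\<in>U. T * card (X u us) \<le> M)" ..
  note us = conjunct1[OF us'] conjunct1[OF conjunct2[OF us']] conjunct2[OF conjunct2[OF us']]
  let ?P = "cells x Q (G us)"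
  have "\<Union>?P = Q"
  proof
    show "\<Union>?P \<subseteq> Q" by (auto simp: cells_def cell_of_def)
    show "Q \<subseteq> \<Union>?P"
    proof
      fix v assume v: "v \<in> Q"
      show "v \<in> \<Union>?P"
        using in_cell_of[where G = "G us" and x = x, OF v Gnz[OF us(1) v]] v unfolding cells_def by (rule UN_I[rotated])
    qed
  qed
  moreover have "2 ^ J * card \<Delta> \<le> card Q + 2 ^ J * (2 * (q + 1) ^ CARD('D))" if "\<Delta> \<in> ?P" for \<Delta>
  proof -
    from that[unfolded cells_def] obtain v where v: "\<Delta> = cell_of x Q (G us) v" "v \<in> Q" by (rule imageE)
    have "\<Delta> \<subseteq> {w\<in>Q. lab w = lab v}"
    proof
      fix w assume "w \<in> \<Delta>"
      then have w: "w \<in> Q" "connected_component {z. G us z \<noteq> 0} (x v) (x w)" by (auto simp: v(1) cell_of_def)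
      have "connected_component {z. G0 z \<noteq> 0} (x v) (x w)"
        by (rule connected_component_of_subset[OF w(2)]) (auto simp: G_def)
      then show "w \<in> {w\<in>Q. lab w = lab v}" using G0(4) v(2) w(1) by auto
    qed
    then have "card \<Delta> \<le> card {w\<in>Q. lab w = lab v}" using Q by (intro card_mono) auto
    then have "2 ^ J * card \<Delta> \<le> 2 ^ J * card {w\<in>Q. lab w = lab v}" by (rule mult_le_mono2)
    also have "\<dots> \<le> card Q + 2 ^ J * (2 * (q + 1) ^ CARD('D))" using G0(3) by blast
    finally show ?thesis .
  qed
  moreover have "\<Delta> \<inter> \<Delta>' = {}" if "\<Delta> \<in> ?P" "\<Delta>' \<in> ?P" "\<Delta> \<noteq> \<Delta>'" for \<Delta> \<Delta>'
    using cells_disjoint[OF that(1,2)] that(3) by blast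
  ultimately show ?thesis
    using bound[OF us(1,2)] us(3)[unfolded X_def]
    by (intro exI[of _ ?P] conjI ballI impI) (simp_all only:)
qed

subsection \<open>Laminar families\<close>

text \<open>Splitting at the minimal cells that contain at least \<open>2\<^sup>h\<close> items leaves two subproblems, the items
  strictly inside and those not inside, in which all cells contain fewer than \<open>2\<^sup>h\<close> items.\<close>

lemma laminar_groups:
  fixes k :: "'i \<Rightarrow> 'c set"
  assumes "finite X" and "\<And>x y. x \<in> X \<Longrightarrow> y \<in> X \<Longrightarrow> k x \<subseteq> k y \<or> k y \<subseteq> k x \<or> k x \<inter> k y = {}"
    and "\<And>x. x \<in> X \<Longrightarrow> k x \<noteq> {}" and "\<And>x. x \<in> X \<Longrightarrow> card {y\<in>X. k y \<subseteq> k x} < 2 ^ h"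
  shows "\<exists>\<G>. finite \<G> \<and> (\<forall>(\<gamma>, A, B)\<in>\<G>. \<gamma> \<in> k ` X \<and> A \<subseteq> X \<and> B \<subseteq> X \<and> (\<forall>x\<in>A. k x \<subseteq> \<gamma>) \<and> (\<forall>y\<in>B. \<gamma> \<subseteq> k y)) \<and>
    (\<forall>x\<in>X. \<forall>y\<in>X. k x \<subseteq> k y \<longrightarrow> (\<exists>(\<gamma>, A, B)\<in>\<G>. x \<in> A \<and> y \<in> B)) \<and>
    (\<Sum>(\<gamma>, A, B)\<in>\<G>. card A + card B) \<le> 2 * h * card X"
  using assms
proof (induction h arbitrary: X)
  case 0
  have "X = {}"
  proof (rule ccontr)
    assume "X \<noteq> {}"
    then obtain x where x: "x \<in> X" by blast
    have "card {y\<in>X. k y \<subseteq> k x} = 0" using 0(4)[OF x] by simp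
    then have "{y\<in>X. k y \<subseteq> k x} = {}" using 0(1) by simp
    then show False using x by blast
  qed
  then show ?case by (intro exI[of _ "{}"]) auto
next
  case (Suc h)
  note fin = Suc.prems(1) and lam = Suc.prems(2) and ne = Suc.prems(3) and small = Suc.prems(4)
  define below where "below = (\<lambda>\<gamma>. {y\<in>X. k y \<subseteq> \<gamma>})"
  define above where "above = (\<lambda>\<gamma>. {y\<in>X. \<gamma> \<subseteq> k y})"
  \<comment> \<open>The heavy cells. \<open>\<Gamma>\<close> consists of the minimal ones, which are
    pairwise disjoint by laminarity.\<close>
  define H where "H = {\<gamma>\<in>k ` X. 2 ^ h \<le> card (below \<gamma>)}"
  define \<Gamma> where "\<Gamma> = {\<gamma>\<in>H. \<forall>\<gamma>'\<in>H. \<gamma>' \<subseteq> \<gamma> \<longrightarrow> \<gamma>' = \<gamma>}"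
  have finH: "finite H" "finite \<Gamma>" using fin by (simp_all add: H_def \<Gamma>_def)
  have \<Gamma>X: "\<gamma> \<in> k ` X" "\<gamma> \<in> H" if "\<gamma> \<in> \<Gamma>" for \<gamma> using that by (auto simp: \<Gamma>_def H_def)
  have minimal: "\<exists>\<gamma>'\<in>\<Gamma>. \<gamma>' \<subseteq> \<gamma>" if "\<gamma> \<in> H" for \<gamma>
  proof -
    obtain m where "m \<in> H" "m \<subseteq> \<gamma>" "\<forall>b\<in>H. b \<subseteq> m \<longrightarrow> m = b"
      using finite_has_minimal2[OF finH(1) \<open>\<gamma> \<in> H\<close>] by blast
    then show ?thesis unfolding \<Gamma>_def by blast
  qed
  have finb: "finite (below \<gamma>)" "finite (above \<gamma>)" for \<gamma> using fin by (simp_all add: below_def above_def)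
  have \<Gamma>_disj: "\<gamma> \<inter> \<gamma>' = {}" if g: "\<gamma> \<in> \<Gamma>" "\<gamma>' \<in> \<Gamma>" "\<gamma> \<noteq> \<gamma>'" for \<gamma> \<gamma>'
  proof -
    have "\<not> \<gamma> \<subseteq> \<gamma>'" "\<not> \<gamma>' \<subseteq> \<gamma>" using g by (auto simp: \<Gamma>_def)
    moreover from \<Gamma>X(1)[OF g(1)] obtain x where "\<gamma> = k x" "x \<in> X" by (rule imageE)
    moreover from \<Gamma>X(1)[OF g(2)] obtain y where "\<gamma>' = k y" "y \<in> X" by (rule imageE)
    ultimately show ?thesis using lam[of x y] by blast
  qed
  have below_disj: "below \<gamma> \<inter> below \<gamma>' = {}" if "\<gamma> \<in> \<Gamma>" "\<gamma>' \<in> \<Gamma>" "\<gamma> \<noteq> \<gamma>'" for \<gamma> \<gamma>'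
    using \<Gamma>_disj[OF that] ne by (fastforce simp: below_def)
  \<comment> \<open>A cell above two members of \<open>\<Gamma>\<close> would hold two disjoint
    families of \<open>2 ^ h\<close> items each, against \<open>small\<close>.\<close>
  have above_disj: "above \<gamma> \<inter> above \<gamma>' = {}" if g: "\<gamma> \<in> \<Gamma>" "\<gamma>' \<in> \<Gamma>" "\<gamma> \<noteq> \<gamma>'" for \<gamma> \<gamma>'
  proof (rule ccontr)
    assume "above \<gamma> \<inter> above \<gamma>' \<noteq> {}"
    then obtain y where y: "y \<in> X" "\<gamma> \<subseteq> k y" "\<gamma>' \<subseteq> k y" by (auto simp: above_def)
    have "card (below \<gamma>) + card (below \<gamma>') = card (below \<gamma> \<union> below \<gamma>')"
      using below_disj[OF g] finb by (simp add: card_Un_disjoint)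
    also have "\<dots> \<le> card {z\<in>X. k z \<subseteq> k y}" using y fin by (intro card_mono) (auto simp: below_def)
    also have "\<dots> < 2 ^ Suc h" using small[OF y(1)] .
    finally show False using \<Gamma>X(2)[OF g(1)] \<Gamma>X(2)[OF g(2)] by (simp add: H_def)
  qed
  define I where "I = {x\<in>X. \<exists>\<gamma>\<in>\<Gamma>. k x \<subset> \<gamma>}"
  define Out where "Out = {x\<in>X. \<forall>\<gamma>\<in>\<Gamma>. \<not> k x \<subseteq> \<gamma>}"
  have inI: "x \<in> I" if "x \<in> X" "\<gamma> \<in> \<Gamma>" "k x \<subset> \<gamma>" for x \<gamma> using that by (auto simp: I_def)
  have IOut: "I \<inter> Out = {}" "I \<subseteq> X" "Out \<subseteq> X" by (auto simp: I_def Out_def)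
  have fIO: "finite I" "finite Out" using IOut fin finite_subset by blast+
  have "\<exists>\<G>. finite \<G> \<and> (\<forall>(\<gamma>, A, B)\<in>\<G>. \<gamma> \<in> k ` I \<and> A \<subseteq> I \<and> B \<subseteq> I \<and> (\<forall>x\<in>A. k x \<subseteq> \<gamma>) \<and> (\<forall>y\<in>B. \<gamma> \<subseteq> k y)) \<and>
    (\<forall>x\<in>I. \<forall>y\<in>I. k x \<subseteq> k y \<longrightarrow> (\<exists>(\<gamma>, A, B)\<in>\<G>. x \<in> A \<and> y \<in> B)) \<and>
    (\<Sum>(\<gamma>, A, B)\<in>\<G>. card A + card B) \<le> 2 * h * card I"
  proof (rule Suc.IH[OF fIO(1)])
    show "k x \<subseteq> k y \<or> k y \<subseteq> k x \<or> k x \<inter> k y = {}" if "x \<in> I" "y \<in> I" for x y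
      using lam that IOut by blast
    show "k x \<noteq> {}" if "x \<in> I" for x using ne that IOut by blast
    \<comment> \<open>A cell strictly inside a minimal heavy cell is not heavy.\<close>
    show "card {y\<in>I. k y \<subseteq> k x} < 2 ^ h" if x: "x \<in> I" for x
    proof -
      obtain \<gamma> where g: "\<gamma> \<in> \<Gamma>" "k x \<subset> \<gamma>" "x \<in> X" using x by (auto simp: I_def)
      then have "k x \<notin> H" by (auto simp: \<Gamma>_def)
      then have "card (below (k x)) < 2 ^ h" using g(3) by (simp add: H_def)
      moreover have "card {y\<in>I. k y \<subseteq> k x} \<le> card (below (k x))"
        using finb IOut by (intro card_mono) (auto simp: below_def)
      ultimately show ?thesis by linarith
    qed
  qed
  then obtain \<G>1 where G1: "finite \<G>1"
    "\<forall>(\<gamma>, A, B)\<in>\<G>1. \<gamma> \<in> k ` I \<and> A \<subseteq> I \<and> B \<subseteq> I \<and> (\<forall>x\<in>A. k x \<subseteq> \<gamma>) \<and> (\<forall>y\<in>B. \<gamma> \<subseteq> k y)"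
    "\<forall>x\<in>I. \<forall>y\<in>I. k x \<subseteq> k y \<longrightarrow> (\<exists>(\<gamma>, A, B)\<in>\<G>1. x \<in> A \<and> y \<in> B)"
    "(\<Sum>(\<gamma>, A, B)\<in>\<G>1. card A + card B) \<le> 2 * h * card I"
    by (elim exE conjE)
  have "\<exists>\<G>. finite \<G> \<and> (\<forall>(\<gamma>, A, B)\<in>\<G>. \<gamma> \<in> k ` Out \<and> A \<subseteq> Out \<and> B \<subseteq> Out \<and> (\<forall>x\<in>A. k x \<subseteq> \<gamma>) \<and> (\<forall>y\<in>B. \<gamma> \<subseteq> k y)) \<and>
    (\<forall>x\<in>Out. \<forall>y\<in>Out. k x \<subseteq> k y \<longrightarrow> (\<exists>(\<gamma>, A, B)\<in>\<G>. x \<in> A \<and> y \<in> B)) \<and>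
    (\<Sum>(\<gamma>, A, B)\<in>\<G>. card A + card B) \<le> 2 * h * card Out"
  proof (rule Suc.IH[OF fIO(2)])
    show "k x \<subseteq> k y \<or> k y \<subseteq> k x \<or> k x \<inter> k y = {}" if "x \<in> Out" "y \<in> Out" for x y
      using lam that IOut by blast
    show "k x \<noteq> {}" if "x \<in> Out" for x using ne that IOut by blast
    show "card {y\<in>Out. k y \<subseteq> k x} < 2 ^ h" if x: "x \<in> Out" for x
    proof (cases "k x \<in> H")
      case False
      then have "card (below (k x)) < 2 ^ h" using x IOut by (auto simp: H_def)
      moreover have "card {y\<in>Out. k y \<subseteq> k x} \<le> card (below (k x))"
        using finb IOut by (intro card_mono) (auto simp: below_def)
      ultimately show ?thesis by linarith
    next
      \<comment> \<open>A heavy cell outside contains a member of \<open>\<Gamma>\<close>, and the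
        items below that member, at least \<open>2 ^ h\<close> of them, are not in
        \<open>Out\<close>; fewer than \<open>2 ^ h\<close> remain.\<close>
      case True
      then obtain \<gamma> where g: "\<gamma> \<in> \<Gamma>" "\<gamma> \<subseteq> k x" using minimal by blast
      have "{y\<in>Out. k y \<subseteq> k x} \<inter> below \<gamma> = {}" using g(1) by (auto simp: Out_def below_def)
      then have "card {y\<in>Out. k y \<subseteq> k x} + card (below \<gamma>) = card ({y\<in>Out. k y \<subseteq> k x} \<union> below \<gamma>)"
        using finb fIO by (simp add: card_Un_disjoint)
      also have "\<dots> \<le> card {y\<in>X. k y \<subseteq> k x}"
        using fin IOut g(2) by (intro card_mono) (auto simp: below_def)
      also have "\<dots> < 2 ^ Suc h" using small x IOut by blast
      finally show ?thesis using \<Gamma>X(2)[OF g(1)] by (simp add: H_def)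
    qed
  qed
  then obtain \<G>2 where G2: "finite \<G>2"
    "\<forall>(\<gamma>, A, B)\<in>\<G>2. \<gamma> \<in> k ` Out \<and> A \<subseteq> Out \<and> B \<subseteq> Out \<and> (\<forall>x\<in>A. k x \<subseteq> \<gamma>) \<and> (\<forall>y\<in>B. \<gamma> \<subseteq> k y)"
    "\<forall>x\<in>Out. \<forall>y\<in>Out. k x \<subseteq> k y \<longrightarrow> (\<exists>(\<gamma>, A, B)\<in>\<G>2. x \<in> A \<and> y \<in> B)"
    "(\<Sum>(\<gamma>, A, B)\<in>\<G>2. card A + card B) \<le> 2 * h * card Out"
    by (elim exE conjE)
  define \<G>0 where "\<G>0 = (\<lambda>\<gamma>. (\<gamma>, below \<gamma>, above \<gamma>)) ` \<Gamma>"
  let ?w = "\<lambda>(\<gamma>, A, B). card A + card B"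
  have "(\<Sum>g\<in>\<G>0. ?w g) = (\<Sum>\<gamma>\<in>\<Gamma>. card (below \<gamma>)) + (\<Sum>\<gamma>\<in>\<Gamma>. card (above \<gamma>))"
    unfolding \<G>0_def by (subst sum.reindex) (auto simp: inj_on_def sum.distrib)
  also have "(\<Sum>\<gamma>\<in>\<Gamma>. card (below \<gamma>)) = card (\<Union>\<gamma>\<in>\<Gamma>. below \<gamma>)"
    using finH finb below_disj by (intro card_UN_disjoint[symmetric]) auto
  also have "(\<Sum>\<gamma>\<in>\<Gamma>. card (above \<gamma>)) = card (\<Union>\<gamma>\<in>\<Gamma>. above \<gamma>)"
    using finH finb above_disj by (intro card_UN_disjoint[symmetric]) auto
  also have "card (\<Union>\<gamma>\<in>\<Gamma>. below \<gamma>) \<le> card X" using fin by (intro card_mono) (auto simp: below_def)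
  also have "card (\<Union>\<gamma>\<in>\<Gamma>. above \<gamma>) \<le> card X" using fin by (intro card_mono) (auto simp: above_def)
  finally have w0: "(\<Sum>g\<in>\<G>0. ?w g) \<le> 2 * card X" by simp
  let ?G = "\<G>0 \<union> (\<G>1 \<union> \<G>2)"
  have fG: "finite \<G>0" using finH by (simp add: \<G>0_def)
  have "(\<Sum>g\<in>?G. ?w g) \<le> (\<Sum>g\<in>\<G>0. ?w g) + ((\<Sum>g\<in>\<G>1. ?w g) + (\<Sum>g\<in>\<G>2. ?w g))"
    using sum_Un_nat[of \<G>0 "\<G>1 \<union> \<G>2" ?w] sum_Un_nat[of \<G>1 \<G>2 ?w] fG G1(1) G2(1) by simp
  also have "\<dots> \<le> 2 * card X + 2 * h * (card I + card Out)"
    using w0 G1(4) G2(4) by (simp add: distrib_left)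
  also have "card I + card Out = card (I \<union> Out)" using fIO IOut by (simp add: card_Un_disjoint)
  also have "card (I \<union> Out) \<le> card X" using IOut fin by (intro card_mono) auto
  finally have W: "(\<Sum>g\<in>?G. ?w g) \<le> 2 * Suc h * card X" by simp
  have valid: "\<forall>(\<gamma>, A, B)\<in>?G. \<gamma> \<in> k ` X \<and> A \<subseteq> X \<and> B \<subseteq> X \<and> (\<forall>x\<in>A. k x \<subseteq> \<gamma>) \<and> (\<forall>y\<in>B. \<gamma> \<subseteq> k y)"
  proof -
    have "\<forall>(\<gamma>, A, B)\<in>\<G>0. \<gamma> \<in> k ` X \<and> A \<subseteq> X \<and> B \<subseteq> X \<and> (\<forall>x\<in>A. k x \<subseteq> \<gamma>) \<and> (\<forall>y\<in>B. \<gamma> \<subseteq> k y)"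
      using \<Gamma>X by (auto simp: \<G>0_def below_def above_def)
    moreover have "\<forall>(\<gamma>, A, B)\<in>\<G>1. \<gamma> \<in> k ` X \<and> A \<subseteq> X \<and> B \<subseteq> X \<and> (\<forall>x\<in>A. k x \<subseteq> \<gamma>) \<and> (\<forall>y\<in>B. \<gamma> \<subseteq> k y)"
    proof (intro ballI, clarify)
      fix \<gamma> A B assume "(\<gamma>, A, B) \<in> \<G>1"
      from bspec[OF G1(2) this] IOut(2)
      show "\<gamma> \<in> k ` X \<and> A \<subseteq> X \<and> B \<subseteq> X \<and> (\<forall>x\<in>A. k x \<subseteq> \<gamma>) \<and> (\<forall>y\<in>B. \<gamma> \<subseteq> k y)" by auto
    qed
    moreover have "\<forall>(\<gamma>, A, B)\<in>\<G>2. \<gamma> \<in> k ` X \<and> A \<subseteq> X \<and> B \<subseteq> X \<and> (\<forall>x\<in>A. k x \<subseteq> \<gamma>) \<and> (\<forall>y\<in>B. \<gamma> \<subseteq> k y)"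
    proof (intro ballI, clarify)
      fix \<gamma> A B assume "(\<gamma>, A, B) \<in> \<G>2"
      from bspec[OF G2(2) this] IOut(3)
      show "\<gamma> \<in> k ` X \<and> A \<subseteq> X \<and> B \<subseteq> X \<and> (\<forall>x\<in>A. k x \<subseteq> \<gamma>) \<and> (\<forall>y\<in>B. \<gamma> \<subseteq> k y)" by auto
    qed
    ultimately show ?thesis by (simp only: ball_Un)
  qed
  have covered: "\<exists>(\<gamma>, A, B)\<in>?G. x \<in> A \<and> y \<in> B" if xy: "x \<in> X" "y \<in> X" "k x \<subseteq> k y" for x y
  proof (cases "\<exists>\<gamma>\<in>\<Gamma>. k x \<subseteq> \<gamma>")
    case True
    then obtain \<gamma> where g: "\<gamma> \<in> \<Gamma>" "k x \<subseteq> \<gamma>" by blast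
    from \<Gamma>X(1)[OF g(1)] obtain z where z: "\<gamma> = k z" "z \<in> X" by (rule imageE)
    show ?thesis
    proof (cases "\<gamma> \<subseteq> k y")
      case True
      then have "x \<in> below \<gamma>" "y \<in> above \<gamma>" using g xy by (auto simp: below_def above_def)
      moreover have "(\<gamma>, below \<gamma>, above \<gamma>) \<in> ?G" using g(1) by (simp add: \<G>0_def)
      ultimately show ?thesis by (intro bexI[of _ "(\<gamma>, below \<gamma>, above \<gamma>)"]) simp_all
    next
      case False
      \<comment> \<open>Here \<open>k y\<close> lies strictly inside \<open>\<gamma>\<close>, and
        then so does \<open>k x\<close>: the pair is left to the recursion on
        \<open>I\<close>.\<close>
      have "k z \<inter> k y \<noteq> {}" using ne[OF xy(1)] g(2) xy(3) z by blast
      then have "k y \<subseteq> k z" using lam[OF z(2) xy(2)] False[unfolded z(1)] by (simp only: simp_thms)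
      then have "k y \<subset> \<gamma>" using False unfolding z(1) by (simp only: less_le_not_le simp_thms)
      moreover from xy(3) this have "k x \<subset> \<gamma>" by (rule order.strict_trans1)
      ultimately have "x \<in> I" "y \<in> I"
        using inI[OF xy(1) g(1)] inI[OF xy(2) g(1)] by (simp_all only:)
      from bspec[OF bspec[OF G1(3) this(1)] this(2)] xy(3)
      have "\<exists>(\<gamma>, A, B)\<in>\<G>1. x \<in> A \<and> y \<in> B" by (rule mp)
      then show ?thesis by (simp only: bex_Un simp_thms)
    qed
  next
    case False
    then have "x \<in> Out" "y \<in> Out" using xy by (auto simp: Out_def)
    from bspec[OF bspec[OF G2(3) this(1)] this(2)] xy(3)
    have "\<exists>(\<gamma>, A, B)\<in>\<G>2. x \<in> A \<and> y \<in> B" by (rule mp)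
    then show ?thesis by (simp only: bex_Un simp_thms)
  qed
  show ?case
  proof (intro exI[of _ ?G] conjI)
    show "finite ?G" using fG G1(1) G2(1) by simp
    show "\<forall>x\<in>X. \<forall>y\<in>X. k x \<subseteq> k y \<longrightarrow> (\<exists>(\<gamma>, A, B)\<in>?G. x \<in> A \<and> y \<in> B)"
      using covered by (intro ballI impI)
  qed (fact valid W)+
qed

subsection \<open>Covering bipartite relations by stars\<close>

text \<open>\<open>E\<close> joins the objects \<open>u\<close> to hubs, \<open>F\<close> joins hubs
  to other members of \<open>Q\<close>. \<open>F\<close> may be any set of pairs because
  \<open>Q\<close> will be a clique. Pairs are ordered and may be degenerate; loops are removed only
  when edges are formed.\<close>

definition hub_cover :: "('u \<Rightarrow> 'v \<Rightarrow> bool) \<Rightarrow> 'u set \<Rightarrow> 'v set \<Rightarrow> real \<Rightarrow> bool" where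
  "hub_cover R U Q c \<longleftrightarrow> (\<exists>E F. E \<subseteq> {(u, v). u \<in> U \<and> v \<in> Q \<and> R u v} \<and> F \<subseteq> Q \<times> Q \<and> finite E \<and> finite F \<and>
     real (card E) + real (card F) \<le> c \<and>
     (\<forall>u\<in>U. \<forall>w\<in>Q. R u w \<longrightarrow> (\<exists>v. (u, v) \<in> E \<and> (v = w \<or> (v, w) \<in> F))))"

lemma hub_coverI:
  assumes "E \<subseteq> {(u, v). u \<in> U \<and> v \<in> Q \<and> R u v}" "F \<subseteq> Q \<times> Q" "finite E" "finite F"
    "real (card E) + real (card F) \<le> c"
    "\<And>u w. u \<in> U \<Longrightarrow> w \<in> Q \<Longrightarrow> R u w \<Longrightarrow> \<exists>v. (u, v) \<in> E \<and> (v = w \<or> (v, w) \<in> F)"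
  shows "hub_cover R U Q c"
  unfolding hub_cover_def using assms by (intro exI[of _ E] exI[of _ F] conjI ballI impI)

lemma hub_cover_mono: "hub_cover R U Q c \<Longrightarrow> c \<le> c' \<Longrightarrow> hub_cover R U Q c'"
  unfolding hub_cover_def by (meson order_trans)

lemma hub_cover_cong:
  assumes "hub_cover R U Q c" "\<And>u v. u \<in> U \<Longrightarrow> v \<in> Q \<Longrightarrow> R u v \<longleftrightarrow> R' u v"
  shows "hub_cover R' U Q c"
proof -
  have "{(u, v). u \<in> U \<and> v \<in> Q \<and> R' u v} = {(u, v). u \<in> U \<and> v \<in> Q \<and> R u v}"
    using assms(2) by auto
  then show ?thesis using assms unfolding hub_cover_def by auto
qed

lemma hub_cover_UN:
  assumes I: "finite I" and sub: "\<And>i. i \<in> I \<Longrightarrow> U i \<subseteq> U'" "\<And>i. i \<in> I \<Longrightarrow> Q i \<subseteq> Q'"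
    and hc: "\<And>i. i \<in> I \<Longrightarrow> hub_cover R (U i) (Q i) (c i)"
    and cover: "\<And>u w. u \<in> U' \<Longrightarrow> w \<in> Q' \<Longrightarrow> R u w \<Longrightarrow> \<exists>i\<in>I. u \<in> U i \<and> w \<in> Q i"
  shows "hub_cover R U' Q' (\<Sum>i\<in>I. c i)"
proof -
  have "\<exists>EF. \<forall>i\<in>I. fst (EF i) \<subseteq> {(u, v). u \<in> U i \<and> v \<in> Q i \<and> R u v} \<and> snd (EF i) \<subseteq> Q i \<times> Q i \<and>
     finite (fst (EF i)) \<and> finite (snd (EF i)) \<and> real (card (fst (EF i))) + real (card (snd (EF i))) \<le> c i \<and>
     (\<forall>u\<in>U i. \<forall>w\<in>Q i. R u w \<longrightarrow> (\<exists>v. (u, v) \<in> fst (EF i) \<and> (v = w \<or> (v, w) \<in> snd (EF i))))"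
    using hc unfolding hub_cover_def by (intro bchoice ballI) simp
  then obtain EF where EF: "\<forall>i\<in>I. fst (EF i) \<subseteq> {(u, v). u \<in> U i \<and> v \<in> Q i \<and> R u v} \<and> snd (EF i) \<subseteq> Q i \<times> Q i \<and>
     finite (fst (EF i)) \<and> finite (snd (EF i)) \<and> real (card (fst (EF i))) + real (card (snd (EF i))) \<le> c i \<and>
     (\<forall>u\<in>U i. \<forall>w\<in>Q i. R u w \<longrightarrow> (\<exists>v. (u, v) \<in> fst (EF i) \<and> (v = w \<or> (v, w) \<in> snd (EF i))))" ..
  let ?E = "\<Union>i\<in>I. fst (EF i)" and ?F = "\<Union>i\<in>I. snd (EF i)"
  show ?thesis
  proof (rule hub_coverI[of ?E _ _ _ ?F])
    show "?E \<subseteq> {(u, v). u \<in> U' \<and> v \<in> Q' \<and> R u v}" using EF sub by blast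
    show "?F \<subseteq> Q' \<times> Q'" using EF sub by blast
    show "finite ?E" "finite ?F" using EF I by auto
    have "real (card ?E) + real (card ?F) \<le> (\<Sum>i\<in>I. real (card (fst (EF i)))) + (\<Sum>i\<in>I. real (card (snd (EF i))))"
      using card_UN_le[OF I, of "\<lambda>i. fst (EF i)"] card_UN_le[OF I, of "\<lambda>i. snd (EF i)"]
      unfolding of_nat_sum[symmetric] by linarith
    also have "\<dots> \<le> (\<Sum>i\<in>I. c i)"
      unfolding sum.distrib[symmetric] using EF by (intro sum_mono) blast
    finally show "real (card ?E) + real (card ?F) \<le> (\<Sum>i\<in>I. c i)" .
    fix u w assume uw: "u \<in> U'" "w \<in> Q'" "R u w"
    then obtain i where i: "i \<in> I" "u \<in> U i" "w \<in> Q i" using cover by blast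
    then obtain v where "(u, v) \<in> fst (EF i) \<and> (v = w \<or> (v, w) \<in> snd (EF i))" using EF uw(3) by blast
    then show "\<exists>v. (u, v) \<in> ?E \<and> (v = w \<or> (v, w) \<in> ?F)" using i(1) by blast
  qed
qed

lemma hub_cover_Un:
  assumes "hub_cover R U1 Q c1" "hub_cover R U2 Q c2"
  shows "hub_cover R (U1 \<union> U2) Q (c1 + c2)"
proof -
  have "hub_cover R (U1 \<union> U2) Q (\<Sum>b\<in>UNIV. if b then c1 else c2)"
    by (rule hub_cover_UN[where U = "\<lambda>b. if b then U1 else U2" and Q = "\<lambda>_. Q"])
      (use assms in \<open>auto split: if_splits simp: UNIV_bool\<close>)
  then show ?thesis by (simp add: UNIV_bool add.commute)
qed

lemma hub_cover_star:
  assumes "finite U" "finite Q" "\<And>u v. u \<in> U \<Longrightarrow> v \<in> Q \<Longrightarrow> R u v \<longleftrightarrow> P"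
  shows "hub_cover R U Q (real (card Q) + real (card U))"
proof (cases "P \<and> Q \<noteq> {}")
  case True
  then obtain v0 where "v0 \<in> Q" by blast
  then show ?thesis using assms True
    by (intro hub_coverI[of "U \<times> {v0}" _ _ _ "{v0} \<times> Q"]) (auto simp: card_cartesian_product)
next
  case False
  then show ?thesis using assms by (intro hub_coverI[of "{}" _ _ _ "{}"]) auto
qed

text \<open>The start of the recursion: with all pairs in \<open>Q\<close> available, one edge per
  \<open>u\<close> suffices. This is efficient once the square of \<open>card Q\<close> is at most
  \<open>card U\<close>.\<close>

lemma hub_cover_trivial:
  assumes "finite U" "finite Q"
  shows "hub_cover R U Q ((real (card Q))\<^sup>2 + real (card U))"
proof -
  let ?U = "{u\<in>U. \<exists>v\<in>Q. R u v}"
  define s where "s = (\<lambda>u. SOME v. v \<in> Q \<and> R u v)"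
  have s: "s u \<in> Q \<and> R u (s u)" if "u \<in> ?U" for u
    unfolding s_def using that by (intro someI_ex[of "\<lambda>v. v \<in> Q \<and> R u v"]) blast
  show ?thesis
  proof (rule hub_coverI[of "(\<lambda>u. (u, s u)) ` ?U" _ _ _ "Q \<times> Q"])
    have "card ((\<lambda>u. (u, s u)) ` ?U) \<le> card ?U" using assms by (intro card_image_le) simp
    also have "\<dots> \<le> card U" using assms by (intro card_mono) auto
    finally show "real (card ((\<lambda>u. (u, s u)) ` ?U)) + real (card (Q \<times> Q)) \<le> (real (card Q))\<^sup>2 + real (card U)"
      by (simp add: card_cartesian_product power2_eq_square)
    show "\<exists>v. (u, v) \<in> (\<lambda>u. (u, s u)) ` ?U \<and> (v = w \<or> (v, w) \<in> Q \<times> Q)"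
      if "u \<in> U" "w \<in> Q" "R u w" for u w
    proof -
      have "u \<in> ?U" using that by blast
      then show ?thesis using s[of u] that(2) by blast
    qed
  qed (use s assms in auto)
qed

text \<open>Concavity of the power function. Each \<open>a i\<close> is compared with
  \<open>S / M\<close> by Young's inequality, so that \<open>S\<close> and \<open>M\<close> may be
  mere upper bounds.\<close>

lemma sum_powr_le:
  fixes a :: "'i \<Rightarrow> real"
  assumes I: "finite I" "card I \<le> M" and M: "M \<ge> 1" and a: "\<And>i. i \<in> I \<Longrightarrow> a i \<ge> 0"
    and S: "(\<Sum>i\<in>I. a i) \<le> S" and \<beta>: "0 \<le> \<beta>" "\<beta> < 1"
  shows "(\<Sum>i\<in>I. a i powr (1 - \<beta>)) \<le> real M powr \<beta> * S powr (1 - \<beta>)"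
proof (cases "S > 0")
  case False
  have "(\<Sum>i\<in>I. a i) = 0" using S False a sum_nonneg[of I a] by force
  then have "\<And>i. i \<in> I \<Longrightarrow> a i = 0" using I(1) a by (simp add: sum_nonneg_eq_0_iff)
  then show ?thesis by simp
next
  case True
  define t where "t = S / M"
  have t: "t > 0" using True M by (simp add: t_def)
  have "a i powr (1 - \<beta>) * t powr \<beta> \<le> (1 - \<beta>) * a i + \<beta> * t" if "i \<in> I" for i
  proof (cases "a i = 0")
    case True then show ?thesis using \<beta> t by simp
  next
    case False
    then show ?thesis using Youngs_inequality_0[of "1 - \<beta>" \<beta> "a i" t] a[OF that] \<beta> t by simp
  qed
  then have "(\<Sum>i\<in>I. a i powr (1 - \<beta>) * t powr \<beta>) \<le> (\<Sum>i\<in>I. (1 - \<beta>) * a i + \<beta> * t)"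
    by (rule sum_mono)
  also have "\<dots> = (1 - \<beta>) * (\<Sum>i\<in>I. a i) + \<beta> * t * card I"
    by (simp add: sum.distrib sum_distrib_left mult_ac)
  also have "\<dots> \<le> (1 - \<beta>) * S + \<beta> * t * M"
    using S \<beta> t I(2) by (intro add_mono mult_left_mono) auto
  also have "\<dots> = S" using M by (simp add: t_def algebra_simps)
  finally have "(\<Sum>i\<in>I. a i powr (1 - \<beta>)) * t powr \<beta> \<le> S" by (simp add: sum_distrib_right)
  then have "(\<Sum>i\<in>I. a i powr (1 - \<beta>)) \<le> S / t powr \<beta>" using t by (simp add: le_divide_eq)
  also have "\<dots> = real M powr \<beta> * (S / S powr \<beta>)"
    using True M by (simp add: t_def powr_divide)
  also have "S / S powr \<beta> = S powr (1 - \<beta>)" using True by (simp add: powr_diff)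
  finally show ?thesis .
qed

section \<open>The partition recursion\<close>

text \<open>All that the recursion has to know about one predicate. Partitions are demanded for
  every large subset because the recursion descends into the parts.\<close>

definition well_partitioned :: "nat \<Rightarrow> real \<Rightarrow> nat \<Rightarrow> real \<Rightarrow> ('u \<Rightarrow> 'v \<Rightarrow> bool) \<Rightarrow> 'u set \<Rightarrow> 'v set \<Rightarrow> bool" where
  "well_partitioned m0 \<mu> M \<kappa> A U Q \<longleftrightarrow> (\<forall>Q'\<subseteq>Q. card Q' > m0 \<longrightarrow> (\<exists>\<P>. \<Union>\<P> = Q' \<and> card \<P> \<le> M \<and>
     (\<forall>\<Delta>\<in>\<P>. \<forall>\<Delta>'\<in>\<P>. \<Delta> \<noteq> \<Delta>' \<longrightarrow> \<Delta> \<inter> \<Delta>' = {}) \<and>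
     (\<forall>\<Delta>\<in>\<P>. real (card \<Delta>) \<le> \<mu> * real (card Q')) \<and>
     (\<forall>u\<in>U. real (card {\<Delta>\<in>\<P>. \<exists>v\<in>\<Delta>. \<exists>w\<in>\<Delta>. A u v \<noteq> A u w}) \<le> \<kappa>)))"

lemma well_partitioned_mono:
  assumes wp: "well_partitioned m0 \<mu> M \<kappa> A U Q" and sub: "U' \<subseteq> U" "Q' \<subseteq> Q"
  shows "well_partitioned m0 \<mu> M \<kappa> A U' Q'"
  unfolding well_partitioned_def
proof (intro allI impI)
  fix R assume R: "R \<subseteq> Q'" "card R > m0"
  from wp[unfolded well_partitioned_def, rule_format, OF order_trans[OF R(1) sub(2)] R(2)]
  obtain \<P> where \<P>: "\<Union>\<P> = R" "card \<P> \<le> M"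
    "\<forall>\<Delta>\<in>\<P>. \<forall>\<Delta>'\<in>\<P>. \<Delta> \<noteq> \<Delta>' \<longrightarrow> \<Delta> \<inter> \<Delta>' = {}" "\<forall>\<Delta>\<in>\<P>. real (card \<Delta>) \<le> \<mu> * real (card R)"
    "\<forall>u\<in>U. real (card {\<Delta>\<in>\<P>. \<exists>v\<in>\<Delta>. \<exists>w\<in>\<Delta>. A u v \<noteq> A u w}) \<le> \<kappa>"
    by (elim exE conjE)
  from \<P>(5) have "\<forall>u\<in>U'. real (card {\<Delta>\<in>\<P>. \<exists>v\<in>\<Delta>. \<exists>w\<in>\<Delta>. A u v \<noteq> A u w}) \<le> \<kappa>"
    using sub(1) by (intro ballI) (erule bspec, erule subsetD)
  with \<P>(1-4) show "\<exists>\<P>. \<Union>\<P> = R \<and> card \<P> \<le> M \<and>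
     (\<forall>\<Delta>\<in>\<P>. \<forall>\<Delta>'\<in>\<P>. \<Delta> \<noteq> \<Delta>' \<longrightarrow> \<Delta> \<inter> \<Delta>' = {}) \<and>
     (\<forall>\<Delta>\<in>\<P>. real (card \<Delta>) \<le> \<mu> * real (card R)) \<and>
     (\<forall>u\<in>U'. real (card {\<Delta>\<in>\<P>. \<exists>v\<in>\<Delta>. \<exists>w\<in>\<Delta>. A u v \<noteq> A u w}) \<le> \<kappa>)"
    by (intro exI[of _ \<P>] conjI)
qed

text \<open>\<open>\<mu>\<close> is the relative size of the parts, \<open>M\<close> bounds their
  number and \<open>\<kappa>\<close> the number of parts on which a single \<open>u\<close> is not
  constant. The contraction conditions reduce the cost of all crossed pairs to a quarter; the rest
  of the budget pays for the uncrossed ones.\<close>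

locale partition_recursion =
  fixes m0 M :: nat and \<mu> \<kappa> \<beta> \<delta> :: real
  assumes M: "M \<ge> 1" and \<mu>: "0 < \<mu>" "\<mu> < 1" and \<kappa>: "\<kappa> \<ge> 0" and \<beta>: "0 \<le> \<beta>" "\<beta> < 1" and \<delta>: "\<delta> > 0"
    and contract: "\<mu> powr (2 * \<beta> + \<delta>) * real M powr \<beta> * \<kappa> powr (1 - \<beta>) \<le> 1 / 4"
    and contract': "\<mu> powr \<delta> \<le> 1 / 4"
begin

text \<open>The geometric mean of m^2 and n with weights \<beta> and 1 - \<beta>, times the slack
  m^\<delta>.\<close>

definition \<Psi> :: "real \<Rightarrow> real \<Rightarrow> real" where
  "\<Psi> m n = m powr (2 * \<beta> + \<delta>) * n powr (1 - \<beta>)"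

lemma \<Psi>_mono: "0 \<le> m \<Longrightarrow> m \<le> m' \<Longrightarrow> 0 \<le> n \<Longrightarrow> n \<le> n' \<Longrightarrow> \<Psi> m n \<le> \<Psi> m' n'"
  unfolding \<Psi>_def using \<beta> \<delta> by (intro mult_mono powr_mono2) auto

lemma \<Psi>_nonneg: "\<Psi> m n \<ge> 0"
  by (simp add: \<Psi>_def)

lemma le_\<Psi>:
  assumes "m \<ge> 1" "0 \<le> n" "n \<le> m\<^sup>2"
  shows "n \<le> \<Psi> m n"
proof (cases "n = 0")
  case False
  have "n = n powr \<beta> * n powr (1 - \<beta>)" using False assms by (simp flip: powr_add)
  also have "\<dots> \<le> (m\<^sup>2) powr \<beta> * n powr (1 - \<beta>)"
    using assms \<beta> by (intro mult_right_mono powr_mono2) auto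
  also have "(m\<^sup>2) powr \<beta> = m powr (2 * \<beta>)"
    using assms by (simp add: powr_powr flip: powr_numeral)
  also have "m powr (2 * \<beta>) * n powr (1 - \<beta>) \<le> m powr (2 * \<beta> + \<delta>) * n powr (1 - \<beta>)"
    using assms \<delta> by (intro mult_right_mono powr_mono) auto
  finally show ?thesis by (simp add: \<Psi>_def)
qed (simp add: \<Psi>_nonneg)

text \<open>Double induction, on the number of predicates and on \<open>card Q\<close>. In a part,
  the objects that cross it keep all predicates but face a smaller \<open>Q\<close>; for the others
  the first predicate is constant there and is substituted into \<open>\<Phi>\<close>, which leaves
  one predicate fewer. The term linear in \<open>card U\<close> does not contract, so its factor 2
  is kept apart from \<open>B\<close>; it is charged to \<open>\<Psi>\<close> while
  \<open>card U\<close> is below the square of \<open>card Q\<close>.\<close>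

theorem hub_cover_well_partitioned:
  "\<exists>B\<ge>1. \<forall>(As :: ('u \<Rightarrow> 'v \<Rightarrow> bool) list) \<Phi> U Q. length As = l \<longrightarrow> finite U \<longrightarrow> finite Q \<longrightarrow>
     (\<forall>A\<in>set As. well_partitioned m0 \<mu> M \<kappa> A U Q) \<longrightarrow>
     hub_cover (\<lambda>u v. \<Phi> (map (\<lambda>A. A u v) As)) U Q
       (B * (\<Psi> (card Q) (card U) + real (card Q) powr (1 + \<delta>)) + 2 * real (card U))"
proof (induction l)
  case 0
  have "hub_cover (\<lambda>u v. \<Phi> (map (\<lambda>A. A u v) As)) U Q
       (1 * (\<Psi> (card Q) (card U) + real (card Q) powr (1 + \<delta>)) + 2 * real (card U))"
    if "length As = 0" "finite U" "finite Q" for As :: "('u \<Rightarrow> 'v \<Rightarrow> bool) list" and \<Phi> U Q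
  proof (rule hub_cover_mono[OF hub_cover_star[where P = "\<Phi> []"]])
    have "real (card Q) \<le> real (card Q) powr (1 + \<delta>)"
    proof (cases "card Q = 0")
      case False
      then have "real (card Q) powr 1 \<le> real (card Q) powr (1 + \<delta>)" using \<delta> by (intro powr_mono) auto
      then show ?thesis using False by simp
    qed simp
    then show "real (card Q) + real (card U) \<le> 1 * (\<Psi> (card Q) (card U) + real (card Q) powr (1 + \<delta>)) + 2 * real (card U)"
      using \<Psi>_nonneg[of "card Q" "card U"] by simp
  qed (use that in auto)
  then show ?case by (intro exI[of _ 1]) auto
next
  case (Suc l)
  then obtain B' where B': "B' \<ge> 1"
    and IH: "\<And>(As :: ('u \<Rightarrow> 'v \<Rightarrow> bool) list) \<Phi> U Q. length As = l \<Longrightarrow> finite U \<Longrightarrow> finite Q \<Longrightarrow>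
     (\<And>A. A \<in> set As \<Longrightarrow> well_partitioned m0 \<mu> M \<kappa> A U Q) \<Longrightarrow>
     hub_cover (\<lambda>u v. \<Phi> (map (\<lambda>A. A u v) As)) U Q
       (B' * (\<Psi> (card Q) (card U) + real (card Q) powr (1 + \<delta>)) + 2 * real (card U))" by metis
  \<comment> \<open>Chosen so that \<open>B / 4 + 6 * M + 2 * B' * M \<le> B\<close>: a quarter goes
    to the crossed parts, the remainder to the uncrossed ones and to linear terms. The summand
    \<open>m0\<close> settles small sets.\<close>
  define B where "B = real m0 + 2 * (6 * real M + 2 * B' * real M)"
  have "B' * real M \<ge> 1 * 1" using B' M by (intro mult_mono) auto
  then have B1: "B \<ge> 1" and Bm0: "B \<ge> real m0" by (auto simp: B_def)
  have main: "hub_cover (\<lambda>u v. \<Phi> (map (\<lambda>A. A u v) As)) U Q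
       (B * (\<Psi> (card Q) (card U) + real (card Q) powr (1 + \<delta>)) + 2 * real (card U))"
    if "length As = Suc l" "finite U" "finite Q" "\<And>A. A \<in> set As \<Longrightarrow> well_partitioned m0 \<mu> M \<kappa> A U Q"
    for As :: "('u \<Rightarrow> 'v \<Rightarrow> bool) list" and \<Phi> U Q
    using that
  proof (induction "card Q" arbitrary: U Q rule: less_induct)
    case less
    note fin = less.prems(2,3) and wp = less.prems(4)
    obtain A As' where As: "As = A # As'" "length As' = l" using less.prems(1) by (cases As) auto
    let ?R = "\<lambda>u v. \<Phi> (map (\<lambda>A. A u v) As)"
    define m n where "m = real (card Q)" and "n = real (card U)"
    have mn: "m \<ge> 0" "n \<ge> 0" by (simp_all add: m_def n_def)
    have m_powr: "m \<le> m powr (1 + \<delta>)" if "m \<ge> 1"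
      using powr_mono[of 1 "1 + \<delta>" m] \<delta> that by simp
    have m01: "m = 0 \<or> m \<ge> 1" unfolding m_def by (cases "card Q") simp_all
    have mm0: "m \<le> m0 \<or> card Q > m0" unfolding m_def of_nat_le_iff by (rule le_less_linear)
    have mn2: "m\<^sup>2 \<le> n \<or> n < m\<^sup>2" by (rule le_less_linear)
    \<comment> \<open>The second and third case join all pairs in \<open>Q\<close>; only the last
      one partitions.\<close>
    consider "m = 0" | "m \<ge> 1" "m \<le> m0" | "m\<^sup>2 \<le> n" | "m \<ge> 1" "card Q > m0" "n < m\<^sup>2"
      using m01 mm0 mn2 by blast
    then show ?case
    proof cases
      case 1
      then have "Q = {}" using fin by (simp add: m_def)
      have "hub_cover ?R U Q 0"
        unfolding \<open>Q = {}\<close> by (rule hub_coverI[of "{}" _ _ _ "{}"]) auto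
      then show ?thesis
        by (rule hub_cover_mono) (use B1 \<Psi>_nonneg[of "card Q" "card U"] in simp)
    next
      case 2
      have "m\<^sup>2 \<le> real m0 * m" using 2 by (simp add: power2_eq_square mult_right_mono)
      also have "\<dots> \<le> B * m powr (1 + \<delta>)" using Bm0 m_powr 2 by (intro mult_mono) auto
      finally have "m\<^sup>2 + n \<le> B * (\<Psi> m n + m powr (1 + \<delta>)) + 2 * n"
        using mn B1 \<Psi>_nonneg[of m n] mult_nonneg_nonneg[of B "\<Psi> m n"] unfolding distrib_left by linarith
      then show ?thesis
        using hub_cover_mono[OF hub_cover_trivial[OF fin, of ?R]] unfolding m_def n_def by blast
    next
      case 3
      moreover have "B * (\<Psi> m n + m powr (1 + \<delta>)) \<ge> 0"
        using B1 \<Psi>_nonneg[of m n] by (intro mult_nonneg_nonneg add_nonneg_nonneg) auto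
      ultimately have "m\<^sup>2 + n \<le> B * (\<Psi> m n + m powr (1 + \<delta>)) + 2 * n" by linarith
      then show ?thesis
        using hub_cover_mono[OF hub_cover_trivial[OF fin, of ?R]] unfolding m_def n_def by blast
    next
      case 4
      have "well_partitioned m0 \<mu> M \<kappa> A U Q" using wp As by simp
      from this[unfolded well_partitioned_def, rule_format, OF order_refl 4(2)]
      obtain \<P> where \<P>: "\<Union>\<P> = Q" "card \<P> \<le> M"
        "\<forall>\<Delta>\<in>\<P>. \<forall>\<Delta>'\<in>\<P>. \<Delta> \<noteq> \<Delta>' \<longrightarrow> \<Delta> \<inter> \<Delta>' = {}"
        "\<forall>\<Delta>\<in>\<P>. real (card \<Delta>) \<le> \<mu> * real (card Q)"
        "\<forall>u\<in>U. real (card {\<Delta>\<in>\<P>. \<exists>v\<in>\<Delta>. \<exists>w\<in>\<Delta>. A u v \<noteq> A u w}) \<le> \<kappa>"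
        by (elim exE conjE)
      have fP: "finite \<P>" using \<P>(1) fin by (simp add: finite_UnionD)
      define X where "X = (\<lambda>\<Delta>. {u\<in>U. \<exists>v\<in>\<Delta>. \<exists>w\<in>\<Delta>. A u v \<noteq> A u w})"
      define mD nD where "mD = (\<lambda>\<Delta>::'v set. real (card \<Delta>))" and "nD = (\<lambda>\<Delta>. real (card (X \<Delta>)))"
      have XU: "X \<Delta> \<subseteq> U" for \<Delta> by (auto simp: X_def)
      have mD: "0 \<le> mD \<Delta>" "mD \<Delta> \<le> \<mu> * m" if "\<Delta> \<in> \<P>" for \<Delta>
        using that \<P>(4) by (auto simp: mD_def m_def)
      have "\<mu> * m \<le> m" using \<mu> mn by (simp add: mult_left_le_one_le)
      then have mDm: "mD \<Delta> \<le> m" if "\<Delta> \<in> \<P>" for \<Delta> using mD[OF that] by linarith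
      have nD: "0 \<le> nD \<Delta>" "nD \<Delta> \<le> n" for \<Delta>
        using card_mono[OF fin(1) XU[of \<Delta>]] by (auto simp: nD_def n_def)
      \<comment> \<open>One recursive cover for the crossing objects, and one for each truth value
        that \<open>A\<close> can have constantly on the part.\<close>
      define c where "c = (\<lambda>\<Delta>. (B * (\<Psi> (mD \<Delta>) (nD \<Delta>) + mD \<Delta> powr (1 + \<delta>)) + 2 * nD \<Delta>)
          + 2 * (B' * (\<Psi> m n + m powr (1 + \<delta>)) + 2 * n))"
      have part: "hub_cover ?R U \<Delta> (c \<Delta>)" if D: "\<Delta> \<in> \<P>" for \<Delta>
      proof -
        have DQ: "\<Delta> \<subseteq> Q" using D \<P>(1) by blast
        have fD: "finite \<Delta>" using DQ fin finite_subset by blast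
        have "\<mu> * m < m" using \<mu> 4(1) by simp
        then have "card \<Delta> < card Q" using mD[OF D] by (simp add: mD_def m_def)
        then have 1: "hub_cover ?R (X \<Delta>) \<Delta> (B * (\<Psi> (mD \<Delta>) (nD \<Delta>) + mD \<Delta> powr (1 + \<delta>)) + 2 * nD \<Delta>)"
          unfolding mD_def nD_def
        proof (rule less.hyps[OF _ less.prems(1)])
          show "finite (X \<Delta>)" using XU fin finite_subset by blast
          show "well_partitioned m0 \<mu> M \<kappa> A' (X \<Delta>) \<Delta>" if "A' \<in> set As" for A'
            using wp[OF that] XU DQ by (rule well_partitioned_mono)
        qed (rule fD)
        have 2: "hub_cover ?R {u\<in>U. \<forall>v\<in>\<Delta>. A u v = t} \<Delta> (B' * (\<Psi> m n + m powr (1 + \<delta>)) + 2 * n)" for t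
        proof -
          let ?U = "{u\<in>U. \<forall>v\<in>\<Delta>. A u v = t}"
          have "hub_cover (\<lambda>u v. \<Phi> (t # map (\<lambda>A. A u v) As')) ?U \<Delta>
              (B' * (\<Psi> (card \<Delta>) (card ?U) + real (card \<Delta>) powr (1 + \<delta>)) + 2 * real (card ?U))"
          proof (rule IH[OF As(2), where \<Phi> = "\<lambda>bs. \<Phi> (t # bs)"])
            show "well_partitioned m0 \<mu> M \<kappa> A' ?U \<Delta>" if "A' \<in> set As'" for A'
            proof (rule well_partitioned_mono[OF _ _ DQ])
              show "well_partitioned m0 \<mu> M \<kappa> A' U Q" using that by (intro wp) (simp add: As(1))
            qed (rule Collect_restrict)
            show "finite ?U" using fin(1) by simp
            show "finite \<Delta>" by (rule fD)
          qed
          moreover have "B' * (\<Psi> (card \<Delta>) (card ?U) + real (card \<Delta>) powr (1 + \<delta>)) + 2 * real (card ?U)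
             \<le> B' * (\<Psi> m n + m powr (1 + \<delta>)) + 2 * n"
          proof -
            have cU: "real (card ?U) \<le> n" unfolding n_def using fin by (auto intro: card_mono)
            have cD: "real (card \<Delta>) \<le> m" using mDm[OF D] by (simp add: mD_def)
            have "\<Psi> (card \<Delta>) (card ?U) \<le> \<Psi> m n" using cU cD by (intro \<Psi>_mono) auto
            moreover have "real (card \<Delta>) powr (1 + \<delta>) \<le> m powr (1 + \<delta>)"
              using cD \<delta> by (intro powr_mono2) auto
            ultimately show ?thesis using cU B' by (intro add_mono mult_left_mono) auto
          qed
          ultimately have "hub_cover (\<lambda>u v. \<Phi> (t # map (\<lambda>A. A u v) As')) ?U \<Delta> (B' * (\<Psi> m n + m powr (1 + \<delta>)) + 2 * n)"
            by (rule hub_cover_mono)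
          then show ?thesis by (rule hub_cover_cong) (simp add: As(1))
        qed
        have "U = X \<Delta> \<union> ({u\<in>U. \<forall>v\<in>\<Delta>. A u v = True} \<union> {u\<in>U. \<forall>v\<in>\<Delta>. A u v = False})"
          unfolding X_def by blast
        then have "hub_cover ?R U \<Delta> ((B * (\<Psi> (mD \<Delta>) (nD \<Delta>) + mD \<Delta> powr (1 + \<delta>)) + 2 * nD \<Delta>)
          + ((B' * (\<Psi> m n + m powr (1 + \<delta>)) + 2 * n) + (B' * (\<Psi> m n + m powr (1 + \<delta>)) + 2 * n)))"
          using hub_cover_Un[OF 1 hub_cover_Un[OF 2[of True] 2[of False]]] by (simp only:)
        then show ?thesis unfolding c_def mult_2 .
      qed
      have "hub_cover ?R U Q (\<Sum>\<Delta>\<in>\<P>. c \<Delta>)"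
        using fP part \<P>(1) by (intro hub_cover_UN[where U = "\<lambda>_. U" and Q = "\<lambda>\<Delta>. \<Delta>"]) auto
      moreover have "(\<Sum>\<Delta>\<in>\<P>. c \<Delta>) \<le> B * (\<Psi> m n + m powr (1 + \<delta>)) + 2 * n"
      proof -
        \<comment> \<open>Double counting of the pairs of a part and an object that crosses
          it.\<close>
        have cross: "(\<Sum>\<Delta>\<in>\<P>. nD \<Delta>) \<le> \<kappa> * n"
        proof -
          have "(\<Sum>\<Delta>\<in>\<P>. nD \<Delta>) = (\<Sum>\<Delta>\<in>\<P>. \<Sum>u\<in>U. if u \<in> X \<Delta> then 1 else 0)"
            using fin XU by (intro sum.cong) (auto simp: nD_def sum.If_cases Int_absorb1)
          also have "\<dots> = (\<Sum>u\<in>U. \<Sum>\<Delta>\<in>\<P>. if u \<in> X \<Delta> then 1 else 0)" by (rule sum.swap)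
          also have "\<dots> = (\<Sum>u\<in>U. real (card {\<Delta>\<in>\<P>. \<exists>v\<in>\<Delta>. \<exists>w\<in>\<Delta>. A u v \<noteq> A u w}))"
            using fP by (intro sum.cong refl) (simp add: sum.If_cases X_def Int_def)
          also have "\<dots> \<le> (\<Sum>u\<in>U. \<kappa>)" using \<P>(5) by (intro sum_mono) auto
          finally show ?thesis by (simp add: n_def mult.commute)
        qed
        have size: "(\<Sum>\<Delta>\<in>\<P>. mD \<Delta>) = m"
        proof -
          have "card (\<Union>\<P>) = (\<Sum>\<Delta>\<in>\<P>. card \<Delta>)"
          proof (rule card_Union_disjoint)
            show "pairwise disjnt \<P>" using \<P>(3) by (simp add: pairwise_def disjnt_def)
            show "finite \<Delta>" if "\<Delta> \<in> \<P>" for \<Delta>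
              using that \<P>(1) by (intro finite_subset[OF _ fin(2)]) blast
          qed
          then show ?thesis by (simp add: \<P>(1) m_def mD_def)
        qed
        have S1: "(\<Sum>\<Delta>\<in>\<P>. \<Psi> (mD \<Delta>) (nD \<Delta>)) \<le> \<Psi> m n / 4"
        proof -
          have "(\<Sum>\<Delta>\<in>\<P>. \<Psi> (mD \<Delta>) (nD \<Delta>)) \<le> (\<Sum>\<Delta>\<in>\<P>. (\<mu> * m) powr (2 * \<beta> + \<delta>) * nD \<Delta> powr (1 - \<beta>))"
            unfolding \<Psi>_def using mD \<beta> \<delta> by (intro sum_mono mult_right_mono powr_mono2) auto
          also have "\<dots> = (\<mu> * m) powr (2 * \<beta> + \<delta>) * (\<Sum>\<Delta>\<in>\<P>. nD \<Delta> powr (1 - \<beta>))"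
            by (simp add: sum_distrib_left)
          also have "\<dots> \<le> (\<mu> * m) powr (2 * \<beta> + \<delta>) * (real M powr \<beta> * (\<kappa> * n) powr (1 - \<beta>))"
            using nD by (intro mult_left_mono sum_powr_le[OF fP \<P>(2) M _ cross \<beta>]) auto
          also have "\<dots> = (\<mu> powr (2 * \<beta> + \<delta>) * real M powr \<beta> * \<kappa> powr (1 - \<beta>)) * \<Psi> m n"
            using \<mu> \<kappa> mn by (simp add: \<Psi>_def powr_mult mult_ac)
          also have "\<dots> \<le> 1 / 4 * \<Psi> m n" using contract \<Psi>_nonneg by (intro mult_right_mono)
          finally show ?thesis by simp
        qed
        have S2: "(\<Sum>\<Delta>\<in>\<P>. mD \<Delta> powr (1 + \<delta>)) \<le> m powr (1 + \<delta>) / 4"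
        proof -
          have "(\<Sum>\<Delta>\<in>\<P>. mD \<Delta> powr (1 + \<delta>)) \<le> (\<Sum>\<Delta>\<in>\<P>. (\<mu> * m) powr \<delta> * mD \<Delta>)"
          proof (rule sum_mono)
            fix \<Delta> assume D: "\<Delta> \<in> \<P>"
            have "mD \<Delta> powr (1 + \<delta>) = mD \<Delta> powr \<delta> * mD \<Delta>"
              using mD(1)[OF D] by (cases "mD \<Delta> = 0") (simp_all add: powr_add)
            also have "\<dots> \<le> (\<mu> * m) powr \<delta> * mD \<Delta>"
              using mD[OF D] \<delta> by (intro mult_right_mono powr_mono2) auto
            finally show "mD \<Delta> powr (1 + \<delta>) \<le> (\<mu> * m) powr \<delta> * mD \<Delta>" .
          qed
          also have "\<dots> = (\<mu> * m) powr \<delta> * m" by (simp add: size flip: sum_distrib_left)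
          also have "\<dots> = \<mu> powr \<delta> * m powr (1 + \<delta>)" using \<mu> 4(1) by (simp add: powr_mult powr_add)
          also have "\<dots> \<le> 1 / 4 * m powr (1 + \<delta>)" using contract' by (intro mult_right_mono) auto
          finally show ?thesis by simp
        qed
        have cP: "real (card \<P>) \<le> real M" using \<P>(2) by simp
        have S3: "(\<Sum>\<Delta>\<in>\<P>. nD \<Delta>) \<le> real M * n"
        proof -
          have "(\<Sum>\<Delta>\<in>\<P>. nD \<Delta>) \<le> (\<Sum>\<Delta>\<in>\<P>. n)" using nD by (intro sum_mono) auto
          also have "\<dots> \<le> real M * n" using cP mn by (simp add: mult_right_mono)
          finally show ?thesis .
        qed
        let ?W = "B' * (\<Psi> m n + m powr (1 + \<delta>)) + 2 * n"
        have W0: "?W \<ge> 0" using B' \<Psi>_nonneg[of m n] mn by simp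
        \<comment> \<open>This uses \<open>n < m\<^sup>2\<close> and lets the linear terms be
          charged to \<open>\<Psi>\<close>.\<close>
        have n\<Psi>: "n \<le> \<Psi> m n" using 4 mn by (intro le_\<Psi>) auto
        have "(\<Sum>\<Delta>\<in>\<P>. c \<Delta>) = B * ((\<Sum>\<Delta>\<in>\<P>. \<Psi> (mD \<Delta>) (nD \<Delta>)) + (\<Sum>\<Delta>\<in>\<P>. mD \<Delta> powr (1 + \<delta>)))
            + 2 * (\<Sum>\<Delta>\<in>\<P>. nD \<Delta>) + real (card \<P>) * (2 * ?W)"
          by (simp only: c_def sum.distrib sum_constant sum_distrib_left distrib_left)
        also have "\<dots> \<le> B * (\<Psi> m n / 4 + m powr (1 + \<delta>) / 4) + 2 * (real M * n) + real M * (2 * ?W)"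
          using S1 S2 S3 cP W0 B1 by (intro add_mono mult_left_mono mult_right_mono) auto
        also have "\<dots> = B / 4 * (\<Psi> m n + m powr (1 + \<delta>)) + 6 * real M * n + 2 * B' * real M * (\<Psi> m n + m powr (1 + \<delta>))"
          by (simp add: algebra_simps)
        also have "\<dots> \<le> B / 4 * (\<Psi> m n + m powr (1 + \<delta>)) + 6 * real M * (\<Psi> m n + m powr (1 + \<delta>))
            + 2 * B' * real M * (\<Psi> m n + m powr (1 + \<delta>))"
        proof -
          have "n \<le> \<Psi> m n + m powr (1 + \<delta>)" using n\<Psi> powr_ge_zero[of m "1 + \<delta>"] by linarith
          then show ?thesis by (intro add_right_mono add_left_mono mult_left_mono) auto
        qed
        also have "\<dots> = (B / 4 + 6 * real M + 2 * B' * real M) * (\<Psi> m n + m powr (1 + \<delta>))"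
          by (simp only: distrib_right)
        also have "\<dots> \<le> B * (\<Psi> m n + m powr (1 + \<delta>))"
        proof (rule mult_right_mono)
          have "0 \<le> B' * real M" using B' by simp
          then show "B / 4 + 6 * real M + 2 * B' * real M \<le> B" by (simp add: B_def)
        qed (use \<Psi>_nonneg[of m n] in simp)
        finally show ?thesis using mn by linarith
      qed
      ultimately show ?thesis unfolding m_def n_def by (rule hub_cover_mono)
    qed
  qed
  show ?case using B1 by (intro exI[of _ B] conjI allI impI main) (assumption | erule (1) bspec)+
qed

end

subsection \<open>Fat objects\<close>

text \<open>The floors make the dyadic cells half-open, so that the cells of each level partition
  the space and levels are nested exactly.\<close>

definition grid_cell :: "real \<Rightarrow> nat \<Rightarrow> real ^ 'd::finite \<Rightarrow> (real ^ 'd) set" where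
  "grid_cell e i x = {y. \<forall>j. \<lfloor>y $ j / (e * 2 ^ i)\<rfloor> = \<lfloor>x $ j / (e * 2 ^ i)\<rfloor>}"

lemma in_grid_cell: "x \<in> grid_cell e i x"
  by (simp add: grid_cell_def)

lemma grid_cell_eq: "y \<in> grid_cell e i x \<Longrightarrow> grid_cell e i y = grid_cell e i x"
  by (simp add: grid_cell_def)

lemma floor_coarsen:
  fixes a e :: real
  assumes "i \<le> i'"
  shows "\<lfloor>a / (e * 2 ^ i')\<rfloor> = \<lfloor>a / (e * 2 ^ i)\<rfloor> div 2 ^ (i' - i)"
proof -
  have "(2::real) ^ i' = 2 ^ i * 2 ^ (i' - i)" using assms by (simp flip: power_add)
  then have "a / (e * 2 ^ i') = a / (e * 2 ^ i) / real_of_int (2 ^ (i' - i))" by simp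
  then show ?thesis by (simp only: floor_divide_real_eq_div zero_le_power zero_le_numeral)
qed

lemma grid_cell_coarsen: "i \<le> i' \<Longrightarrow> grid_cell e i x \<subseteq> grid_cell e i' x"
  unfolding grid_cell_def by (auto simp: floor_coarsen)

lemma grid_cell_nested:
  assumes "i \<le> i'" "y \<in> grid_cell e i x" "y \<in> grid_cell e i' x'"
  shows "grid_cell e i x \<subseteq> grid_cell e i' x'"
  using grid_cell_coarsen[OF assms(1), of e y] grid_cell_eq[OF assms(2)] grid_cell_eq[OF assms(3)] by simp

lemma grid_cell_subset_cbox:
  fixes x :: "real ^ 'd::finite"
  assumes "e > 0"
  shows "\<exists>a. grid_cell e i x \<subseteq> cbox a (a + (\<chi> j. e * 2 ^ i))"
proof (intro exI subsetI)
  let ?H = "e * 2 ^ i"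
  let ?a = "(\<chi> j. ?H * of_int \<lfloor>x $ j / ?H\<rfloor>) :: real ^ 'd"
  have H: "?H > 0" using assms by simp
  fix y assume y: "y \<in> grid_cell e i x"
  have "?H * of_int \<lfloor>x $ j / ?H\<rfloor> \<le> y $ j \<and> y $ j \<le> ?H * of_int \<lfloor>x $ j / ?H\<rfloor> + ?H" for j
  proof -
    have f: "\<lfloor>x $ j / ?H\<rfloor> = \<lfloor>y $ j / ?H\<rfloor>" using y by (simp add: grid_cell_def)
    have "of_int \<lfloor>y $ j / ?H\<rfloor> \<le> y $ j / ?H" "y $ j / ?H \<le> of_int \<lfloor>y $ j / ?H\<rfloor> + 1" by linarith+
    from this[THEN mult_left_mono, of ?H] show ?thesis
      using H assms unfolding f by (simp add: distrib_left del: mult_le_cancel_left)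
  qed
  then show "y \<in> cbox ?a (?a + (\<chi> j. ?H))" by (simp add: mem_box_cart)
qed

lemma card_grid_cells_le:
  fixes A :: "(real ^ 'd::finite) set"
  assumes e: "e > 0" and A: "\<And>x y j. x \<in> A \<Longrightarrow> y \<in> A \<Longrightarrow> \<bar>x $ j - y $ j\<bar> \<le> 2 * (e * 2 ^ i)"
  shows "card (grid_cell e i ` A) \<le> 5 ^ CARD('d)"
proof (cases "A = {}")
  case False
  then obtain x0 where x0: "x0 \<in> A" by blast
  let ?H = "e * 2 ^ i"
  have H: "?H > 0" using e by simp
  define \<phi> where "\<phi> = (\<lambda>(x :: real ^ 'd) j. \<lfloor>x $ j / ?H\<rfloor>)"
  define cell where "cell = (\<lambda>f :: 'd \<Rightarrow> int. {y :: real ^ 'd. \<forall>j. \<lfloor>y $ j / ?H\<rfloor> = f j})"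
  \<comment> \<open>Coordinates that differ by at most two cell sides have floors that differ by at
    most 2, hence five values for each coordinate.\<close>
  let ?T = "PiE UNIV (\<lambda>j. {\<phi> x0 j - 2 .. \<phi> x0 j + 2})"
  have "\<phi> x \<in> ?T" if "x \<in> A" for x
  proof -
    have "\<phi> x j \<in> {\<phi> x0 j - 2 .. \<phi> x0 j + 2}" for j
    proof -
      have "\<bar>x $ j / ?H - x0 $ j / ?H\<bar> = \<bar>x $ j - x0 $ j\<bar> / ?H"
        using H by (simp add: abs_divide flip: diff_divide_distrib)
      also have "\<dots> \<le> 2" using A[OF that x0, of j] H by (simp add: divide_le_eq)
      finally have "\<bar>x $ j / ?H - x0 $ j / ?H\<bar> \<le> 2" .
      then show ?thesis unfolding \<phi>_def atLeastAtMost_iff by linarith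
    qed
    then show ?thesis by auto
  qed
  then have "\<phi> ` A \<subseteq> ?T" by blast
  then have "card (\<phi> ` A) \<le> card ?T" by (intro card_mono finite_PiE) auto
  also have "card ?T = 5 ^ CARD('d)" by (subst card_PiE) auto
  finally have 1: "card (\<phi> ` A) \<le> 5 ^ CARD('d)" .
  have fin: "finite (\<phi> ` A)" using \<open>\<phi> ` A \<subseteq> ?T\<close> by (rule finite_subset) (auto intro: finite_PiE)
  have "grid_cell e i ` A = cell ` (\<phi> ` A)" by (simp add: image_image grid_cell_def cell_def \<phi>_def)
  then show ?thesis using card_image_le[OF fin, of cell] 1 by simp
qed simp

lemma dyadic_scale_exists:
  assumes "e > 0" "e \<le> (s::real)"
  shows "\<exists>i::nat. e * 2 ^ i \<le> s \<and> s < e * 2 ^ Suc i"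
proof -
  obtain n where n: "s / e < 2 ^ n" using real_arch_pow[of 2 "s / e"] by auto
  define L where "L = (LEAST n. s / e < (2::real) ^ n)"
  have L: "s / e < 2 ^ L" unfolding L_def using n by (rule LeastI)
  have "L \<noteq> 0" using L assms by (intro notI) (simp add: field_simps)
  then obtain i where i: "L = Suc i" by (cases L) auto
  have "\<not> s / e < 2 ^ i" using not_less_Least[of i "\<lambda>n. s / e < (2::real) ^ n"] i by (simp add: L_def)
  then show ?thesis using L assms unfolding i by (intro exI[of _ i]) (simp add: field_simps)
qed

lemma diameter_zero_imp_eq:
  fixes u :: "'a::euclidean_space set"
  assumes "bounded u" "\<not> diameter u > 0" "x \<in> u" "y \<in> u"
  shows "x = y"
proof -
  have "dist x y = 0"
    using diameter_bounded_bound[OF assms(1,3,4)] assms(2) zero_le_dist[of x y] by linarith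
  then show ?thesis by simp
qed

text \<open>\<open>i u\<close> is the dyadic scale of the diameter of \<open>u\<close>; unbounded objects are cut off at the diameter
  of the finite set \<open>W\<close> of witness points, and one-point objects get a scale below all others.\<close>

lemma object_scales:
  fixes V :: "(real ^ 'd::finite) set set"
  assumes V: "finite V" and W: "finite W"
  shows "\<exists>e>0. \<exists>i. (\<forall>u\<in>V. \<forall>x\<in>u \<inter> W. \<forall>y\<in>u \<inter> W. \<forall>j. \<bar>x $ j - y $ j\<bar> \<le> 2 * (e * 2 ^ i u)) \<and>
    (\<forall>u\<in>V. \<forall>v\<in>V. u \<noteq> v \<longrightarrow> u \<inter> v \<noteq> {} \<longrightarrow> i u \<le> i v \<longrightarrow> (\<not> bounded v \<or> diameter v \<ge> e * 2 ^ i v))"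
proof -
  define nd where "nd = (\<lambda>u :: (real ^ 'd) set. \<not> bounded u \<or> diameter u > 0)"
  \<comment> \<open>The added 1 keeps this size positive even if there is only one witness.\<close>
  define S where "S = diameter W + 1"
  have bW: "bounded W" using W by (rule finite_imp_bounded)
  have S: "S > 0" unfolding S_def using diameter_ge_0[OF bW] by simp
  define s where "s = (\<lambda>u :: (real ^ 'd) set. if bounded u then diameter u else S)"
  \<comment> \<open>At most half of the least size, so that all objects counted by \<open>nd\<close>
    get a scale of at least 1 and scale 0 remains for the degenerate ones.\<close>
  define e where "e = Min (insert 1 (s ` {u\<in>V. nd u})) / 2"
  have s_pos: "s u > 0" if "nd u" for u using that S by (auto simp: nd_def s_def)
  have "Min (insert 1 (s ` {u\<in>V. nd u})) > 0" using V s_pos by (subst Min_gr_iff) auto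
  then have e: "e > 0" by (simp add: e_def)
  have se: "2 * e \<le> s u" if "u \<in> V" "nd u" for u
  proof -
    have "Min (insert 1 (s ` {u\<in>V. nd u})) \<le> s u" using V that by (intro Min_le) auto
    then show ?thesis by (simp add: e_def)
  qed
  have "\<exists>i. (nd u \<longrightarrow> e * 2 ^ i \<le> s u \<and> s u < e * 2 ^ Suc i \<and> i \<ge> 1) \<and> (\<not> nd u \<longrightarrow> i = 0)"
    if u: "u \<in> V" for u
  proof (cases "nd u")
    case True
    obtain i where i: "e * 2 ^ i \<le> s u" "s u < e * 2 ^ Suc i"
      using dyadic_scale_exists[OF e, of "s u"] se[OF u True] e by auto
    have "i \<noteq> 0" using i(2) se[OF u True] by (intro notI) simp
    then show ?thesis using i True by (intro exI[of _ i]) simp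
  qed auto
  then have "\<exists>i. \<forall>u\<in>V. (nd u \<longrightarrow> e * 2 ^ i u \<le> s u \<and> s u < e * 2 ^ Suc (i u) \<and> i u \<ge> (1::nat)) \<and> (\<not> nd u \<longrightarrow> i u = 0)"
    by (intro bchoice ballI)
  then obtain i where i: "\<forall>u\<in>V. (nd u \<longrightarrow> e * 2 ^ i u \<le> s u \<and> s u < e * 2 ^ Suc (i u) \<and> i u \<ge> (1::nat)) \<and> (\<not> nd u \<longrightarrow> i u = 0)" ..
  have "\<bar>x $ j - y $ j\<bar> \<le> 2 * (e * 2 ^ i u)" if u: "u \<in> V" and xy: "x \<in> u \<inter> W" "y \<in> u \<inter> W" for u x y j
  proof (cases "nd u")
    case False
    then have "x = y" using xy diameter_zero_imp_eq[of u x y] by (simp add: nd_def)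
    then show ?thesis using e by simp
  next
    case True
    have "\<bar>x $ j - y $ j\<bar> \<le> dist x y"
      using component_le_norm_cart[of "x - y" j] by (simp add: dist_norm)
    also have "\<dots> \<le> s u"
    proof (cases "bounded u")
      case True
      then show ?thesis using diameter_bounded_bound[OF True, of x y] xy by (simp add: s_def)
    next
      case False
      then show ?thesis using diameter_bounded_bound[OF bW, of x y] xy by (simp add: s_def S_def)
    qed
    also have "s u < e * 2 ^ Suc (i u)" using i u True by blast
    finally show ?thesis by simp
  qed
  moreover have "\<not> bounded v \<or> diameter v \<ge> e * 2 ^ i v"
    if uv: "u \<in> V" "v \<in> V" "u \<noteq> v" "u \<inter> v \<noteq> {}" "i u \<le> i v" for u v
  proof (cases "nd v")
    case True
    then have "e * 2 ^ i v \<le> s v" using i uv(2) by blast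
    then show ?thesis by (simp add: s_def split: if_splits)
  next
    case False
    then have "i v = 0" using i uv(2) by blast
    \<comment> \<open>Both objects would be single points, and single points that meet are
      equal.\<close>
    then have "\<not> nd u" using i uv(1,5) by force
    obtain x where x: "x \<in> u" "x \<in> v" using uv(4) by blast
    have "u = {x}" using x(1) diameter_zero_imp_eq[of u] \<open>\<not> nd u\<close> by (auto simp: nd_def)
    moreover have "v = {x}" using x(2) diameter_zero_imp_eq[of v] False by (auto simp: nd_def)
    ultimately show ?thesis using uv(3) by simp
  qed
  ultimately show ?thesis using e by blast
qed

text \<open>Each group consists of objects \<open>U\<close> and a clique \<open>Q\<close> of objects through a common point.\<close>

theorem fat_groups:
  fixes V :: "(real ^ 'd::finite) set set"
  assumes V: "finite V" and fat: "fat_family c V" and h: "5 ^ CARD('d) * card V < 2 ^ h"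
  shows "\<exists>\<G>. finite \<G> \<and> (\<forall>(U, Q)\<in>\<G>. U \<subseteq> V \<and> Q \<subseteq> V \<and> (\<forall>v\<in>Q. \<forall>w\<in>Q. v \<inter> w \<noteq> {})) \<and>
    (\<forall>u\<in>V. \<forall>v\<in>V. u \<noteq> v \<longrightarrow> u \<inter> v \<noteq> {} \<longrightarrow> (\<exists>(U, Q)\<in>\<G>. (u \<in> U \<and> v \<in> Q) \<or> (v \<in> U \<and> u \<in> Q))) \<and>
    (\<Sum>(U, Q)\<in>\<G>. card U + card Q) \<le> c * (2 * h * (5 ^ CARD('d) * card V))"
proof -
  define wit where "wit = (\<lambda>(u, v). SOME x :: real ^ 'd. x \<in> u \<inter> v)"
  define W where "W = wit ` (V \<times> V)"
  have wit: "wit (u, v) \<in> u \<inter> v" if "u \<inter> v \<noteq> {}" for u v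
    using that unfolding wit_def prod.case some_in_eq .
  have W: "finite W" using V by (simp add: W_def)
  from object_scales[OF V W] obtain e i where e: "e > 0" and ei:
    "\<forall>u\<in>V. \<forall>x\<in>u \<inter> W. \<forall>y\<in>u \<inter> W. \<forall>j. \<bar>x $ j - y $ j\<bar> \<le> 2 * (e * 2 ^ i u)"
    "\<forall>u\<in>V. \<forall>v\<in>V. u \<noteq> v \<longrightarrow> u \<inter> v \<noteq> {} \<longrightarrow> i u \<le> i v \<longrightarrow> (\<not> bounded v \<or> diameter v \<ge> e * 2 ^ i v)"
    by (elim exE conjE)
  note near = ei(1)[rule_format] and large = ei(2)[rule_format]
  \<comment> \<open>An item is an object together with a grid cell, at the scale of the object, that
    holds one of its witnesses; each object yields at most \<open>5 ^ CARD('d)\<close>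
    items.\<close>
  define X where "X = (\<Union>u\<in>V. Pair u ` grid_cell e (i u) ` (u \<inter> W))"
  \<comment> \<open>The second factor makes inclusion of these sets record the order of the scales
    as well.\<close>
  define k where "k = (\<lambda>(u :: (real ^ 'd) set, C :: (real ^ 'd) set). C \<times> {..i u})"
  have XI: "(u, grid_cell e (i u) x) \<in> X" if "u \<in> V" "x \<in> u \<inter> W" for u x
    using that by (auto simp: X_def)
  have XE: "\<exists>u x. p = (u, grid_cell e (i u) x) \<and> u \<in> V \<and> x \<in> u \<inter> W" if "p \<in> X" for p
    using that by (auto simp: X_def)
  have finX: "finite X" using V W by (simp add: X_def)
  have "card X \<le> (\<Sum>u\<in>V. card (Pair u ` grid_cell e (i u) ` (u \<inter> W)))"
    unfolding X_def by (rule card_UN_le[OF V])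
  also have "\<dots> \<le> (\<Sum>u\<in>V. 5 ^ CARD('d))"
  proof (rule sum_mono)
    fix u assume u: "u \<in> V"
    have "card (Pair u ` grid_cell e (i u) ` (u \<inter> W)) \<le> card (grid_cell e (i u) ` (u \<inter> W))"
      using W by (intro card_image_le) auto
    also have "\<dots> \<le> 5 ^ CARD('d)" using near[OF u] by (intro card_grid_cells_le e)
    finally show "card (Pair u ` grid_cell e (i u) ` (u \<inter> W)) \<le> 5 ^ CARD('d)" .
  qed
  finally have cX: "card X \<le> 5 ^ CARD('d) * card V" by (simp add: mult.commute)
  have mem_k: "(y, t) \<in> k (u, C) \<longleftrightarrow> y \<in> C \<and> t \<le> i u" for y t u C by (simp add: k_def)
  have nested: "k p \<subseteq> k p'"
    if p: "p = (u, grid_cell e (i u) x)" "p' = (u', grid_cell e (i u') x')" "i u \<le> i u'"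
      "y \<in> grid_cell e (i u) x" "y \<in> grid_cell e (i u') x'" for p p' u u' x x' y
    using grid_cell_nested[OF p(3,4,5)] p(3) unfolding p(1,2) k_def by auto
  have lam: "k p \<subseteq> k p' \<or> k p' \<subseteq> k p \<or> k p \<inter> k p' = {}" if pp: "p \<in> X" "p' \<in> X" for p p'
  proof (rule ccontr)
    assume neg: "\<not> ?thesis"
    obtain u x where u: "p = (u, grid_cell e (i u) x)" using XE[OF pp(1)] by blast
    obtain u' x' where u': "p' = (u', grid_cell e (i u') x')" using XE[OF pp(2)] by blast
    have "k p \<inter> k p' \<noteq> {}" using neg by blast
    then obtain y t where "(y, t) \<in> k p" "(y, t) \<in> k p'" by auto
    then have y: "y \<in> grid_cell e (i u) x" "y \<in> grid_cell e (i u') x'" by (simp_all add: u u' mem_k)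
    show False
    proof (cases "i u \<le> i u'")
      case True
      then show False using nested[OF u u' True y] neg by blast
    next
      case False
      then have "i u' \<le> i u" by simp
      then show False using nested[OF u' u _ y(2) y(1)] neg by blast
    qed
  qed
  have ne: "k p \<noteq> {}" if pX: "p \<in> X" for p
  proof -
    obtain u x where u: "p = (u, grid_cell e (i u) x)" using XE[OF pX] by blast
    have "(x, 0) \<in> k p" by (simp add: u mem_k in_grid_cell)
    then show ?thesis by blast
  qed
  have small: "card {y\<in>X. k y \<subseteq> k x} < 2 ^ h" for x
  proof -
    have "card {y\<in>X. k y \<subseteq> k x} \<le> card X" using finX by (intro card_mono) auto
    then show ?thesis using cX h by linarith
  qed
  have "\<exists>\<G>. finite \<G> \<and> (\<forall>(\<gamma>, A, B)\<in>\<G>. \<gamma> \<in> k ` X \<and> A \<subseteq> X \<and> B \<subseteq> X \<and> (\<forall>x\<in>A. k x \<subseteq> \<gamma>) \<and> (\<forall>y\<in>B. \<gamma> \<subseteq> k y)) \<and>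
    (\<forall>x\<in>X. \<forall>y\<in>X. k x \<subseteq> k y \<longrightarrow> (\<exists>(\<gamma>, A, B)\<in>\<G>. x \<in> A \<and> y \<in> B)) \<and>
    (\<Sum>(\<gamma>, A, B)\<in>\<G>. card A + card B) \<le> 2 * h * card X"
    by (rule laminar_groups[OF finX], erule (1) lam, erule ne, rule small)
  then obtain \<G> where \<G>: "finite \<G>"
    "\<forall>(\<gamma>, A, B)\<in>\<G>. \<gamma> \<in> k ` X \<and> A \<subseteq> X \<and> B \<subseteq> X \<and> (\<forall>x\<in>A. k x \<subseteq> \<gamma>) \<and> (\<forall>y\<in>B. \<gamma> \<subseteq> k y)"
    "\<forall>x\<in>X. \<forall>y\<in>X. k x \<subseteq> k y \<longrightarrow> (\<exists>(\<gamma>, A, B)\<in>\<G>. x \<in> A \<and> y \<in> B)"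
    "(\<Sum>(\<gamma>, A, B)\<in>\<G>. card A + card B) \<le> 2 * h * card X"
    by (elim exE conjE)
  \<comment> \<open>The objects to which fatness will apply: they meet the cell and are at least as
    large as their own scale.\<close>
  define big where "big = (\<lambda>(\<gamma> :: ((real ^ 'd) \<times> nat) set) (B :: ((real ^ 'd) set \<times> (real ^ 'd) set) set). {v \<in> fst ` B. v \<inter> fst ` \<gamma> \<noteq> {} \<and> (\<not> bounded v \<or> diameter v \<ge> e * 2 ^ i v)})"
  \<comment> \<open>\<open>\<gamma>\<close> projects into a cube whose side is the scale of some
    object, and all members of \<open>B\<close> have at least that scale, so \<open>c\<close> points
    hit the large ones among them that meet it.\<close>
  have hit: "\<exists>P. finite P \<and> card P \<le> c \<and> (\<forall>v\<in>big \<gamma> B. P \<inter> v \<noteq> {})" if g: "(\<gamma>, A, B) \<in> \<G>" for \<gamma> A B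
  proof -
    have gv: "\<gamma> \<in> k ` X" "B \<subseteq> X" "\<forall>y\<in>B. \<gamma> \<subseteq> k y" using bspec[OF \<G>(2) g] by simp_all
    from gv(1) obtain p where p: "\<gamma> = k p" "p \<in> X" by (rule imageE)
    obtain u x where u: "p = (u, grid_cell e (i u) x)" using XE[OF p(2)] by blast
    obtain a where a: "grid_cell e (i u) x \<subseteq> cbox a (a + (\<chi> j. e * 2 ^ i u))"
      using grid_cell_subset_cbox[OF e] by blast
    have s: "e * 2 ^ i u > 0" using e by simp
    obtain P where P: "finite P" "card P \<le> c"
      "\<forall>v\<in>V. v \<inter> cbox a (a + (\<chi> j. e * 2 ^ i u)) \<noteq> {} \<and> (\<not> bounded v \<or> diameter v \<ge> e * 2 ^ i u) \<longrightarrow> P \<inter> v \<noteq> {}"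
      using fat[unfolded fat_family_def, rule_format, OF s, of a] by blast
    have "P \<inter> v \<noteq> {}" if v: "v \<in> big \<gamma> B" for v
    proof -
      have v': "v \<in> fst ` B" "v \<inter> fst ` \<gamma> \<noteq> {}" "\<not> bounded v \<or> diameter v \<ge> e * 2 ^ i v"
        using v by (simp_all add: big_def)
      from v'(1) obtain p' where p': "v = fst p'" "p' \<in> B" by (rule imageE)
      obtain v0 x' where v0: "p' = (v0, grid_cell e (i v0) x')" "v0 \<in> V" using XE[of p'] p'(2) gv(2) by blast
      then have vV: "v \<in> V" "p' = (v, grid_cell e (i v) x')" using p' by simp_all
      have "(x, i u) \<in> \<gamma>" by (simp add: p u mem_k in_grid_cell)
      then have "(x, i u) \<in> k p'" using gv(3) p'(2) by blast
      then have "i u \<le> i v" by (simp add: vV(2) mem_k)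
      then have "e * 2 ^ i u \<le> e * 2 ^ i v" using e by (simp add: power_increasing)
      then have "\<not> bounded v \<or> diameter v \<ge> e * 2 ^ i u" using v'(3) by linarith
      moreover have "fst ` \<gamma> \<subseteq> cbox a (a + (\<chi> j. e * 2 ^ i u))" using a by (auto simp: p u mem_k)
      then have "v \<inter> cbox a (a + (\<chi> j. e * 2 ^ i u)) \<noteq> {}" using v'(2) by blast
      ultimately show ?thesis using P(3) vV(1) by blast
    qed
    then show ?thesis using P(1,2) by blast
  qed
  have "\<exists>P. \<forall>g\<in>\<G>. finite (P g) \<and> card (P g) \<le> c \<and> (\<forall>v\<in>big (fst g) (snd (snd g)). P g \<inter> v \<noteq> {})"
    using hit by (intro bchoice ballI) (metis prod.collapse)
  then obtain P where P: "\<forall>g\<in>\<G>. finite (P g) \<and> card (P g) \<le> c \<and> (\<forall>v\<in>big (fst g) (snd (snd g)). P g \<inter> v \<noteq> {})" ..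
  \<comment> \<open>One group for every hitting point; the large objects of \<open>B\<close> through
    that point form the clique.\<close>
  define grp where "grp = (\<lambda>(g :: ((real ^ 'd) \<times> nat) set \<times> ((real ^ 'd) set \<times> (real ^ 'd) set) set \<times> ((real ^ 'd) set \<times> (real ^ 'd) set) set,
      pt :: real ^ 'd). (fst ` fst (snd g), {v \<in> big (fst g) (snd (snd g)). pt \<in> v}))"
  let ?I = "Sigma \<G> P"
  have finI: "finite ?I" using \<G>(1) P by (intro finite_SigmaI) auto
  have in_X: "A \<subseteq> X" "B \<subseteq> X" if "(\<gamma>, A, B) \<in> \<G>" for \<gamma> A B using bspec[OF \<G>(2) that] by simp_all
  have fstX: "fst ` A \<subseteq> V" if "A \<subseteq> X" for A using that XE by fastforce
  have "(\<Sum>(U, Q)\<in>grp ` ?I. card U + card Q) \<le> (\<Sum>z\<in>?I. (case grp z of (U, Q) \<Rightarrow> card U + card Q))"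
    using sum_image_le[OF finI, of "\<lambda>(U, Q). card U + card Q" grp] by (simp add: o_def)
  also have "\<dots> \<le> (\<Sum>(g, pt)\<in>?I. card (fst (snd g)) + card (snd (snd g)))"
  proof (rule sum_mono)
    fix z assume z: "z \<in> ?I"
    obtain \<gamma> A B pt where zz: "z = ((\<gamma>, A, B), pt)" by (cases z) auto
    then have g: "(\<gamma>, A, B) \<in> \<G>" using z by simp
    have fAB: "finite A" "finite B" using in_X[OF g] finX finite_subset by blast+
    have "card (fst ` A) \<le> card A" using fAB(1) by (rule card_image_le)
    moreover have "card {v \<in> big \<gamma> B. pt \<in> v} \<le> card (fst ` B)"
      using fAB by (intro card_mono) (auto simp: big_def)
    moreover have "card (fst ` B) \<le> card B" using fAB(2) by (rule card_image_le)
    ultimately show "(case grp z of (U, Q) \<Rightarrow> card U + card Q) \<le> (case z of (g, pt) \<Rightarrow> card (fst (snd g)) + card (snd (snd g)))"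
      by (simp add: zz grp_def)
  qed
  also have "\<dots> = (\<Sum>g\<in>\<G>. \<Sum>pt\<in>P g. card (fst (snd g)) + card (snd (snd g)))"
    using P \<G>(1) by (subst sum.Sigma) auto
  also have "\<dots> = (\<Sum>g\<in>\<G>. card (P g) * (card (fst (snd g)) + card (snd (snd g))))" by simp
  also have "\<dots> \<le> (\<Sum>g\<in>\<G>. c * (card (fst (snd g)) + card (snd (snd g))))"
    using P by (intro sum_mono mult_right_mono) auto
  also have "\<dots> = c * (\<Sum>(\<gamma>, A, B)\<in>\<G>. card A + card B)"
    by (simp add: sum_distrib_left case_prod_beta)
  also have "\<dots> \<le> c * (2 * h * (5 ^ CARD('d) * card V))"
    using \<G>(4) cX by (intro mult_left_mono order_trans[OF \<G>(4)]) auto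
  finally have size: "(\<Sum>(U, Q)\<in>grp ` ?I. card U + card Q) \<le> c * (2 * h * (5 ^ CARD('d) * card V))" .
  have valid: "U \<subseteq> V \<and> Q \<subseteq> V \<and> (\<forall>v\<in>Q. \<forall>w\<in>Q. v \<inter> w \<noteq> {})" if UQ: "(U, Q) \<in> grp ` ?I" for U Q
  proof -
    from UQ obtain z where z: "(U, Q) = grp z" "z \<in> ?I" by (rule imageE)
    obtain \<gamma> A B pt where zz: "z = ((\<gamma>, A, B), pt)" by (cases z) auto
    then have g: "(\<gamma>, A, B) \<in> \<G>" using z(2) by simp
    have U: "U = fst ` A" and Q: "Q = {v \<in> big \<gamma> B. pt \<in> v}" using z(1) by (simp_all add: zz grp_def)
    have "Q \<subseteq> fst ` B" by (auto simp: Q big_def)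
    moreover have "\<forall>v\<in>Q. \<forall>w\<in>Q. v \<inter> w \<noteq> {}" by (auto simp: Q)
    ultimately show ?thesis using fstX[OF in_X(1)[OF g]] fstX[OF in_X(2)[OF g]] U by blast
  qed
  \<comment> \<open>The cell of the object with the smaller scale lies in \<open>\<gamma>\<close>,
    and with it the witness. Hence the other object meets \<open>\<gamma>\<close> and is
    hit.\<close>
  have ordered: "\<exists>(U, Q)\<in>grp ` ?I. u \<in> U \<and> v \<in> Q"
    if uv: "u \<in> V" "v \<in> V" "u \<noteq> v" "u \<inter> v \<noteq> {}" "i u \<le> i v" "x \<in> u \<inter> v" "x \<in> W" for u v x
  proof -
    let ?p = "(u, grid_cell e (i u) x)" and ?p' = "(v, grid_cell e (i v) x)"
    have pX: "?p \<in> X" "?p' \<in> X" using uv by (auto intro!: XI)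
    have kk: "k ?p \<subseteq> k ?p'" by (rule nested[OF refl refl uv(5) in_grid_cell in_grid_cell])
    from bspec[OF bspec[OF \<G>(3) pX(1)] pX(2)] kk
    have "\<exists>(\<gamma>, A, B)\<in>\<G>. ?p \<in> A \<and> ?p' \<in> B" by (rule mp)
    then obtain \<gamma> A B where g: "(\<gamma>, A, B) \<in> \<G>" "?p \<in> A" "?p' \<in> B" by blast
    have sub: "\<forall>x\<in>A. k x \<subseteq> \<gamma>" using bspec[OF \<G>(2) g(1)] by simp
    have "(x, 0) \<in> k ?p" by (simp add: mem_k in_grid_cell)
    then have "(x, 0) \<in> \<gamma>" using sub g(2) by blast
    then have "x \<in> fst ` \<gamma>" by force
    then have vb: "v \<in> big \<gamma> B"
      using g(3) uv(6) large[OF uv(1-5)] unfolding big_def by force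
    then obtain pt where pt: "pt \<in> P (\<gamma>, A, B)" "pt \<in> v" using P g(1) by fastforce
    have "((\<gamma>, A, B), pt) \<in> ?I" using g(1) pt(1) by blast
    then have "grp ((\<gamma>, A, B), pt) \<in> grp ` ?I" by (rule imageI)
    then have mem: "(fst ` A, {v \<in> big \<gamma> B. pt \<in> v}) \<in> grp ` ?I" by (simp only: grp_def prod.case fst_conv snd_conv)
    have "u \<in> fst ` A" using g(2) by force
    then show ?thesis using vb pt(2) by (intro bexI[OF _ mem]) simp
  qed
  have covered: "\<exists>(U, Q)\<in>grp ` ?I. (u \<in> U \<and> v \<in> Q) \<or> (v \<in> U \<and> u \<in> Q)"
    if uv: "u \<in> V" "v \<in> V" "u \<noteq> v" "u \<inter> v \<noteq> {}" for u v
  proof -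
    have x: "wit (u, v) \<in> u \<inter> v" "wit (u, v) \<in> W" using wit[OF uv(4)] uv by (auto simp: W_def)
    show ?thesis
    proof (cases "i u \<le> i v")
      case True
      from ordered[OF uv True x]
      obtain z where "z \<in> grp ` ?I" "case z of (U, Q) \<Rightarrow> u \<in> U \<and> v \<in> Q" by (elim bexE)
      then show ?thesis by (intro bexI[of _ z]) (simp_all only: case_prod_beta simp_thms)
    next
      case False
      have "\<exists>(U, Q)\<in>grp ` ?I. v \<in> U \<and> u \<in> Q"
        by (rule ordered[OF uv(2,1)]) (use uv False x in auto)
      then obtain z where "z \<in> grp ` ?I" "case z of (U, Q) \<Rightarrow> v \<in> U \<and> u \<in> Q" by (elim bexE)
      then show ?thesis by (intro bexI[of _ z]) (simp_all only: case_prod_beta simp_thms)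
    qed
  qed
  show ?thesis
  proof (intro exI[of _ "grp ` ?I"] conjI)
    show "finite (grp ` ?I)" using finI by (rule finite_imageI)
    show "\<forall>(U, Q)\<in>grp ` ?I. U \<subseteq> V \<and> Q \<subseteq> V \<and> (\<forall>v\<in>Q. \<forall>w\<in>Q. v \<inter> w \<noteq> {})"
    proof
      fix z assume "z \<in> grp ` ?I"
      then have "(fst z, snd z) \<in> grp ` ?I" by (simp only: prod.collapse)
      from valid[OF this] show "case z of (U, Q) \<Rightarrow> U \<subseteq> V \<and> Q \<subseteq> V \<and> (\<forall>v\<in>Q. \<forall>w\<in>Q. v \<inter> w \<noteq> {})"
        unfolding case_prod_beta .
    qed
    show "\<forall>u\<in>V. \<forall>v\<in>V. u \<noteq> v \<longrightarrow> u \<inter> v \<noteq> {} \<longrightarrow>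
      (\<exists>(U, Q)\<in>grp ` ?I. (u \<in> U \<and> v \<in> Q) \<or> (v \<in> U \<and> u \<in> Q))" using covered by (intro ballI impI)
  qed (fact size)
qed

subsection \<open>Semialgebraic relations\<close>

text \<open>\<open>s\<close> is the binary logarithm of the partition parameter q. The degree of the
  partitioning polynomial carries this logarithm as a factor, and a small power of q has to beat
  it.\<close>

lemma partition_scale_exists:
  fixes C \<delta> :: real
  assumes "\<delta> > 0"
  shows "\<exists>s::nat. s \<ge> 1 \<and> C * real s * (2 ^ s) powr (- \<delta>) \<le> 1 / 16"
proof -
  have "(1::real) < norm (2 powr \<delta>)" using assms powr_less_mono[of 0 \<delta> 2] by simp
  then have "(\<lambda>n. of_nat n / (2 powr \<delta>) ^ n) \<longlonglongrightarrow> (0::real)" by (rule lim_n_over_pown)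
  then have "(\<lambda>n. C * (of_nat n / (2 powr \<delta>) ^ n)) \<longlonglongrightarrow> C * 0" by (rule tendsto_mult_left)
  then have "\<forall>\<^sub>F n in sequentially. C * (of_nat n / (2 powr \<delta>) ^ n) < 1 / 16"
    by (intro order_tendstoD) auto
  with eventually_ge_at_top[of 1] have "\<forall>\<^sub>F n in sequentially. 1 \<le> n \<and> C * (of_nat n / (2 powr \<delta>) ^ n) < 1 / 16"
    by (rule eventually_conj)
  then obtain s where s: "1 \<le> s" "C * (real s / (2 powr \<delta>) ^ s) < 1 / 16"
    using eventually_happens[of _ sequentially] by auto
  have eq: "(2 ^ s) powr (- \<delta>) = inverse ((2 powr \<delta>) ^ s)"
    by (simp add: powr_minus powr_powr powr_power mult.commute flip: powr_realpow)
  have "C * real s * (2 ^ s) powr (- \<delta>) = C * (real s / (2 powr \<delta>) ^ s)"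
    unfolding eq divide_inverse by (rule mult.assoc)
  then show ?thesis using s by (intro exI[of _ s]) linarith
qed

text \<open>Apart from \<open>\<delta>\<close>, the exponents of \<open>q\<close> in the product
  cancel, which is what determines \<open>\<beta>\<close>. What remains is the power
  \<open>D\<close> of \<open>A * q powr (- \<delta>)\<close>, times at most 4; hence the constant 1
  / 16.\<close>

lemma contraction_bound:
  fixes D :: nat and q A \<delta> \<beta> M \<kappa> \<mu> :: real
  assumes D: "D \<ge> 1" and \<delta>: "0 < \<delta>" "\<delta> \<le> 1" and q: "q \<ge> 1" and A: "A \<ge> 1" and small: "A * q powr (- \<delta>) \<le> 1 / 16"
    and \<beta>: "\<beta> = (real D - 1) / (2 * real D - 1)" and \<mu>: "\<mu> = 2 / q ^ D"
    and M: "0 \<le> M" "M \<le> (A * q) ^ D" and \<kappa>: "0 \<le> \<kappa>" "\<kappa> \<le> (A * q) ^ D / q"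
  shows "\<mu> powr (2 * \<beta> + \<delta>) * M powr \<beta> * \<kappa> powr (1 - \<beta>) \<le> 1 / 4" and "\<mu> powr \<delta> \<le> 1 / 4"
proof -
  let ?D = "real D"
  have \<beta>01: "0 \<le> \<beta>" "\<beta> \<le> 1 / 2" using D by (simp_all add: \<beta> field_simps)
  have pw: "x ^ D = x powr ?D" if "x > 0" for x :: real using that by (simp add: powr_realpow)
  have \<mu>': "\<mu> = 2 * q powr (- ?D)" using q by (simp add: \<mu> pw powr_minus divide_inverse)
  have \<mu>e: "\<mu> powr t = 2 powr t * q powr (- ?D * t)" for t
    using q by (simp add: \<mu>' powr_mult powr_powr)
  have "M powr \<beta> \<le> ((A * q) powr ?D) powr \<beta>"
    using M \<beta>01 A q by (intro powr_mono2) (auto simp flip: pw)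
  also have "\<dots> = A powr (?D * \<beta>) * q powr (?D * \<beta>)" using A q by (simp add: powr_mult powr_powr)
  finally have Mb: "M powr \<beta> \<le> A powr (?D * \<beta>) * q powr (?D * \<beta>)" .
  have "(A * q) ^ D / q = A powr ?D * q powr (?D - 1)"
    using A q by (simp add: pw powr_mult powr_diff)
  then have "\<kappa> powr (1 - \<beta>) \<le> (A powr ?D * q powr (?D - 1)) powr (1 - \<beta>)"
    using \<kappa> \<beta>01 by (intro powr_mono2) auto
  also have "\<dots> = A powr (?D * (1 - \<beta>)) * q powr ((?D - 1) * (1 - \<beta>))"
    using A q by (simp add: powr_mult powr_powr)
  finally have Kb: "\<kappa> powr (1 - \<beta>) \<le> A powr (?D * (1 - \<beta>)) * q powr ((?D - 1) * (1 - \<beta>))" .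
  have "\<mu> powr (2 * \<beta> + \<delta>) * M powr \<beta> * \<kappa> powr (1 - \<beta>)
     \<le> (2 powr (2 * \<beta> + \<delta>) * q powr (- ?D * (2 * \<beta> + \<delta>))) * (A powr (?D * \<beta>) * q powr (?D * \<beta>)) *
       (A powr (?D * (1 - \<beta>)) * q powr ((?D - 1) * (1 - \<beta>)))"
    unfolding \<mu>e using Mb Kb by (intro mult_mono) auto
  also have "\<dots> = 2 powr (2 * \<beta> + \<delta>) * (A powr (?D * \<beta>) * A powr (?D * (1 - \<beta>))) *
      (q powr (- ?D * (2 * \<beta> + \<delta>)) * q powr (?D * \<beta>) * q powr ((?D - 1) * (1 - \<beta>)))"
    by (simp only: mult_ac)
  also have "A powr (?D * \<beta>) * A powr (?D * (1 - \<beta>)) = A powr ?D"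
    by (simp add: algebra_simps flip: powr_add)
  also have "q powr (- ?D * (2 * \<beta> + \<delta>)) * q powr (?D * \<beta>) * q powr ((?D - 1) * (1 - \<beta>)) = q powr (- \<delta> * ?D)"
  proof -
    have "\<beta> * (2 * ?D - 1) = ?D - 1" using D by (simp add: \<beta>)
    then have "- ?D * (2 * \<beta> + \<delta>) + ?D * \<beta> + (?D - 1) * (1 - \<beta>) = - \<delta> * ?D" by (simp add: algebra_simps)
    then show ?thesis by (simp flip: powr_add)
  qed
  also have "2 powr (2 * \<beta> + \<delta>) * A powr ?D * q powr (- \<delta> * ?D) = 2 powr (2 * \<beta> + \<delta>) * (A * q powr (- \<delta>)) powr ?D"
    using A q by (simp add: powr_mult powr_powr)
  also have "\<dots> \<le> 2 powr 2 * (1 / 16) powr 1"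
  proof (intro mult_mono)
    have "(A * q powr (- \<delta>)) powr ?D \<le> (1 / 16) powr ?D" using small A q by (intro powr_mono2) auto
    also have "\<dots> \<le> (1 / 16) powr 1" using D by (intro powr_mono') auto
    finally show "(A * q powr (- \<delta>)) powr ?D \<le> (1 / 16) powr 1" .
    show "2 powr (2 * \<beta> + \<delta>) \<le> (2::real) powr 2" using \<beta>01 \<delta> by (intro powr_mono) auto
  qed auto
  finally show "\<mu> powr (2 * \<beta> + \<delta>) * M powr \<beta> * \<kappa> powr (1 - \<beta>) \<le> 1 / 4" by simp
  have "\<mu> powr \<delta> = 2 powr \<delta> * q powr (- ?D * \<delta>)" by (rule \<mu>e)
  also have "\<dots> \<le> 2 powr 1 * q powr (- \<delta>)"
  proof (intro mult_mono powr_mono)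
    have "1 * \<delta> \<le> ?D * \<delta>" using D \<delta> by (intro mult_right_mono) auto
    then show "- ?D * \<delta> \<le> - \<delta>" by simp
  qed (use q \<delta> in auto)
  also have "\<dots> \<le> 2 * (A * q powr (- \<delta>))" using mult_right_mono[OF A, of "q powr (- \<delta>)"] by simp
  also have "\<dots> \<le> 1 / 4" using small by simp
  finally show "\<mu> powr \<delta> \<le> 1 / 4" .
qed

text \<open>Above the threshold, the additive error of the polynomial partition is at most
  \<open>card R\<close>, so it merely doubles the relative size of the parts. Where all polynomials
  of \<open>u\<close> keep their signs, the predicate is constant.\<close>

lemma well_partitioned_semialgebraic:
  fixes x :: "'v \<Rightarrow> real ^ 'D::finite" and A :: "'u \<Rightarrow> 'v \<Rightarrow> bool"
  assumes Q: "finite Q" and gen: "generic q x Q" and J: "2 ^ J \<le> (q + 1) ^ CARD('D)" and T: "T \<ge> 1"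
    and A: "\<And>u. u \<in> U \<Longrightarrow> \<exists>fs B. length fs \<le> b \<and> (\<forall>f\<in>set fs. polynomial_deg_le b f \<and> (\<forall>v\<in>Q. f (x v) \<noteq> 0)) \<and>
        (\<forall>v\<in>Q. A u v \<longleftrightarrow> B (map (\<lambda>f. f (x v) > 0) fs))"
    and M: "M = (2 * (J * (CARD('D) * q) + T * (b * b)) + 1) ^ CARD('D)"
  shows "well_partitioned (2 ^ J * (2 * (q + 1) ^ CARD('D))) (2 / 2 ^ J) M (real M / real T) A U Q"
  unfolding well_partitioned_def
proof (intro allI impI)
  let ?m0 = "2 ^ J * (2 * (q + 1) ^ CARD('D))"
  fix R assume R: "R \<subseteq> Q" "card R > ?m0"
  have fR: "finite R" using R(1) Q by (rule finite_subset)
  have "\<exists>F. \<forall>u\<in>U. \<exists>B. length (F u) \<le> b \<and> (\<forall>f\<in>set (F u). polynomial_deg_le b f \<and> (\<forall>v\<in>Q. f (x v) \<noteq> 0)) \<and>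
        (\<forall>v\<in>Q. A u v \<longleftrightarrow> B (map (\<lambda>f. f (x v) > 0) (F u)))"
    using A by (intro bchoice ballI)
  then obtain F where F: "\<forall>u\<in>U. \<exists>B. length (F u) \<le> b \<and> (\<forall>f\<in>set (F u). polynomial_deg_le b f \<and> (\<forall>v\<in>Q. f (x v) \<noteq> 0)) \<and>
        (\<forall>v\<in>Q. A u v \<longleftrightarrow> B (map (\<lambda>f. f (x v) > 0) (F u)))" ..
  have F1: "length (F u) \<le> b" if "u \<in> U" for u using bspec[OF F that] by (elim exE conjE)
  have F2: "polynomial_deg_le b f" if "u \<in> U" "f \<in> set (F u)" for u f
    using bspec[OF F that(1)] that(2) by (elim exE conjE) blast
  have F3: "f (x v) \<noteq> 0" if "u \<in> U" "f \<in> set (F u)" "v \<in> R" for u f v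
    using bspec[OF F that(1)] that(2,3) R(1) by (elim exE conjE) blast
  have F4: "A u v = A u w"
    if u: "u \<in> U" and vw: "v \<in> R" "w \<in> R" and same: "\<And>f. f \<in> set (F u) \<Longrightarrow> (f (x v) > 0) = (f (x w) > 0)" for u v w
  proof -
    obtain B where B: "\<forall>v\<in>Q. A u v \<longleftrightarrow> B (map (\<lambda>f. f (x v) > 0) (F u))"
      using bspec[OF F u] by (elim exE conjE)
    have eq: "map (\<lambda>f. f (x v) > 0) (F u) = map (\<lambda>f. f (x w) > 0) (F u)" using same by simp
    have "v \<in> Q" "w \<in> Q" using vw R(1) by auto
    with B have "A u v = B (map (\<lambda>f. f (x v) > 0) (F u))" "A u w = B (map (\<lambda>f. f (x w) > 0) (F u))"
      by (auto elim: bspec)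
    then show ?thesis by (simp only: eq)
  qed
  have "\<exists>\<P>. \<Union>\<P> = R \<and> card \<P> \<le> M \<and> (\<forall>\<Delta>\<in>\<P>. 2 ^ J * card \<Delta> \<le> card R + ?m0) \<and>
     (\<forall>\<Delta>\<in>\<P>. \<forall>\<Delta>'\<in>\<P>. \<Delta> \<noteq> \<Delta>' \<longrightarrow> \<Delta> \<inter> \<Delta>' = {}) \<and>
     (\<forall>u\<in>U. T * card {\<Delta>\<in>\<P>. \<exists>v\<in>\<Delta>. \<exists>w\<in>\<Delta>. \<exists>f\<in>set (F u). (f (x v) > 0) \<noteq> (f (x w) > 0)} \<le> M)"
    by (rule polynomial_partition[OF fR generic_subset[OF gen Q R(1)] J T, where b = b])
      (erule F1, erule (1) F2, erule (2) F3, rule M)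
  then
  obtain \<P> where \<P>: "\<Union>\<P> = R" "card \<P> \<le> M" "\<forall>\<Delta>\<in>\<P>. 2 ^ J * card \<Delta> \<le> card R + ?m0"
     "\<forall>\<Delta>\<in>\<P>. \<forall>\<Delta>'\<in>\<P>. \<Delta> \<noteq> \<Delta>' \<longrightarrow> \<Delta> \<inter> \<Delta>' = {}"
     "\<forall>u\<in>U. T * card {\<Delta>\<in>\<P>. \<exists>v\<in>\<Delta>. \<exists>w\<in>\<Delta>. \<exists>f\<in>set (F u). (f (x v) > 0) \<noteq> (f (x w) > 0)} \<le> M"
    by (elim exE conjE)
  have fP: "finite \<P>" using \<P>(1) fR by (simp add: finite_UnionD)
  have P1: "real (card \<Delta>) \<le> 2 / 2 ^ J * real (card R)" if "\<Delta> \<in> \<P>" for \<Delta>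
  proof -
    have "2 ^ J * card \<Delta> \<le> 2 * card R" using bspec[OF \<P>(3) that] R(2) by linarith
    then have "real (2 ^ J * card \<Delta>) \<le> real (2 * card R)" by (simp only: of_nat_le_iff)
    then show ?thesis by (simp add: field_simps)
  qed
  have P2: "real (card {\<Delta>\<in>\<P>. \<exists>v\<in>\<Delta>. \<exists>w\<in>\<Delta>. A u v \<noteq> A u w}) \<le> real M / real T" if u: "u \<in> U" for u
  proof -
    have "{\<Delta>\<in>\<P>. \<exists>v\<in>\<Delta>. \<exists>w\<in>\<Delta>. A u v \<noteq> A u w}
      \<subseteq> {\<Delta>\<in>\<P>. \<exists>v\<in>\<Delta>. \<exists>w\<in>\<Delta>. \<exists>f\<in>set (F u). (f (x v) > 0) \<noteq> (f (x w) > 0)}"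
    proof
      fix \<Delta> assume "\<Delta> \<in> {\<Delta>\<in>\<P>. \<exists>v\<in>\<Delta>. \<exists>w\<in>\<Delta>. A u v \<noteq> A u w}"
      then obtain v w where D: "\<Delta> \<in> \<P>" "v \<in> \<Delta>" "w \<in> \<Delta>" "A u v \<noteq> A u w" by blast
      have "v \<in> R" "w \<in> R" using D(1-3) \<P>(1) by auto
      then have "\<exists>f\<in>set (F u). (f (x v) > 0) \<noteq> (f (x w) > 0)"
        using F4[OF u, of v w] D(4) by (intro ccontr[of "\<exists>f\<in>set (F u). _ f"]) auto
      then show "\<Delta> \<in> {\<Delta>\<in>\<P>. \<exists>v\<in>\<Delta>. \<exists>w\<in>\<Delta>. \<exists>f\<in>set (F u). (f (x v) > 0) \<noteq> (f (x w) > 0)}"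
        using D(1-3) by (intro CollectI conjI bexI[of _ v] bexI[of _ w])
    qed
    then have le: "card {\<Delta>\<in>\<P>. \<exists>v\<in>\<Delta>. \<exists>w\<in>\<Delta>. A u v \<noteq> A u w}
      \<le> card {\<Delta>\<in>\<P>. \<exists>v\<in>\<Delta>. \<exists>w\<in>\<Delta>. \<exists>f\<in>set (F u). (f (x v) > 0) \<noteq> (f (x w) > 0)}"
      using fP by (intro card_mono) auto
    have "T * card {\<Delta>\<in>\<P>. \<exists>v\<in>\<Delta>. \<exists>w\<in>\<Delta>. A u v \<noteq> A u w} \<le> M"
      by (rule order_trans[OF mult_le_mono2[OF le] bspec[OF \<P>(5) u]])
    then have "real (T * card {\<Delta>\<in>\<P>. \<exists>v\<in>\<Delta>. \<exists>w\<in>\<Delta>. A u v \<noteq> A u w}) \<le> real M" by (simp only: of_nat_le_iff)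
    then show ?thesis using T by (simp add: le_divide_eq mult.commute)
  qed
  show "\<exists>\<P>. \<Union>\<P> = R \<and> card \<P> \<le> M \<and>
     (\<forall>\<Delta>\<in>\<P>. \<forall>\<Delta>'\<in>\<P>. \<Delta> \<noteq> \<Delta>' \<longrightarrow> \<Delta> \<inter> \<Delta>' = {}) \<and>
     (\<forall>\<Delta>\<in>\<P>. real (card \<Delta>) \<le> 2 / 2 ^ J * real (card R)) \<and>
     (\<forall>u\<in>U. real (card {\<Delta>\<in>\<P>. \<exists>v\<in>\<Delta>. \<exists>w\<in>\<Delta>. A u v \<noteq> A u w}) \<le> real M / real T)"
  proof (intro exI[of _ \<P>] conjI)
    show "\<forall>\<Delta>\<in>\<P>. real (card \<Delta>) \<le> 2 / 2 ^ J * real (card R)" by (intro ballI P1)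
    show "\<forall>u\<in>U. real (card {\<Delta>\<in>\<P>. \<exists>v\<in>\<Delta>. \<exists>w\<in>\<Delta>. A u v \<noteq> A u w}) \<le> real M / real T" by (intro ballI P2)
  qed (fact \<P>(1,2,4))+
qed

text \<open>Finitely many incidences survive replacing \<open>f \<ge> 0\<close> by \<open>f + \<eta> > 0\<close> and moving the points slightly.\<close>

lemma semialgebraic_perturbation:
  fixes p :: "'v \<Rightarrow> real ^ 'D::finite" and S :: "'u \<Rightarrow> (real ^ 'D) set"
  assumes V: "finite V" and U: "finite U" and S: "\<And>u. u \<in> U \<Longrightarrow> semialgebraic_complexity_le b (S u)"
  shows "\<exists>x :: 'v \<Rightarrow> real ^ 'D. generic q x V \<and> (\<forall>u\<in>U. \<exists>fs B. length fs \<le> b \<and>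
     (\<forall>f\<in>set fs. polynomial_deg_le b f \<and> (\<forall>v\<in>V. f (x v) \<noteq> 0)) \<and>
     (\<forall>v\<in>V. p v \<in> S u \<longleftrightarrow> B (map (\<lambda>f. f (x v) > 0) fs)))"
proof -
  have "\<exists>F. \<forall>u\<in>U. \<exists>B. length (F u) \<le> b \<and> (\<forall>f\<in>set (F u). polynomial_deg_le b f) \<and>
     S u = {x. B (map (\<lambda>f. f x \<ge> 0) (F u))}"
    using S unfolding semialgebraic_complexity_le_def by (intro bchoice ballI)
  then obtain F where F: "\<forall>u\<in>U. \<exists>B. length (F u) \<le> b \<and> (\<forall>f\<in>set (F u). polynomial_deg_le b f) \<and>
     S u = {x. B (map (\<lambda>f. f x \<ge> 0) (F u))}" ..
  have deg: "polynomial_deg_le b f" if "u \<in> U" "f \<in> set (F u)" for u f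
    using bspec[OF F that(1)] that(2) by (elim exE conjE) blast
  define Fs where "Fs = (\<Union>u\<in>U. set (F u))"
  have finFs: "finite Fs" using U by (simp add: Fs_def)
  \<comment> \<open>The absolute values of all negative values that occur, and 1 to make the set
    nonempty. A shift by half the minimum leaves no zeros and turns the weak atoms into strict
    ones.\<close>
  define N where "N = insert 1 ((\<lambda>(f, v). - f (p v)) ` {(f, v) \<in> Fs \<times> V. f (p v) < 0})"
  define \<eta> where "\<eta> = Min N / 2"
  have finN: "finite N" unfolding N_def using finFs V by (auto intro: finite_subset[of _ "Fs \<times> V"])
  have "Min N > 0" using finN by (subst Min_gr_iff) (auto simp: N_def)
  then have eta: "\<eta> > 0" by (simp add: \<eta>_def)
  have eta': "f (p v) + \<eta> < 0" if "f \<in> Fs" "v \<in> V" "f (p v) < 0" for f v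
  proof -
    have "Min N \<le> - f (p v)" using finN that by (intro Min_le) (auto simp: N_def)
    then show ?thesis using \<open>Min N > 0\<close> by (simp add: \<eta>_def)
  qed
  have sgn: "f (p v) + \<eta> > 0 \<longleftrightarrow> f (p v) \<ge> 0" "f (p v) + \<eta> \<noteq> 0" if "f \<in> Fs" "v \<in> V" for f v
    using eta eta'[OF that] by (smt (verit))+
  have ev: "\<forall>\<^sub>F z in nhds (p v). (f z + \<eta> > 0 \<longleftrightarrow> f (p v) \<ge> 0) \<and> f z + \<eta> \<noteq> 0" if fv: "f \<in> Fs" "v \<in> V" for f v
  proof -
    have "polynomial_deg_le b f" using fv(1) deg by (auto simp: Fs_def)
    then have "continuous_on UNIV (\<lambda>z. f z + \<eta>)"
      by (intro continuous_intros polynomial_deg_le_continuous_on)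
    then have lim: "((\<lambda>z. f z + \<eta>) \<longlongrightarrow> f (p v) + \<eta>) (nhds (p v))"
      by (metis UNIV_I continuous_on_eq_continuous_at isCont_def open_UNIV tendsto_at_iff_tendsto_nhds)
    show ?thesis
    proof (cases "f (p v) \<ge> 0")
      case True
      then have "f (p v) + \<eta> > 0" using eta by linarith
      from order_tendstoD(1)[OF lim this] show ?thesis by eventually_elim (use True in auto)
    next
      case False
      then have "f (p v) + \<eta> < 0" using sgn[OF fv] by linarith
      from order_tendstoD(2)[OF lim this] show ?thesis by eventually_elim (use False in auto)
    qed
  qed
  have "\<exists>d>0. \<forall>z. dist z (p v) < d \<longrightarrow> (\<forall>f\<in>Fs. (f z + \<eta> > 0 \<longleftrightarrow> f (p v) \<ge> 0) \<and> f z + \<eta> \<noteq> 0)" if "v \<in> V" for v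
  proof -
    have "\<forall>\<^sub>F z in nhds (p v). \<forall>f\<in>Fs. (f z + \<eta> > 0 \<longleftrightarrow> f (p v) \<ge> 0) \<and> f z + \<eta> \<noteq> 0"
      using finFs ev that by (intro eventually_ball_finite) auto
    then show ?thesis unfolding eventually_nhds_metric .
  qed
  then have "\<exists>d. \<forall>v\<in>V. d v > 0 \<and> (\<forall>z. dist z (p v) < d v \<longrightarrow> (\<forall>f\<in>Fs. (f z + \<eta> > 0 \<longleftrightarrow> f (p v) \<ge> 0) \<and> f z + \<eta> \<noteq> 0))"
    by (intro bchoice ballI)
  then obtain d where d: "\<forall>v\<in>V. d v > 0 \<and> (\<forall>z. dist z (p v) < d v \<longrightarrow> (\<forall>f\<in>Fs. (f z + \<eta> > 0 \<longleftrightarrow> f (p v) \<ge> 0) \<and> f z + \<eta> \<noteq> 0))" ..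
  define \<epsilon> where "\<epsilon> = Min (insert 1 (d ` V))"
  have "\<epsilon> > 0" unfolding \<epsilon>_def using V d by (subst Min_gr_iff) auto
  from generic_perturbation[OF V this, of p q]
  obtain x where x: "\<forall>v\<in>V. dist (p v) (x v) < \<epsilon>" "generic q x V" by (elim exE conjE)
  have near: "(f (x v) + \<eta> > 0 \<longleftrightarrow> f (p v) \<ge> 0) \<and> f (x v) + \<eta> \<noteq> 0" if "v \<in> V" "f \<in> Fs" for v f
  proof -
    have "\<epsilon> \<le> d v" unfolding \<epsilon>_def using V that by (intro Min_le) auto
    then have "dist (x v) (p v) < d v" using bspec[OF x(1) that(1)] by (simp add: dist_commute)
    then show ?thesis using bspec[OF d that(1)] that(2) by blast
  qed
  have P: "\<exists>fs B. length fs \<le> b \<and> (\<forall>f\<in>set fs. polynomial_deg_le b f \<and> (\<forall>v\<in>V. f (x v) \<noteq> 0)) \<and>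
     (\<forall>v\<in>V. p v \<in> S u \<longleftrightarrow> B (map (\<lambda>f. f (x v) > 0) fs))" if u: "u \<in> U" for u
  proof -
    from bspec[OF F u] obtain B where B: "length (F u) \<le> b" "\<forall>f\<in>set (F u). polynomial_deg_le b f"
      "S u = {x. B (map (\<lambda>f. f x \<ge> 0) (F u))}" by (elim exE conjE)
    let ?fs = "map (\<lambda>f z. f z + \<eta>) (F u)"
    have sub: "f \<in> Fs" if "f \<in> set (F u)" for f using that u by (auto simp: Fs_def)
    have "polynomial_deg_le b f \<and> (\<forall>v\<in>V. f (x v) \<noteq> 0)" if f: "f \<in> set ?fs" for f
    proof -
      obtain f0 where f0: "f0 \<in> set (F u)" "f = (\<lambda>z. f0 z + \<eta>)" using f by auto
      have "polynomial_deg_le b f"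
        unfolding f0(2) using B(2) f0(1) by (intro polynomial_deg_le_add polynomial_deg_le_const) blast
      moreover have "\<forall>v\<in>V. f (x v) \<noteq> 0" using near[OF _ sub[OF f0(1)]] f0(2) by simp
      ultimately show ?thesis ..
    qed
    moreover have "p v \<in> S u \<longleftrightarrow> B (map (\<lambda>f. f (x v) > 0) ?fs)" if v: "v \<in> V" for v
    proof -
      have eq: "map (\<lambda>f. f (p v) \<ge> 0) (F u) = map (\<lambda>f. f (x v) > 0) ?fs"
        using near[OF v sub] by (simp add: o_def)
      have "p v \<in> S u \<longleftrightarrow> B (map (\<lambda>f. f (p v) \<ge> 0) (F u))" unfolding B(3) by (rule mem_Collect_eq)
      then show ?thesis by (simp only: eq)
    qed
    ultimately show ?thesis using B(1) by (intro exI[of _ ?fs] exI[of _ B]) simp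
  qed
  show ?thesis by (intro exI[of _ x] conjI ballI x(2)) (erule P)
qed

text \<open>\<open>B\<close> precedes the objects in the order of the quantifiers: it is fixed once
  the dimension, the object type, \<open>l\<close>, \<open>b\<close> and \<open>\<delta>\<close> are
  given.\<close>

lemma hub_cover_semialgebraic:
  fixes l b :: nat and \<delta> \<beta> :: real
  assumes \<delta>: "0 < \<delta>" "\<delta> \<le> 1" and \<beta>: "\<beta> = (real CARD('D::finite) - 1) / (2 * real CARD('D) - 1)"
  shows "\<exists>B\<ge>1. \<forall>(V :: 'o set) (p :: nat \<Rightarrow> 'o \<Rightarrow> real ^ 'D) S \<Phi> U Q. finite V \<longrightarrow>
    (\<forall>v\<in>V. \<forall>i\<in>{1..l}. semialgebraic_complexity_le b (S i v)) \<longrightarrow> U \<subseteq> V \<longrightarrow> Q \<subseteq> V \<longrightarrow>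
    hub_cover (\<lambda>u v. \<Phi> (map (\<lambda>i. p i v \<in> S i u) [1..<Suc l])) U Q
      (B * (real (card Q) powr (2 * \<beta> + \<delta>) * real (card U) powr (1 - \<beta>) + real (card Q) powr (1 + \<delta>)) + 2 * real (card U))"
proof -
  let ?D = "CARD('D)"
  have D: "?D \<ge> 1" by (simp add: Suc_le_eq)
  \<comment> \<open>Makes \<open>C * s * q\<close> an upper bound for the base of the power
    \<open>M\<close>.\<close>
  define C where "C = ?D * ?D * (2 * (b * b) + 3)"
  obtain s :: nat where s: "s \<ge> 1" "real C * real s * (2 ^ s) powr (- \<delta>) \<le> 1 / 16"
    using partition_scale_exists[OF \<delta>(1), of "real C"] by (elim exE conjE)
  \<comment> \<open>A power of two, so that the sign partition has exactly \<open>q ^ ?D\<close>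
    labels available. \<open>T\<close> equals the degree of its polynomial: the greedy
    multiplications then raise the degree only by a constant factor, while \<open>\<kappa>\<close>
    is at most \<open>M / q\<close>.\<close>
  define q where "q = (2::nat) ^ s"
  define J where "J = ?D * s"
  define T where "T = J * (?D * q)"
  define M where "M = (2 * (T + T * (b * b)) + 1) ^ ?D"
  define m0 where "m0 = 2 ^ J * (2 * (q + 1) ^ ?D)"
  define \<mu> where "\<mu> = 2 / (2::real) ^ J"
  define \<kappa> where "\<kappa> = real M / real T"
  have q: "q \<ge> 1" by (simp add: q_def)
  have "1 * 1 * (1 * 1) \<le> ?D * s * (?D * q)" using D s(1) q by (intro mult_le_mono)
  then have T: "T \<ge> 1" by (simp add: T_def J_def)
  have "1 * 1 * (1 * q) \<le> ?D * s * (?D * q)" using D s(1) by (intro mult_le_mono) auto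
  then have Tq: "q \<le> T" by (simp add: T_def J_def)
  have MC: "M \<le> (C * s * q) ^ ?D"
  proof -
    have "2 * (T + T * (b * b)) + 1 \<le> 2 * (T + T * (b * b)) + T" using T by simp
    also have "\<dots> = C * s * q" by (simp add: C_def T_def J_def algebra_simps)
    finally show ?thesis unfolding M_def by (rule power_mono) simp
  qed
  have qD: "2 ^ J = q ^ ?D" by (simp add: q_def J_def power_mult mult.commute)
  have J: "2 ^ J \<le> (q + 1) ^ ?D" unfolding qD by (intro power_mono) auto
  have "1 * 1 * (1 * 1) \<le> ?D * ?D * (2 * (b * b) + 3) * s" using D s(1) by (intro mult_le_mono) auto
  then have CS: "real C * real s \<ge> 1" unfolding C_def by (simp flip: of_nat_mult)
  have small: "real C * real s * real q powr (- \<delta>) \<le> 1 / 16" using s(2) by (simp add: q_def)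
  have \<mu>q: "\<mu> = 2 / real q ^ ?D" unfolding \<mu>_def using arg_cong[OF qD, of real] by simp
  have M1: "real M \<le> (real C * real s * real q) ^ ?D" using MC by (simp flip: of_nat_mult of_nat_power)
  have \<kappa>1: "\<kappa> \<le> (real C * real s * real q) ^ ?D / real q"
    unfolding \<kappa>_def using M1 Tq q by (intro frac_le) auto
  have \<kappa>0: "\<kappa> \<ge> 0" by (simp add: \<kappa>_def)
  have q1: "real q \<ge> 1" using q by simp
  note contr = contraction_bound[OF D \<delta> q1 CS small \<beta> \<mu>q _ M1 \<kappa>0 \<kappa>1]
  have \<mu>0: "\<mu> > 0" by (simp add: \<mu>_def)
  have "\<mu> < 1"
  proof (rule ccontr)
    assume "\<not> \<mu> < 1"
    then have "\<mu> powr \<delta> \<ge> 1" using \<delta> by (intro ge_one_powr_ge_zero) auto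
    then show False using contr(2) by simp
  qed
  have "real 1 \<le> real ?D" using D by (simp only: of_nat_le_iff)
  moreover have "0 \<le> (r - 1) / (2 * r - 1) \<and> (r - 1) / (2 * r - 1) < 1" if "r \<ge> real 1" for r
    using that by (auto simp: divide_less_eq)
  ultimately have \<beta>01: "0 \<le> \<beta>" "\<beta> < 1" unfolding \<beta> by blast+
  have M0: "M \<ge> 1" by (simp add: M_def)
  interpret partition_recursion m0 M \<mu> \<kappa> \<beta> \<delta>
    using M0 \<mu>0 \<open>\<mu> < 1\<close> \<kappa>0 \<beta>01 \<delta>(1) contr by unfold_locales simp_all
  from hub_cover_well_partitioned[where l = l and 'u = 'o and 'v = 'o]
  obtain B where B: "B \<ge> 1" "\<forall>(As :: ('o \<Rightarrow> 'o \<Rightarrow> bool) list) \<Phi> U Q. length As = l \<longrightarrow> finite U \<longrightarrow> finite Q \<longrightarrow>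
     (\<forall>A\<in>set As. well_partitioned m0 \<mu> M \<kappa> A U Q) \<longrightarrow>
     hub_cover (\<lambda>u v. \<Phi> (map (\<lambda>A. A u v) As)) U Q
       (B * (\<Psi> (card Q) (card U) + real (card Q) powr (1 + \<delta>)) + 2 * real (card U))"
    by (elim exE conjE)
  have main: "hub_cover (\<lambda>u v. \<Phi> (map (\<lambda>i. p i v \<in> S i u) [1..<Suc l])) U Q
      (B * (real (card Q) powr (2 * \<beta> + \<delta>) * real (card U) powr (1 - \<beta>) + real (card Q) powr (1 + \<delta>)) + 2 * real (card U))"
    if V: "finite V" and S: "\<forall>v\<in>V. \<forall>i\<in>{1..l}. semialgebraic_complexity_le b (S i v)" and UQ: "U \<subseteq> V" "Q \<subseteq> V"
    for V :: "'o set" and p :: "nat \<Rightarrow> 'o \<Rightarrow> real ^ 'D" and S \<Phi> U Q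
  proof -
    define As where "As = map (\<lambda>i u v. p i v \<in> S i u) [1..<Suc l]"
    have len: "length As = l" by (simp add: As_def)
    have "well_partitioned m0 \<mu> M \<kappa> A U Q" if A: "A \<in> set As" for A
    proof -
      from A[unfolded As_def set_map] obtain i
        where i': "A = (\<lambda>u v. p i v \<in> S i u)" "i \<in> set [1..<Suc l]" by (rule imageE)
      then have i: "i \<in> {1..l}" "A = (\<lambda>u v. p i v \<in> S i u)" by auto
      have Si: "semialgebraic_complexity_le b (S i u)" if "u \<in> V" for u using S that i(1) by blast
      \<comment> \<open>Every index \<open>i\<close> gets its own generic points, since the
        recursion sees only the predicates.\<close>
      have "\<exists>x :: 'o \<Rightarrow> real ^ 'D. generic q x V \<and> (\<forall>u\<in>V. \<exists>fs B. length fs \<le> b \<and>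
         (\<forall>f\<in>set fs. polynomial_deg_le b f \<and> (\<forall>v\<in>V. f (x v) \<noteq> 0)) \<and>
         (\<forall>v\<in>V. p i v \<in> S i u \<longleftrightarrow> B (map (\<lambda>f. f (x v) > 0) fs)))"
        by (rule semialgebraic_perturbation[OF V V]) (erule Si)
      then obtain x :: "'o \<Rightarrow> real ^ 'D" where x: "generic q x V" "\<forall>u\<in>V. \<exists>fs B. length fs \<le> b \<and>
         (\<forall>f\<in>set fs. polynomial_deg_le b f \<and> (\<forall>v\<in>V. f (x v) \<noteq> 0)) \<and>
         (\<forall>v\<in>V. p i v \<in> S i u \<longleftrightarrow> B (map (\<lambda>f. f (x v) > 0) fs))" by (elim exE conjE)
      have "well_partitioned m0 \<mu> M \<kappa> A V V"
        unfolding m0_def \<mu>_def \<kappa>_def i(2)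
      proof (rule well_partitioned_semialgebraic[OF V x(1) J T, where b = b])
        show "\<exists>fs B. length fs \<le> b \<and> (\<forall>f\<in>set fs. polynomial_deg_le b f \<and> (\<forall>v\<in>V. f (x v) \<noteq> 0)) \<and>
         (\<forall>v\<in>V. p i v \<in> S i u \<longleftrightarrow> B (map (\<lambda>f. f (x v) > 0) fs))" if "u \<in> V" for u
          using bspec[OF x(2) that] .
        show "M = (2 * (J * (?D * q) + T * (b * b)) + 1) ^ ?D" by (simp add: M_def flip: T_def)
      qed
      then show ?thesis using UQ by (rule well_partitioned_mono)
    qed
    moreover have "finite U" "finite Q" using UQ V finite_subset by blast+
    ultimately have "hub_cover (\<lambda>u v. \<Phi> (map (\<lambda>A. A u v) As)) U Q
       (B * (\<Psi> (card Q) (card U) + real (card Q) powr (1 + \<delta>)) + 2 * real (card U))"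
      by (intro B(2)[rule_format, OF len])
    then show ?thesis unfolding \<Psi>_def As_def by (simp add: o_def del: upt_Suc)
  qed
  show ?thesis
    by (intro exI[of _ B] conjI allI impI B(1)) (rule main)
qed

subsection \<open>Spanners\<close>

lemma hop_dist_edge:
  assumes "(x, y) \<in> {(a, b). {a, b} \<in> E} ^^ k"
  shows "hop_dist E x y \<le> enat k"
  unfolding hop_dist_def using assms by (intro INF_lower) simp

lemma hop_dist_attained:
  "hop_dist E x y = \<infinity> \<or> (\<exists>k. (x, y) \<in> {(a, b). {a, b} \<in> E} ^^ k \<and> hop_dist E x y = enat k)"
proof (cases "{k. (x, y) \<in> {(a, b). {a, b} \<in> E} ^^ k} = {}")
  case True
  then have "hop_dist E x y = \<infinity>" unfolding hop_dist_def True by (simp add: top_enat_def)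
  then show ?thesis ..
next
  case False
  define K where "K = {k. (x, y) \<in> {(a, b). {a, b} \<in> E} ^^ k}"
  have "\<exists>k. k \<in> K" using False unfolding K_def[symmetric] by (simp only: ex_in_conv not_False_eq_True)
  then obtain k where k: "k \<in> K" ..
  have ne: "enat ` K \<noteq> {}" using imageI[OF k, of enat] by (intro notI) (simp only: empty_iff)
  have "(LEAST z. z \<in> enat ` K) \<in> enat ` K" using imageI[OF k] by (rule LeastI)
  then have "Inf (enat ` K) \<in> enat ` K" unfolding Inf_enat_def if_not_P[OF ne] .
  then obtain j where "Inf (enat ` K) = enat j" "j \<in> K" by (rule imageE)
  then have "(x, y) \<in> {(a, b). {a, b} \<in> E} ^^ j \<and> hop_dist E x y = enat j"
    by (simp only: hop_dist_def K_def mem_Collect_eq)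
  then have "\<exists>k. (x, y) \<in> {(a, b). {a, b} \<in> E} ^^ k \<and> hop_dist E x y = enat k" ..
  then show ?thesis ..
qed

text \<open>Replacing the edges of a walk one by one at most doubles its length, so it suffices to
  bridge single edges.\<close>

lemma hop_spanner_2I:
  assumes sub: "E' \<subseteq> E"
    and short: "\<And>a b. {a, b} \<in> E \<Longrightarrow> {a, b} \<in> E' \<or> (\<exists>c. {a, c} \<in> E' \<and> {c, b} \<in> E')"
  shows "hop_spanner 2 V E E'"
proof -
  let ?R = "{(a, b). {a, b} \<in> E}" and ?R' = "{(a, b). {a, b} \<in> E'}"
  have walk: "\<exists>j\<le>2 * k. (x, y) \<in> ?R' ^^ j" if "(x, y) \<in> ?R ^^ k" for k x y
    using that
  proof (induction k arbitrary: y)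
    case (Suc k)
    then obtain z where z: "(x, z) \<in> ?R ^^ k" "{z, y} \<in> E" by auto
    obtain j where j: "j \<le> 2 * k" "(x, z) \<in> ?R' ^^ j" using Suc.IH[OF z(1)] by blast
    from short[OF z(2)] show ?case
    proof
      assume "{z, y} \<in> E'"
      then have "(x, y) \<in> ?R' ^^ Suc j" using j(2) by auto
      then show ?thesis using j(1) by (intro exI[of _ "Suc j"]) simp
    next
      assume "\<exists>c. {z, c} \<in> E' \<and> {c, y} \<in> E'"
      then obtain c where c: "{z, c} \<in> E'" "{c, y} \<in> E'" by blast
      have "(x, c) \<in> ?R' ^^ Suc j" using j(2) c(1) by auto
      then have "(x, y) \<in> ?R' ^^ Suc (Suc j)" using c(2) by (auto simp del: relpow.simps(2) intro: relpow_Suc_I)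
      then show ?thesis using j(1) by (intro exI[of _ "Suc (Suc j)"]) simp
    qed
  qed auto
  have "hop_dist E' x y \<le> enat 2 * hop_dist E x y" for x y
    using hop_dist_attained[of E x y]
  proof
    assume "hop_dist E x y = \<infinity>"
    moreover have "enat 2 * \<infinity> = \<infinity>" by (subst times_enat_simps) simp
    ultimately show ?thesis by (simp only: enat_ord_simps)
  next
    assume "\<exists>k. (x, y) \<in> ?R ^^ k \<and> hop_dist E x y = enat k"
    then obtain k where k: "(x, y) \<in> ?R ^^ k" "hop_dist E x y = enat k" by blast
    obtain j where j: "j \<le> 2 * k" "(x, y) \<in> ?R' ^^ j" using walk[OF k(1)] by blast
    have "hop_dist E' x y \<le> enat j" using j(2) by (rule hop_dist_edge)
    also have "\<dots> \<le> enat (2 * k)" using j(1) by simp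
    finally show ?thesis by (simp add: k(2))
  qed
  then show ?thesis using sub by (simp add: hop_spanner_def)
qed

lemma hub_cover_imp_edges:
  assumes hc: "hub_cover R U Q c" and sub: "U \<subseteq> V" "Q \<subseteq> V"
    and clique: "\<And>v w. v \<in> Q \<Longrightarrow> w \<in> Q \<Longrightarrow> v \<inter> w \<noteq> {}"
    and R: "\<And>u v. u \<in> U \<Longrightarrow> v \<in> Q \<Longrightarrow> u \<noteq> v \<Longrightarrow> R u v \<longleftrightarrow> u \<inter> v \<noteq> {}"
  shows "\<exists>E'. finite E' \<and> E' \<subseteq> intersection_edges V \<and> real (card E') \<le> c \<and>
    (\<forall>u\<in>U. \<forall>w\<in>Q. u \<noteq> w \<longrightarrow> u \<inter> w \<noteq> {} \<longrightarrow> {u, w} \<in> E' \<or> (\<exists>v. {u, v} \<in> E' \<and> {v, w} \<in> E'))"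
proof -
  from hc[unfolded hub_cover_def] obtain E F where EF: "E \<subseteq> {(u, v). u \<in> U \<and> v \<in> Q \<and> R u v}" "F \<subseteq> Q \<times> Q"
    "finite E" "finite F" "real (card E) + real (card F) \<le> c"
    "\<forall>u\<in>U. \<forall>w\<in>Q. R u w \<longrightarrow> (\<exists>v. (u, v) \<in> E \<and> (v = w \<or> (v, w) \<in> F))"
    by (elim exE conjE)
  define E' where "E' = (\<lambda>(a, b). {a, b}) ` {(a, b) \<in> E \<union> F. a \<noteq> b}"
  have fin: "finite {(a, b) \<in> E \<union> F. a \<noteq> b}" using EF(3,4) by (auto intro: finite_subset[of _ "E \<union> F"])
  have I: "{a, b} \<in> E'" if "(a, b) \<in> E \<union> F" "a \<noteq> b" for a b
    unfolding E'_def using that by (intro image_eqI[of _ _ "(a, b)"]) auto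
  have "card E' \<le> card {(a, b) \<in> E \<union> F. a \<noteq> b}" unfolding E'_def by (rule card_image_le[OF fin])
  also have "\<dots> \<le> card (E \<union> F)" using EF(3,4) by (intro card_mono) auto
  also have "\<dots> \<le> card E + card F" by (rule card_Un_le)
  finally have cE: "real (card E') \<le> c" using EF(5) by linarith
  have sE: "E' \<subseteq> intersection_edges V"
  proof
    fix e assume "e \<in> E'"
    then obtain a b where ab: "e = {a, b}" "(a, b) \<in> E \<union> F" "a \<noteq> b" by (auto simp: E'_def)
    from ab(2) have "a \<in> V \<and> b \<in> V \<and> a \<inter> b \<noteq> {}"
    proof
      assume "(a, b) \<in> E"
      then have "a \<in> U" "b \<in> Q" "R a b" using EF(1) by auto
      then show ?thesis using R[of a b] ab(3) sub by blast
    next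
      assume "(a, b) \<in> F"
      then have "a \<in> Q" "b \<in> Q" using EF(2) by auto
      then show ?thesis using clique[of a b] sub by blast
    qed
    then show "e \<in> intersection_edges V" unfolding intersection_edges_def using ab(1,3) by blast
  qed
  have shE: "{u, w} \<in> E' \<or> (\<exists>v. {u, v} \<in> E' \<and> {v, w} \<in> E')"
    if uw: "u \<in> U" "w \<in> Q" "u \<noteq> w" "u \<inter> w \<noteq> {}" for u w
  proof -
    have "R u w" using R uw by blast
    then obtain v where v: "(u, v) \<in> E" "v = w \<or> (v, w) \<in> F" using EF(6) uw(1,2) by blast
    show ?thesis
    \<comment> \<open>\<open>R\<close> is unspecified on the diagonal, so the hub may be
      \<open>u\<close> itself; then \<open>F\<close> already contains the pair.\<close>
    proof (cases "v = w \<or> v = u")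
      case True
      then have "(u, w) \<in> E \<union> F" using v by auto
      then show ?thesis using I uw(3) by blast
    next
      case False
      then have "{u, v} \<in> E'" "{v, w} \<in> E'" using v by (auto intro!: I)
      then show ?thesis by blast
    qed
  qed
  have "finite E'" using fin by (simp add: E'_def)
  then show ?thesis using cE sE shE by (intro exI[of _ E'] conjI ballI impI)
qed

section \<open>Counting the edges\<close>

text \<open>With both sizes replaced by their maximum, the exponents add up to 1 + \<beta> +
  \<delta>. One factor is kept, to be summed over the groups; the others are bounded by powers of
  \<open>N\<close>.\<close>

lemma group_cost_le:
  fixes m n N :: nat and B \<beta> \<delta> :: real
  assumes mn: "m \<le> N" "n \<le> N" and \<beta>: "0 \<le> \<beta>" "\<beta> \<le> 1" and \<delta>: "0 \<le> \<delta>" and B: "0 \<le> B"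
  shows "B * (real m powr (2 * \<beta> + \<delta>) * real n powr (1 - \<beta>) + real m powr (1 + \<delta>)) + 2 * real n
    \<le> (2 * B + 2) * real N powr (\<beta> + \<delta>) * real (n + m)"
proof (cases "N = 0")
  case True
  then show ?thesis using mn by simp
next
  case False
  then have N: "real N \<ge> 1" by simp
  define K where "K = real N powr (\<beta> + \<delta>)"
  define t where "t = real (max m n)"
  have K: "K \<ge> 1" unfolding K_def using N \<beta> \<delta> by (intro ge_one_powr_ge_zero) auto
  have t: "0 \<le> t" "t \<le> real N" "real m \<le> t" "real n \<le> t" "t \<le> real (n + m)" using mn by (auto simp: t_def)
  have "real m powr (2 * \<beta> + \<delta>) * real n powr (1 - \<beta>) \<le> t powr (2 * \<beta> + \<delta>) * t powr (1 - \<beta>)"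
    using t \<beta> \<delta> by (intro mult_mono powr_mono2) auto
  also have "\<dots> = t powr (1 + (\<beta> + \<delta>))" unfolding powr_add[symmetric] by (rule arg_cong[where f = "(powr) t"]) simp
  also have "\<dots> = t * t powr (\<beta> + \<delta>)" using t(1) by (simp only: powr_add powr_one)
  also have "\<dots> \<le> real (n + m) * K" unfolding K_def using t \<beta> \<delta> by (intro mult_mono powr_mono2) auto
  finally have 1: "real m powr (2 * \<beta> + \<delta>) * real n powr (1 - \<beta>) \<le> real (n + m) * K" .
  have "real m powr \<delta> \<le> real N powr \<delta>" using mn \<delta> by (intro powr_mono2) auto
  also have "\<dots> \<le> K" unfolding K_def using N \<beta> by (intro powr_mono) auto
  finally have "real m powr \<delta> \<le> K" .
  then have "real m * real m powr \<delta> \<le> real (n + m) * K" by (intro mult_mono) auto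
  then have 2: "real m powr (1 + \<delta>) \<le> real (n + m) * K" by (simp only: powr_add powr_one of_nat_0_le_iff)
  have "real n * 1 \<le> real (n + m) * K" using K by (intro mult_mono) auto
  then have 3: "2 * real n \<le> 2 * (real (n + m) * K)" by simp
  have "B * (real m powr (2 * \<beta> + \<delta>) * real n powr (1 - \<beta>) + real m powr (1 + \<delta>))
      \<le> B * (real (n + m) * K + real (n + m) * K)"
    using B 1 2 by (intro mult_left_mono add_mono)
  then show ?thesis using 3 unfolding K_def[symmetric] by (simp add: algebra_simps)
qed

text \<open>The number of levels is logarithmic, and the logarithm is bounded by a small power of
  \<open>N\<close>. The summand \<open>3 * real d\<close> stems from 5 \<le> 2^3.\<close>

lemma dyadic_level_exists:
  fixes N d :: nat and \<delta> :: real
  assumes N: "N \<ge> 1" and \<delta>: "0 < \<delta>"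
  shows "\<exists>h. 5 ^ d * N < 2 ^ h \<and> real h \<le> (3 * real d + 1 + 1 / (\<delta> * ln 2)) * real N powr \<delta>"
proof -
  define L where "L = (LEAST L. N < 2 ^ L)"
  have L: "N < 2 ^ L" unfolding L_def by (rule LeastI) (rule less_exp)
  have L0: "L \<noteq> 0"
  proof
    assume "L = 0"
    then show False using L N by simp
  qed
  then have "\<not> N < 2 ^ (L - 1)" unfolding L_def by (intro not_less_Least) simp
  then have "real (2 ^ (L - 1)) \<le> real N" by (simp only: not_less of_nat_le_iff)
  then have "ln ((2::real) ^ (L - 1)) \<le> ln (real N)" using N by simp
  then have "real (L - 1) * ln 2 \<le> ln (real N)" by (simp add: ln_realpow)
  also have "\<dots> \<le> real N powr \<delta> / \<delta>" using N \<delta> by (intro ln_powr_bound) auto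
  finally have 1: "real (L - 1) \<le> 1 / (\<delta> * ln 2) * real N powr \<delta>" using \<delta> by (simp add: field_simps)
  have "1 \<le> real N powr \<delta>" using N \<delta> by (intro ge_one_powr_ge_zero) auto
  then have 2: "(3 * real d + 1) * 1 \<le> (3 * real d + 1) * real N powr \<delta>" by (intro mult_left_mono) auto
  have "real (L + 3 * d) = real (L - 1) + (3 * real d + 1)" using L0 by simp
  moreover have "X \<le> (x + y) * z" if "X = w + x" "w \<le> y * z" "x * 1 \<le> x * z" for X w x y z :: real
    using that unfolding distrib_right by linarith
  ultimately have "real (L + 3 * d) \<le> (3 * real d + 1 + 1 / (\<delta> * ln 2)) * real N powr \<delta>"
    using 1 2 by metis
  moreover have "5 ^ d * N < 2 ^ (L + 3 * d)"
  proof -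
    have "5 ^ d * N \<le> (8::nat) ^ d * N" by (intro mult_right_mono power_mono) auto
    also have "\<dots> < 8 ^ d * 2 ^ L" using L by simp
    also have "(8::nat) ^ d = 2 ^ (3 * d)" by (simp add: power_mult)
    finally show ?thesis by (simp add: power_add mult.commute)
  qed
  ultimately show ?thesis by blast
qed

lemma spanner_from_groups:
  fixes V :: "'a set set"
  assumes fin: "finite \<G>"
    and grp: "\<And>g. g \<in> \<G> \<Longrightarrow> fst g \<subseteq> V \<and> snd g \<subseteq> V \<and> (\<forall>v\<in>snd g. \<forall>w\<in>snd g. v \<inter> w \<noteq> {})"
    and cov: "\<And>u v. u \<in> V \<Longrightarrow> v \<in> V \<Longrightarrow> u \<noteq> v \<Longrightarrow> u \<inter> v \<noteq> {} \<Longrightarrow>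
      \<exists>g\<in>\<G>. (u \<in> fst g \<and> v \<in> snd g) \<or> (v \<in> fst g \<and> u \<in> snd g)"
    and hc: "\<And>U Q. U \<subseteq> V \<Longrightarrow> Q \<subseteq> V \<Longrightarrow> hub_cover R U Q (k * real (card U + card Q))"
    and R: "\<And>u v. u \<in> V \<Longrightarrow> v \<in> V \<Longrightarrow> u \<noteq> v \<Longrightarrow> R u v \<longleftrightarrow> u \<inter> v \<noteq> {}"
  shows "\<exists>E'. hop_spanner 2 V (intersection_edges V) E' \<and>
    real (card E') \<le> k * real (\<Sum>g\<in>\<G>. card (fst g) + card (snd g))"
proof -
  have "\<exists>F. \<forall>g\<in>\<G>. finite (F g) \<and> F g \<subseteq> intersection_edges V \<and> real (card (F g)) \<le> k * real (card (fst g) + card (snd g)) \<and>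
    (\<forall>u\<in>fst g. \<forall>w\<in>snd g. u \<noteq> w \<longrightarrow> u \<inter> w \<noteq> {} \<longrightarrow> {u, w} \<in> F g \<or> (\<exists>v. {u, v} \<in> F g \<and> {v, w} \<in> F g))"
  proof (rule bchoice, rule ballI)
    fix g assume "g \<in> \<G>"
    note g' = grp[OF this]
    note g = conjunct1[OF g'] conjunct1[OF conjunct2[OF g']] conjunct2[OF conjunct2[OF g']]
    show "\<exists>E'. finite E' \<and> E' \<subseteq> intersection_edges V \<and> real (card E') \<le> k * real (card (fst g) + card (snd g)) \<and>
      (\<forall>u\<in>fst g. \<forall>w\<in>snd g. u \<noteq> w \<longrightarrow> u \<inter> w \<noteq> {} \<longrightarrow> {u, w} \<in> E' \<or> (\<exists>v. {u, v} \<in> E' \<and> {v, w} \<in> E'))"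
    proof (rule hub_cover_imp_edges[OF hc[OF g(1,2)] g(1,2)])
      show "v \<inter> w \<noteq> {}" if "v \<in> snd g" "w \<in> snd g" for v w
        using bspec[OF bspec[OF g(3) that(1)] that(2)] .
      show "R u v \<longleftrightarrow> u \<inter> v \<noteq> {}" if "u \<in> fst g" "v \<in> snd g" "u \<noteq> v" for u v
        using subsetD[OF g(1) that(1)] subsetD[OF g(2) that(2)] that(3) by (rule R)
    qed
  qed
  then obtain F where "\<forall>g\<in>\<G>. finite (F g) \<and> F g \<subseteq> intersection_edges V \<and> real (card (F g)) \<le> k * real (card (fst g) + card (snd g)) \<and>
    (\<forall>u\<in>fst g. \<forall>w\<in>snd g. u \<noteq> w \<longrightarrow> u \<inter> w \<noteq> {} \<longrightarrow> {u, w} \<in> F g \<or> (\<exists>v. {u, v} \<in> F g \<and> {v, w} \<in> F g))" ..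
  note F = bspec[OF this]
  have Fc: "real (card (F g)) \<le> k * real (card (fst g) + card (snd g))" if "g \<in> \<G>" for g
    using F[OF that] by (elim conjE)
  have Fsub: "F g \<subseteq> intersection_edges V" if "g \<in> \<G>" for g
    using F[OF that] by (elim conjE)
  have Fsh: "{u, w} \<in> F g \<or> (\<exists>v. {u, v} \<in> F g \<and> {v, w} \<in> F g)"
    if g: "g \<in> \<G>" and uw: "u \<in> fst g" "w \<in> snd g" "u \<noteq> w" "u \<inter> w \<noteq> {}" for g u w
    using bspec[OF bspec[OF conjunct2[OF conjunct2[OF conjunct2[OF F[OF g]]]] uw(1)] uw(2)] uw(3,4) by (elim impE)
  define E' where "E' = (\<Union>g\<in>\<G>. F g)"
  have FE: "e \<in> E'" if "g \<in> \<G>" "e \<in> F g" for g e unfolding E'_def using that by (rule UN_I)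
  have "hop_spanner 2 V (intersection_edges V) E'"
  proof (rule hop_spanner_2I)
    show "E' \<subseteq> intersection_edges V" unfolding E'_def using Fsub by (rule UN_least)
    fix a b assume "{a, b} \<in> intersection_edges V"
    then have ab: "a \<in> V" "b \<in> V" "a \<noteq> b" "a \<inter> b \<noteq> {}"
      unfolding intersection_edges_def by (auto simp: doubleton_eq_iff)
    from cov[OF ab] obtain g where g: "g \<in> \<G>" "(a \<in> fst g \<and> b \<in> snd g) \<or> (b \<in> fst g \<and> a \<in> snd g)" by (rule bexE)
    from g(2) show "{a, b} \<in> E' \<or> (\<exists>c. {a, c} \<in> E' \<and> {c, b} \<in> E')"
    proof
      assume as: "a \<in> fst g \<and> b \<in> snd g"
      from Fsh[OF g(1) conjunct1[OF as] conjunct2[OF as] ab(3,4)] show ?thesis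
        using FE[OF g(1)] by meson
    next
      assume as: "b \<in> fst g \<and> a \<in> snd g"
      have "b \<noteq> a" "b \<inter> a \<noteq> {}" using ab(3,4) by (auto simp: Int_commute)
      from Fsh[OF g(1) conjunct1[OF as] conjunct2[OF as] this]
      have "{b, a} \<in> E' \<or> (\<exists>v. {b, v} \<in> E' \<and> {v, a} \<in> E')" using FE[OF g(1)] by meson
      then have "{a, b} \<in> E' \<or> (\<exists>v. {v, b} \<in> E' \<and> {a, v} \<in> E')" by (simp only: insert_commute)
      then show ?thesis by meson
    qed
  qed
  moreover have "real (card E') \<le> k * real (\<Sum>g\<in>\<G>. card (fst g) + card (snd g))"
  proof -
    have "real (card E') \<le> real (\<Sum>g\<in>\<G>. card (F g))"
      unfolding E'_def of_nat_le_iff using fin by (rule card_UN_le)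
    also have "\<dots> = (\<Sum>g\<in>\<G>. real (card (F g)))" by (rule of_nat_sum)
    also have "\<dots> \<le> (\<Sum>g\<in>\<G>. k * real (card (fst g) + card (snd g)))" using Fc by (rule sum_mono)
    also have "\<dots> = k * real (\<Sum>g\<in>\<G>. card (fst g) + card (snd g))" by (simp only: sum_distrib_left of_nat_sum)
    finally show ?thesis .
  qed
  ultimately show ?thesis by (intro exI[of _ E'] conjI)
qed

lemma O_star_uniform_bound:
  fixes N :: "'x \<Rightarrow> nat" and a :: real
  assumes bound: "\<And>\<epsilon>. \<epsilon> > 0 \<Longrightarrow> \<exists>C\<ge>0. \<forall>x\<in>X. \<exists>E. good x E \<and> real (card E) \<le> C * real (N x) powr (a + \<epsilon>)"
  shows "\<exists>f\<in>O_star_powr a. \<forall>x\<in>X. \<exists>E. good x E \<and> real (card E) \<le> f (N x)"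
proof -
  \<comment> \<open>Countably many exponents that tend to 0 suffice.\<close>
  define e where "e k = 1 / (real k + 1)" for k
  have "\<exists>C. \<forall>k. C k \<ge> 0 \<and> (\<forall>x\<in>X. \<exists>E. good x E \<and> real (card E) \<le> C k * real (N x) powr (a + e k))"
    by (rule choice, rule allI, rule bound) (simp add: e_def)
  then obtain C where C: "\<forall>k. C k \<ge> 0 \<and> (\<forall>x\<in>X. \<exists>E. good x E \<and> real (card E) \<le> C k * real (N x) powr (a + e k))" ..
  have C0: "C k \<ge> 0" for k using spec[OF C] by (rule conjunct1)
  have C1: "\<forall>x\<in>X. \<exists>E. good x E \<and> real (card E) \<le> C k * real (N x) powr (a + e k)" for k
    using spec[OF C] by (rule conjunct2)
  \<comment> \<open>The infimum inherits every single bound and so belongs to the growth class of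
    each \<open>e k\<close>.\<close>
  define f where "f n = (INF k. C k * real n powr (a + e k))" for n
  have bdd: "bdd_below (range (\<lambda>k. C k * real n powr (a + e k)))" for n
    using C0 by (intro bdd_belowI2[of _ 0]) simp
  have f0: "f n \<ge> 0" for n unfolding f_def using C0 by (intro cINF_greatest) auto
  have "f \<in> O(\<lambda>n. real n powr (a + \<epsilon>))" if \<epsilon>: "\<epsilon> > 0" for \<epsilon>
  proof -
    from reals_Archimedean[OF \<epsilon>] obtain k where "inverse (real (Suc k)) < \<epsilon>" ..
    then have k: "e k \<le> \<epsilon>" by (simp add: e_def divide_inverse add.commute)
    have "norm (f n) \<le> C k * norm (real n powr (a + \<epsilon>))" for n
    proof -
      have "f n \<le> C k * real n powr (a + e k)" unfolding f_def using bdd by (rule cINF_lower) simp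
      also have "real n powr (a + e k) \<le> real n powr (a + \<epsilon>)"
        using k by (cases "n = 0") (auto intro: powr_mono)
      finally show ?thesis using f0[of n] C0[of k] by (simp add: mult_left_mono)
    qed
    then show ?thesis by (intro bigoI[of _ "C k"] always_eventually allI)
  qed
  then have "f \<in> O_star_powr a" by (simp add: O_star_powr_def)
  moreover have "\<exists>E. good x E \<and> real (card E) \<le> f (N x)" if x: "x \<in> X" for x
  proof -
    from bspec[OF C1[of 0] x] obtain E0 where "good x E0" by (elim exE conjE)
    from ex_has_least_nat[where P = "good x" and m = card, OF this] obtain E
      where E: "good x E" "\<forall>E'. good x E' \<longrightarrow> card E \<le> card E'" by (elim exE conjE)
    have "real (card E) \<le> C k * real (N x) powr (a + e k)" for k
    proof -
      from bspec[OF C1[of k] x] obtain E1 where E1: "good x E1" "real (card E1) \<le> C k * real (N x) powr (a + e k)"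
        by (elim exE conjE)
      have "card E \<le> card E1" using E(2) E1(1) by simp
      then show ?thesis using E1(2) by linarith
    qed
    then have "real (card E) \<le> f (N x)" unfolding f_def by (intro cINF_greatest) auto
    then show ?thesis using E(1) by (intro exI[of _ E] conjI)
  qed
  ultimately show ?thesis by (intro bexI[of _ f] ballI)
qed

text \<open>One \<open>\<delta>\<close> in the exponent comes from the partition recursion, the
  other from the number of levels in the decomposition into groups.\<close>

lemma fat_semialgebraic_spanner:
  fixes l c b :: nat and \<delta> \<beta> :: real
  assumes \<delta>: "0 < \<delta>" "\<delta> \<le> 1" and \<beta>: "\<beta> = (real CARD('D::finite) - 1) / (2 * real CARD('D) - 1)"
  shows "\<exists>C\<ge>0. \<forall>(V :: (real ^ 'd::finite) set set) (p :: nat \<Rightarrow> (real ^ 'd) set \<Rightarrow> real ^ 'D) S \<Phi>.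
    finite V \<longrightarrow> fat_family c V \<longrightarrow> (\<forall>v\<in>V. \<forall>i\<in>{1..l}. semialgebraic_complexity_le b (S i v)) \<longrightarrow>
    (\<forall>u\<in>V. \<forall>v\<in>V. u \<noteq> v \<longrightarrow> (u \<inter> v \<noteq> {} \<longleftrightarrow> \<Phi> (map (\<lambda>i. p i u \<in> S i v) [1..<Suc l]))) \<longrightarrow>
    (\<exists>E'. hop_spanner 2 V (intersection_edges V) E' \<and> real (card E') \<le> C * real (card V) powr (1 + \<beta> + 2 * \<delta>))"
proof -
  from hub_cover_semialgebraic[OF \<delta> \<beta>, where 'o = "(real ^ 'd) set" and l = l and b = b]
  obtain B where B: "B \<ge> 1" "\<forall>(V :: (real ^ 'd) set set) (p :: nat \<Rightarrow> (real ^ 'd) set \<Rightarrow> real ^ 'D) S \<Phi> U Q. finite V \<longrightarrow>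
    (\<forall>v\<in>V. \<forall>i\<in>{1..l}. semialgebraic_complexity_le b (S i v)) \<longrightarrow> U \<subseteq> V \<longrightarrow> Q \<subseteq> V \<longrightarrow>
    hub_cover (\<lambda>u v. \<Phi> (map (\<lambda>i. p i v \<in> S i u) [1..<Suc l])) U Q
      (B * (real (card Q) powr (2 * \<beta> + \<delta>) * real (card U) powr (1 - \<beta>) + real (card Q) powr (1 + \<delta>)) + 2 * real (card U))"
    by (elim exE conjE)
  define H where "H = 3 * real CARD('d) + 1 + 1 / (\<delta> * ln 2)"
  define C where "C = (2 * B + 2) * (real c * (2 * H * 5 ^ CARD('d)))"
  have H: "H \<ge> 0" using \<delta> by (simp add: H_def)
  have C: "C \<ge> 0" using B(1) H by (simp add: C_def)
  have "CARD('D) \<ge> 1" by (simp add: Suc_le_eq)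
  then have "real 1 \<le> real CARD('D)" by (simp only: of_nat_le_iff)
  moreover have "0 \<le> (r - 1) / (2 * r - 1) \<and> (r - 1) / (2 * r - 1) \<le> 1" if "r \<ge> real 1" for r
    using that by (auto simp: divide_le_eq)
  ultimately have \<beta>01: "0 \<le> \<beta>" "\<beta> \<le> 1" unfolding \<beta> by blast+
  have main: "\<exists>E'. hop_spanner 2 V (intersection_edges V) E' \<and> real (card E') \<le> C * real (card V) powr (1 + \<beta> + 2 * \<delta>)"
    if V: "finite V" and fat: "fat_family c V"
      and S: "\<forall>v\<in>V. \<forall>i\<in>{1..l}. semialgebraic_complexity_le b (S i v)"
      and \<Phi>: "\<forall>u\<in>V. \<forall>v\<in>V. u \<noteq> v \<longrightarrow> (u \<inter> v \<noteq> {} \<longleftrightarrow> \<Phi> (map (\<lambda>i. p i u \<in> S i v) [1..<Suc l]))"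
    for V :: "(real ^ 'd) set set" and p :: "nat \<Rightarrow> (real ^ 'd) set \<Rightarrow> real ^ 'D" and S \<Phi>
  proof (cases "V = {}")
    case True
    have "hop_spanner 2 V (intersection_edges V) {}"
      by (rule hop_spanner_2I) (simp_all add: intersection_edges_def True)
    then show ?thesis using C by (intro exI[of _ "{}"] conjI) simp_all
  next
    case False
    let ?N = "real (card V)"
    have N: "card V \<ge> 1" using V False by (simp add: Suc_le_eq card_gt_0_iff)
    from dyadic_level_exists[OF N \<delta>(1), of "CARD('d)"] obtain h
      where h: "5 ^ CARD('d) * card V < 2 ^ h" "real h \<le> H * ?N powr \<delta>" unfolding H_def by (elim exE conjE)
    define K where "K = (2 * B + 2) * ?N powr (\<beta> + \<delta>)"
    have K: "K \<ge> 0" using B(1) by (simp add: K_def)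
    from fat_groups[OF V fat h(1)] obtain \<G> where \<G>: "finite \<G>"
      "\<forall>g\<in>\<G>. fst g \<subseteq> V \<and> snd g \<subseteq> V \<and> (\<forall>v\<in>snd g. \<forall>w\<in>snd g. v \<inter> w \<noteq> {})"
      "\<forall>u\<in>V. \<forall>v\<in>V. u \<noteq> v \<longrightarrow> u \<inter> v \<noteq> {} \<longrightarrow> (\<exists>g\<in>\<G>. (u \<in> fst g \<and> v \<in> snd g) \<or> (v \<in> fst g \<and> u \<in> snd g))"
      "(\<Sum>g\<in>\<G>. card (fst g) + card (snd g)) \<le> c * (2 * h * (5 ^ CARD('d) * card V))"
      unfolding case_prod_beta by (elim exE conjE)
    have "\<exists>E'. hop_spanner 2 V (intersection_edges V) E' \<and>
      real (card E') \<le> K * real (\<Sum>g\<in>\<G>. card (fst g) + card (snd g))"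
    proof (rule spanner_from_groups[where R = "\<lambda>u v. \<Phi> (map (\<lambda>i. p i v \<in> S i u) [1..<Suc l])", OF \<G>(1)])
      show "fst g \<subseteq> V \<and> snd g \<subseteq> V \<and> (\<forall>v\<in>snd g. \<forall>w\<in>snd g. v \<inter> w \<noteq> {})" if "g \<in> \<G>" for g
        using \<G>(2) that by (rule bspec)
      show "\<exists>g\<in>\<G>. (u \<in> fst g \<and> v \<in> snd g) \<or> (v \<in> fst g \<and> u \<in> snd g)"
        if "u \<in> V" "v \<in> V" "u \<noteq> v" "u \<inter> v \<noteq> {}" for u v
        using mp[OF mp[OF bspec[OF bspec[OF \<G>(3) that(1)] that(2)] that(3)] that(4)] .
      \<comment> \<open>Here \<open>u\<close> supplies the range and \<open>v\<close> the point, the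
        reverse of the hypothesis; intersection is symmetric.\<close>
      show "\<Phi> (map (\<lambda>i. p i v \<in> S i u) [1..<Suc l]) \<longleftrightarrow> u \<inter> v \<noteq> {}" if "u \<in> V" "v \<in> V" "u \<noteq> v" for u v
        using mp[OF bspec[OF bspec[OF \<Phi> that(2)] that(1)] not_sym[OF that(3)]] by (simp only: Int_commute)
      show "hub_cover (\<lambda>u v. \<Phi> (map (\<lambda>i. p i v \<in> S i u) [1..<Suc l])) U Q (K * real (card U + card Q))"
        if UQ: "U \<subseteq> V" "Q \<subseteq> V" for U Q
      proof (rule hub_cover_mono)
        show "hub_cover (\<lambda>u v. \<Phi> (map (\<lambda>i. p i v \<in> S i u) [1..<Suc l])) U Q
          (B * (real (card Q) powr (2 * \<beta> + \<delta>) * real (card U) powr (1 - \<beta>) + real (card Q) powr (1 + \<delta>)) + 2 * real (card U))"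
          by (intro B(2)[rule_format, of V] V UQ bspec[OF bspec[OF S]])
        have "card Q \<le> card V" "card U \<le> card V" using UQ V by (auto intro: card_mono)
        then show "B * (real (card Q) powr (2 * \<beta> + \<delta>) * real (card U) powr (1 - \<beta>) + real (card Q) powr (1 + \<delta>)) + 2 * real (card U)
          \<le> K * real (card U + card Q)"
          unfolding K_def using \<beta>01 \<delta>(1) B(1) by (intro group_cost_le) auto
      qed
    qed
    then obtain E' where E': "hop_spanner 2 V (intersection_edges V) E'"
      "real (card E') \<le> K * real (\<Sum>g\<in>\<G>. card (fst g) + card (snd g))" by (elim exE conjE)
    note E'(2)
    also have "K * real (\<Sum>g\<in>\<G>. card (fst g) + card (snd g)) \<le> K * real (c * (2 * h * (5 ^ CARD('d) * card V)))"
      using \<G>(4) K by (intro mult_left_mono) (simp_all only: of_nat_le_iff)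
    also have "\<dots> = K * (real c * (2 * real h * (5 ^ CARD('d) * ?N)))" by simp
    also have "\<dots> \<le> K * (real c * (2 * (H * ?N powr \<delta>) * (5 ^ CARD('d) * ?N)))"
      using h(2) K by (intro mult_left_mono mult_right_mono) auto
    also have "\<dots> = C * (?N powr (\<beta> + \<delta>) * ?N powr \<delta> * ?N powr 1)" by (simp add: C_def K_def)
    also have "?N powr (\<beta> + \<delta>) * ?N powr \<delta> * ?N powr 1 = ?N powr (1 + \<beta> + 2 * \<delta>)"
      unfolding powr_add[symmetric] by (rule arg_cong[where f = "(powr) ?N"]) simp
    finally show ?thesis using E'(1) by (intro exI[of _ E'] conjI)
  qed
  show ?thesis by (intro exI[of _ C] conjI allI impI C) (rule main)
qed

theorem theorem3p6:
  fixes l c b :: nat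
  shows
    "(\<exists>f \<in> O_star_powr ((3 * real CARD('D) - 2) / (2 * real CARD('D) - 1)).
        \<forall>(V :: (real ^ 'd) set set)
         (p :: nat \<Rightarrow> (real ^ 'd) set \<Rightarrow> real ^ 'D)
         (S :: nat \<Rightarrow> (real ^ 'd) set \<Rightarrow> (real ^ 'D) set)
         (\<Phi> :: bool list \<Rightarrow> bool).
          finite V \<and> fat_family c V \<and>
          (\<forall>v\<in>V. \<forall>i\<in>{1..l}. semialgebraic_complexity_le b (S i v)) \<and>
          (\<forall>u\<in>V. \<forall>v\<in>V. u \<noteq> v \<longrightarrow>
             (u \<inter> v \<noteq> {} \<longleftrightarrow> \<Phi> (map (\<lambda>i. p i u \<in> S i v) [1..<Suc l])))
          \<longrightarrow> (\<exists>E'. hop_spanner 2 V (intersection_edges V) E' \<and>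
                    real (card E') \<le> f (card V)))
     \<and> O_star_powr ((3 * real CARD('D) - 2) / (2 * real CARD('D) - 1))
       = O_star_powr (3 / 2 - 1 / (2 * (2 * real CARD('D) - 1)))"
proof
  define \<beta> where "\<beta> = (real CARD('D) - 1) / (2 * real CARD('D) - 1)"
  define a where "a = (3 * real CARD('D) - 2) / (2 * real CARD('D) - 1)"
  have "CARD('D) \<ge> 1" by (simp add: Suc_le_eq)
  then have D: "real 1 \<le> real CARD('D)" by (simp only: of_nat_le_iff)
  have "1 + (r - 1) / (2 * r - 1) = (3 * r - 2) / (2 * r - 1)" if "r \<ge> real 1" for r :: real
    using that by (simp add: field_simps)
  from this[OF D] have a\<beta>: "1 + \<beta> = a" unfolding a_def \<beta>_def .
  define H where "H V p S \<Phi> \<longleftrightarrow> finite V \<and> fat_family c V \<and>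
    (\<forall>v\<in>V. \<forall>i\<in>{1..l}. semialgebraic_complexity_le b (S i v)) \<and>
    (\<forall>u\<in>V. \<forall>v\<in>V. u \<noteq> v \<longrightarrow> (u \<inter> v \<noteq> {} \<longleftrightarrow> \<Phi> (map (\<lambda>i. p i u \<in> S i v) [1..<Suc l])))"
    for V :: "(real ^ 'd) set set" and p :: "nat \<Rightarrow> (real ^ 'd) set \<Rightarrow> real ^ 'D" and S \<Phi>
  \<comment> \<open>The bound may depend on the number of objects only, so \<open>p\<close>,
    \<open>S\<close> and \<open>\<Phi>\<close> are hidden in the index set.\<close>
  have "\<exists>f\<in>O_star_powr a. \<forall>V\<in>{V. \<exists>p S \<Phi>. H V p S \<Phi>}. \<exists>E'. hop_spanner 2 V (intersection_edges V) E' \<and>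
    real (card E') \<le> f (card V)"
  proof (rule O_star_uniform_bound)
    fix \<epsilon> :: real assume \<epsilon>: "\<epsilon> > 0"
    define \<delta> where "\<delta> = min 1 (\<epsilon> / 2)"
    have \<delta>: "0 < \<delta>" "\<delta> \<le> 1" "2 * \<delta> \<le> \<epsilon>" using \<epsilon> by (auto simp: \<delta>_def)
    from fat_semialgebraic_spanner[OF \<delta>(1,2) \<beta>_def, where l = l and c = c and b = b and 'd = 'd]
    obtain C where C: "C \<ge> 0" "\<forall>(V :: (real ^ 'd) set set) (p :: nat \<Rightarrow> (real ^ 'd) set \<Rightarrow> real ^ 'D) S \<Phi>.
      finite V \<longrightarrow> fat_family c V \<longrightarrow> (\<forall>v\<in>V. \<forall>i\<in>{1..l}. semialgebraic_complexity_le b (S i v)) \<longrightarrow>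
      (\<forall>u\<in>V. \<forall>v\<in>V. u \<noteq> v \<longrightarrow> (u \<inter> v \<noteq> {} \<longleftrightarrow> \<Phi> (map (\<lambda>i. p i u \<in> S i v) [1..<Suc l]))) \<longrightarrow>
      (\<exists>E'. hop_spanner 2 V (intersection_edges V) E' \<and> real (card E') \<le> C * real (card V) powr (1 + \<beta> + 2 * \<delta>))"
      by (elim exE conjE)
    have mono: "C * real n powr (1 + \<beta> + 2 * \<delta>) \<le> C * real n powr (a + \<epsilon>)" for n
      using C(1) \<delta>(3) unfolding a\<beta> by (cases "n = 0") (auto intro!: mult_left_mono powr_mono)
    show "\<exists>C\<ge>0. \<forall>V\<in>{V. \<exists>p S \<Phi>. H V p S \<Phi>}. \<exists>E'. hop_spanner 2 V (intersection_edges V) E' \<and>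
      real (card E') \<le> C * real (card V) powr (a + \<epsilon>)"
    proof (intro exI[of _ C] conjI ballI C(1))
      fix V assume "V \<in> {V. \<exists>p S \<Phi>. H V p S \<Phi>}"
      then obtain p S \<Phi> where "H V p S \<Phi>" unfolding mem_Collect_eq by (elim exE)
      then have "\<exists>E'. hop_spanner 2 V (intersection_edges V) E' \<and> real (card E') \<le> C * real (card V) powr (1 + \<beta> + 2 * \<delta>)"
        unfolding H_def by (elim conjE) (rule C(2)[THEN spec, THEN spec, THEN spec, THEN spec, THEN mp, THEN mp, THEN mp, THEN mp])
      then obtain E' where "hop_spanner 2 V (intersection_edges V) E'"
        "real (card E') \<le> C * real (card V) powr (1 + \<beta> + 2 * \<delta>)" by (elim exE conjE)
      then show "\<exists>E'. hop_spanner 2 V (intersection_edges V) E' \<and> real (card E') \<le> C * real (card V) powr (a + \<epsilon>)"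
        using order_trans[OF _ mono] by (intro exI[of _ E'] conjI)
    qed
  qed
  then obtain f where f: "f \<in> O_star_powr a" "\<forall>V\<in>{V. \<exists>p S \<Phi>. H V p S \<Phi>}. \<exists>E'. hop_spanner 2 V (intersection_edges V) E' \<and>
    real (card E') \<le> f (card V)" by (rule bexE)
  show "\<exists>f \<in> O_star_powr ((3 * real CARD('D) - 2) / (2 * real CARD('D) - 1)).
        \<forall>(V :: (real ^ 'd) set set)
         (p :: nat \<Rightarrow> (real ^ 'd) set \<Rightarrow> real ^ 'D)
         (S :: nat \<Rightarrow> (real ^ 'd) set \<Rightarrow> (real ^ 'D) set)
         (\<Phi> :: bool list \<Rightarrow> bool).
          finite V \<and> fat_family c V \<and>
          (\<forall>v\<in>V. \<forall>i\<in>{1..l}. semialgebraic_complexity_le b (S i v)) \<and>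
          (\<forall>u\<in>V. \<forall>v\<in>V. u \<noteq> v \<longrightarrow>
             (u \<inter> v \<noteq> {} \<longleftrightarrow> \<Phi> (map (\<lambda>i. p i u \<in> S i v) [1..<Suc l])))
          \<longrightarrow> (\<exists>E'. hop_spanner 2 V (intersection_edges V) E' \<and>
                    real (card E') \<le> f (card V))"
    unfolding a_def[symmetric] H_def[symmetric]
  proof (intro bexI[of _ f] allI impI f(1))
    fix V p S \<Phi> assume "H V p S \<Phi>"
    then have "V \<in> {V. \<exists>p S \<Phi>. H V p S \<Phi>}" unfolding mem_Collect_eq by (intro exI)
    with f(2) show "\<exists>E'. hop_spanner 2 V (intersection_edges V) E' \<and> real (card E') \<le> f (card V)" by (rule bspec)
  qed
  have "(3 * r - 2) / (2 * r - 1) = 3 / 2 - 1 / (2 * (2 * r - 1))" if "r \<ge> real 1" for r :: real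
    using that by (simp add: field_simps)
  from this[OF D] show "O_star_powr ((3 * real CARD('D) - 2) / (2 * real CARD('D) - 1))
       = O_star_powr (3 / 2 - 1 / (2 * (2 * real CARD('D) - 1)))" by (rule arg_cong)
qed

end
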